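(* Let $1 \le k < n$ and $0 \le l \le k-1$, and let $f = f(x,z,p)$ be a positive $C^2$ function on $B_1 \times \mathbb{R} \times \mathbb{R}^n$. Suppose $u \in C^\infty(B_1)$ is an $(\eta,k)$-convex solution, i.e. $\lambda(\eta[u]) \in \Gamma_k$, of \[ \frac{\sigma_k(\eta[u])}{\sigma_l(\eta[u])} = f(x,u,Du), \quad x \in B_1 , \] where $B_1$ is the unit ball of $\mathbb{R}^n$. Then there exists $C > 0$ depending only on $n, k, l, \inf f, \|f\|_{C^2(B_1 \times \mathbb{R} \times \mathbb{R}^n)}$ and $\|u\|_{C^1(B_1)}$ such that \[ \sup_{B_{1/2}} |D^2 u| \le C . \]
   Context: $\sigma_j$ is the $j$-th elementary symmetric polynomial ($\sigma_0 = 1$), applied to a symmetric matrix via its eigenvalues $\lambda(\cdot)$; $\Gamma_k = \{x \in \mathbb{R}^n : \sigma_j(x) > 0, 1 \le j \le k\}$. For a $C^2$ function $u$, $\eta[u] = (\Delta u) I - D^2 u$, with $I$ the identity matrix. *)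

theory Defs
  imports "HOL-Analysis.Analysis"
begin

definition partial :: "'a::real_normed_vector \<Rightarrow> ('a \<Rightarrow> real) \<Rightarrow> 'a \<Rightarrow> real" where
  "partial b g x = deriv (\<lambda>t. g (x + t *\<^sub>R b)) 0"

fun cont_diff :: "nat \<Rightarrow> 'a::euclidean_space set \<Rightarrow> ('a \<Rightarrow> real) \<Rightarrow> bool" where
  "cont_diff 0 S g = continuous_on S g"
| "cont_diff (Suc m) S g = (continuous_on S g \<and> (\<forall>x\<in>S. g differentiable (at x))
      \<and> (\<forall>b\<in>Basis. cont_diff m S (partial b g)))"

definition smooth_on :: "'a::euclidean_space set \<Rightarrow> ('a \<Rightarrow> real) \<Rightarrow> bool" where
  "smooth_on S g \<longleftrightarrow> (\<forall>m. cont_diff m S g)"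

definition grad :: "(real^'n \<Rightarrow> real) \<Rightarrow> real^'n \<Rightarrow> real^'n" where
  "grad u x = (\<chi> i. partial (axis i 1) u x)"

definition hess :: "(real^'n \<Rightarrow> real) \<Rightarrow> real^'n \<Rightarrow> real^'n^'n" where
  "hess u x = (\<chi> i j. partial (axis j 1) (partial (axis i 1) u) x)"

definition laplacian :: "(real^'n \<Rightarrow> real) \<Rightarrow> real^'n \<Rightarrow> real" where
  "laplacian u x = (\<Sum>i\<in>UNIV. hess u x $ i $ i)"

definition eta :: "(real^'n \<Rightarrow> real) \<Rightarrow> real^'n \<Rightarrow> real^'n^'n" where
  "eta u x = laplacian u x *\<^sub>R mat 1 - hess u x"

definition diag_mat :: "real^'n \<Rightarrow> real^'n^'n" where
  "diag_mat v = (\<chi> i j. if i = j then v $ i else 0)"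

text \<open>Eigenvalue vector of a symmetric matrix (orthogonal diagonalisation; order irrelevant
  for the symmetric functions below).\<close>
definition eigvals :: "real^'n^'n \<Rightarrow> real^'n" where
  "eigvals A = (SOME v. \<exists>Q. orthogonal_matrix Q \<and> A = Q ** diag_mat v ** transpose Q)"

definition sigma :: "nat \<Rightarrow> real^'n \<Rightarrow> real" where
  "sigma j v = (\<Sum>S\<in>{S::'n set. card S = j}. \<Prod>i\<in>S. v $ i)"

definition Gamma :: "nat \<Rightarrow> (real^'n) set" where
  "Gamma k = {v. \<forall>j\<in>{1..k}. sigma j v > 0}"

definition sigma_mat :: "nat \<Rightarrow> real^'n^'n \<Rightarrow> real" where
  "sigma_mat j A = sigma j (eigvals A)"

definition C2_bounded_by :: "'a::euclidean_space set \<Rightarrow> ('a \<Rightarrow> real) \<Rightarrow> real \<Rightarrow> bool" where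
  "C2_bounded_by S g M \<longleftrightarrow> (\<forall>w\<in>S. \<bar>g w\<bar> \<le> M \<and> (\<forall>b\<in>Basis. \<bar>partial b g w\<bar> \<le> M)
      \<and> (\<forall>b\<in>Basis. \<forall>c\<in>Basis. \<bar>partial c (partial b g) w\<bar> \<le> M))"

end

theory Submission
  imports Defs "HOL-Computational_Algebra.Polynomial"
begin

text \<open>
  With \<open>q\<^sub>j = \<sigma>\<^sub>j / \<sigma>\<^sub>j\<^sub>-\<^sub>1\<close> one has \<open>\<sigma>\<^sub>k / \<sigma>\<^sub>l = q\<^sub>l\<^sub>+\<^sub>1 \<cdots> q\<^sub>k\<close>, and every \<open>q\<^sub>j\<close> has linear majorants
  touching it at any point of the cone; hence so has \<open>ln (\<sigma>\<^sub>k / \<sigma>\<^sub>l)\<close>, and a rearrangement argument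
  transfers this to symmetric matrices. In terms of \<open>D\<^sup>2 u\<close> the majorant has the coefficients
  \<open>a\<^sub>i = T - L\<^sub>i\<close>, where \<open>T\<close> is the trace of \<open>L\<close>. Because \<open>k < n\<close> they are all comparable to \<open>T\<close>, and
  \<open>T\<close> is bounded below: the equation is uniformly elliptic up to the factor \<open>T\<close>.

  Now maximize \<open>(9/16 - |x|\<^sup>2) u\<^sub>e\<^sub>e / (K - |Du|\<^sup>2)\<^sup>1\<^sup>/\<^sup>2\<close> over points \<open>x\<close> and unit vectors \<open>e\<close>. Differentiating
  the denominator produces \<open>\<Sum> a\<^sub>i |D u\<^sub>i|\<^sup>2\<close>, which is at least a multiple of \<open>T u\<^sub>e\<^sub>e\<^sup>2\<close>, whereas all other terms are at most
  linear in \<open>u\<^sub>e\<^sub>e\<close>, up to powers of the cutoff. As \<open>\<Delta>u > 0\<close>, upper bounds for \<open>u\<^sub>e\<^sub>e\<close> bound \<open>D\<^sup>2 u\<close>.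
\<close>

section \<open>Elementary symmetric functions\<close>

text \<open>Two obstacles shape the argument: eigenvalues need not be differentiable where they
  coincide, and no upper bound for \<open>T\<close> is available. Against the first, only
  \<open>u\<close> and \<open>f\<close> are ever differentiated: the linear majorant built at
  \<open>x0\<close> lies above the logarithm of the equation at all points, so along a line the
  difference has a minimum at \<open>x0\<close>. The second dictates the bookkeeping: the pure
  cutoff terms carry a factor \<open>T\<close>, the terms coming from \<open>f\<close> do not, and
  \<open>1 \<le> t0 * T\<close> makes the latter proportional to \<open>T\<close> before
  \<open>T\<close> is cancelled. Maximizing over directions as well makes \<open>w\<close>, the
  value of u_ee at \<open>x0\<close>, an upper bound for all pure second derivatives there; with
  positive Laplacian the whole Hessian at \<open>x0\<close> is O(w). Differentiating
  \<open>f\<close> twice produces |D u_e|^2 = O(w^2), linear after division by w, and the gradient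
  of u_ee, which the first order condition expresses through Du, D^2 u and the cutoff. The radius
  3/4 lies between 1/2 and 1, and \<open>K = M1\<^sup>2 + 1\<close> keeps K - |Du|^2 at least
  1.\<close>

text \<open>Read off the generating polynomial, the product of the 1 + x_i t, so that recursion and
  differentiation identities become polynomial arithmetic. The explicit index set permits deleting
  variables, the general ring permits complex ones.\<close>

definition esym :: "'i set \<Rightarrow> nat \<Rightarrow> ('i \<Rightarrow> 'a::comm_ring_1) \<Rightarrow> 'a" where
  "esym I j x = coeff (\<Prod>i\<in>I. [:1, x i:]) j"

lemma esym_0 [simp]: "esym I 0 x = 1"
  unfolding esym_def by (induct I rule: infinite_finite_induct) (auto simp: coeff_mult)

lemma esym_empty [simp]: "esym {} (Suc j) x = 0"
  by (simp add: esym_def)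

lemma esym_insert:
  assumes "finite I" "i \<notin> I"
  shows "esym (insert i I) (Suc j) x = esym I (Suc j) x + x i * esym I j x"
  using assms by (simp add: esym_def)

lemma esym_remove:
  assumes "finite I" "i \<in> I"
  shows "esym I (Suc j) x = esym (I - {i}) (Suc j) x + x i * esym (I - {i}) j x"
  using esym_insert[of "I - {i}" i j x] assms by (simp add: insert_absorb)

lemma esym_cong: "(\<And>i. i \<in> I \<Longrightarrow> x i = y i) \<Longrightarrow> esym I j x = esym I j y"
  unfolding esym_def by (metis (mono_tags, lifting) prod.cong)

lemma esym_reindex: "inj_on h I \<Longrightarrow> esym (h ` I) j x = esym I j (x \<circ> h)"
  unfolding esym_def by (simp add: prod.reindex)

lemma esym_eq_0: "finite I \<Longrightarrow> card I < j \<Longrightarrow> esym I j x = 0"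
proof (induct I arbitrary: j rule: finite_induct)
  case empty
  then show ?case by (cases j) auto
next
  case (insert i I)
  then show ?case by (cases j) (auto simp: esym_insert)
qed

lemma esym_of_real: "esym I j (\<lambda>i. complex_of_real (x i)) = complex_of_real (esym I j x)"
proof (induct I arbitrary: j rule: infinite_finite_induct)
  case (infinite A)
  then show ?case by (simp add: esym_def)
next
  case empty
  then show ?case by (cases j) auto
next
  case (insert i I)
  then show ?case by (cases j) (auto simp: esym_insert)
qed

text \<open>Comparison of coefficients in the derivative of the generating polynomial. Dividing by a
  lower symmetric function turns it into the recursion for quotients on which both Newton's
  inequality and concavity rest.\<close>

lemma Suc_mult_esym_Suc:
  assumes "finite I"
  shows "of_nat (Suc j) * esym I (Suc j) x
    = (\<Sum>i\<in>I. x i * esym (I - {i}) j (x :: 'i \<Rightarrow> 'a::idom))"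
proof -
  have "of_nat (Suc j) * esym I (Suc j) x = coeff (pderiv (\<Prod>i\<in>I. [:1, x i:])) j"
    by (simp add: esym_def coeff_pderiv)
  also have "\<dots> = (\<Sum>i\<in>I. coeff ((\<Prod>i\<in>I - {i}. [:1, x i:]) * [:x i:]) j)"
    by (simp add: pderiv_prod pderiv_pCons coeff_sum)
  also have "\<dots> = (\<Sum>i\<in>I. x i * esym (I - {i}) j x)"
    by (simp add: esym_def mult.commute)
  finally show ?thesis .
qed

lemma tendsto_esym:
  fixes f :: "'b \<Rightarrow> 'i \<Rightarrow> 'a::{real_normed_algebra_1, comm_ring_1}"
  assumes "finite I" "\<And>i. i \<in> I \<Longrightarrow> ((\<lambda>t. f t i) \<longlongrightarrow> g i) F"
  shows "((\<lambda>t. esym I j (f t)) \<longlongrightarrow> esym I j g) F"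
  using assms
proof (induct I arbitrary: j rule: finite_induct)
  case empty
  then show ?case by (cases j) auto
next
  case (insert i I)
  then show ?case by (cases j) (auto simp: esym_insert intro!: tendsto_intros)
qed

lemma esym_eq_sum_prod:
  assumes "finite I"
  shows "esym I j x = (\<Sum>S\<in>{S. S \<subseteq> I \<and> card S = j}. \<Prod>i\<in>S. x i)"
proof -
  have "[:1, x i:] = monom (x i) 1 + 1" for i
    by (simp add: monom_Suc monom_0 one_pCons)
  then have "esym I j x = coeff (\<Prod>i\<in>I. monom (x i) 1 + 1) j"
    by (simp add: esym_def)
  also have "\<dots> = (\<Sum>S\<in>Pow I. coeff (\<Prod>i\<in>S. monom (x i) 1) j)"
    using assms by (simp add: prod_add coeff_sum)
  also have "\<dots> = (\<Sum>S\<in>Pow I. if card S = j then \<Prod>i\<in>S. x i else 0)"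
  proof (rule sum.cong)
    fix S assume "S \<in> Pow I"
    then have "finite S" using assms finite_subset by blast
    then have "(\<Prod>i\<in>S. monom (x i) 1) = monom (\<Prod>i\<in>S. x i) (card S)"
      by (induct S rule: finite_induct) (auto simp: mult_monom monom_0 one_pCons)
    then show "coeff (\<Prod>i\<in>S. monom (x i) 1) j = (if card S = j then \<Prod>i\<in>S. x i else 0)"
      by simp
  qed auto
  also have "\<dots> = (\<Sum>S\<in>{S. S \<subseteq> I \<and> card S = j}. \<Prod>i\<in>S. x i)"
    using assms by (subst sum.inter_filter[symmetric]) (auto intro!: sum.cong)
  finally show ?thesis .
qed

section \<open>Newton's inequality through the upper half plane\<close>

text \<open>The expression is the parallel sum 1 / (1/x + 1/q), and inversion exchanges the upper
  and the lower half plane.\<close>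

lemma Im_mult_divide_add_pos:
  assumes "Im x > 0" "Im q > 0"
  shows "Im (x * q / (x + q)) > 0"
proof -
  have nz: "x \<noteq> 0" "q \<noteq> 0" "x + q \<noteq> 0"
    using assms by (auto simp: complex_eq_iff)
  have *: "Im (inverse z) < 0 \<longleftrightarrow> Im z > 0" if "z \<noteq> 0" for z
  proof -
    have "(Re z)\<^sup>2 + (Im z)\<^sup>2 > 0"
      using that by (simp add: complex_eq_iff sum_power2_gt_zero_iff)
    then show ?thesis by (simp add: divide_less_0_iff zero_less_divide_iff)
  qed
  have "x * q / (x + q) = inverse (inverse x + inverse q)"
    using nz by (simp add: field_simps)
  moreover have "Im (inverse x + inverse q) < 0"
    using *[of x] *[of q] assms nz by simp
  ultimately show ?thesis
    using *[of "inverse (inverse x + inverse q)"] nz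
    by (metis inverse_inverse_eq inverse_zero less_irrefl zero_complex.simps(2))
qed

text \<open>Induction on \<open>j\<close>. With variable i deleted, the quotient q_i lies in the
  upper half plane by induction, and (j+2) e_{j+2} / e_{j+1} is the sum of the parallel sums x_i q_i
  / (x_i + q_i). Nonvanishing is carried along because e_{j+1} factors as the reduced e_j times x_i
  + q_i.\<close>

lemma esym_upper_half_plane:
  fixes x :: "'i \<Rightarrow> complex"
  assumes "finite I" "\<And>i. i \<in> I \<Longrightarrow> Im (x i) > 0" "j < card I"
  shows "esym I j x \<noteq> 0 \<and> Im (esym I (Suc j) x / esym I j x) > 0"
  using assms
proof (induct j arbitrary: I)
  case 0
  have "of_nat (Suc 0) * esym I (Suc 0) x = (\<Sum>i\<in>I. x i * esym (I - {i}) 0 x)"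
    using 0 by (intro Suc_mult_esym_Suc)
  then have "Im (esym I (Suc 0) x) = (\<Sum>i\<in>I. Im (x i))"
    by simp
  also have "\<dots> > 0"
    using 0 by (intro sum_pos) auto
  finally show ?case by simp
next
  case (Suc j)
  define q where "q i = esym (I - {i}) (Suc j) x / esym (I - {i}) j x" for i
  have IH: "esym (I - {i}) j x \<noteq> 0" "Im (q i) > 0" if "i \<in> I" for i
    using Suc.hyps[of "I - {i}"] Suc.prems that unfolding q_def by auto
  have eq: "esym I (Suc j) x = esym (I - {i}) j x * (x i + q i)" if "i \<in> I" for i
    using esym_remove[of I i j x] that IH[OF that] Suc.prems by (simp add: q_def algebra_simps)
  have nz: "esym I (Suc j) x \<noteq> 0"
  proof -
    obtain i where i: "i \<in> I" using Suc.prems by (metis card_gt_0_iff gr_implies_not0 equals0I not_gr0)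
    have "Im (x i + q i) > 0" using IH[OF i] Suc.prems i by (simp add: add_pos_pos)
    then have "x i + q i \<noteq> 0" by (metis less_irrefl zero_complex.simps(2))
    then show ?thesis using eq[OF i] IH[OF i] by simp
  qed
  have "of_nat (Suc (Suc j)) * esym I (Suc (Suc j)) x / esym I (Suc j) x
      = (\<Sum>i\<in>I. x i * esym (I - {i}) (Suc j) x / esym I (Suc j) x)"
    using Suc.prems by (subst Suc_mult_esym_Suc) (auto simp: sum_divide_distrib)
  also have "\<dots> = (\<Sum>i\<in>I. x i * q i / (x i + q i))"
  proof (rule sum.cong[OF refl])
    fix i assume i: "i \<in> I"
    show "x i * esym (I - {i}) (Suc j) x / esym I (Suc j) x = x i * q i / (x i + q i)"
      using IH[OF i] nz unfolding eq[OF i] by (simp add: q_def divide_simps)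
  qed
  finally have "of_nat (Suc (Suc j)) * (esym I (Suc (Suc j)) x / esym I (Suc j) x)
      = (\<Sum>i\<in>I. x i * q i / (x i + q i))" by simp
  then have "Im (of_nat (Suc (Suc j)) * (esym I (Suc (Suc j)) x / esym I (Suc j) x))
      = (\<Sum>i\<in>I. Im (x i * q i / (x i + q i)))" by simp
  also have "\<dots> > 0"
    using Suc.prems IH by (intro sum_pos Im_mult_divide_add_pos) auto
  finally have "real (Suc (Suc j)) * Im (esym I (Suc (Suc j)) x / esym I (Suc j) x) > 0"
    by (metis Im_complex_of_real Re_complex_of_real add.right_neutral mult_zero_left of_real_of_nat_eq times_complex.simps(2))
  then show ?case using nz by (simp add: zero_less_mult_iff)
qed

text \<open>Adjoin the variable \<open>\<i>\<close>: then the ratio of consecutive symmetric functions is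
  \<open>(e\<^sub>j\<^sub>+\<^sub>1 + \<i> e\<^sub>j) / (e\<^sub>j + \<i> e\<^sub>j\<^sub>-\<^sub>1)\<close>, whose imaginary part has the sign of the
  Newton defect. The other variables are shifted into the upper half plane and moved back.\<close>
lemma esym_newton:
  fixes x :: "'i \<Rightarrow> real"
  assumes I: "finite I"
  shows "esym I j x * esym I (Suc (Suc j)) x \<le> (esym I (Suc j) x)\<^sup>2"
proof (cases "Suc j \<le> card I")
  case False
  then show ?thesis using I by (simp add: esym_eq_0)
next
  case True
  define y where "y \<epsilon> = case_option \<i> (\<lambda>i. complex_of_real (x i) + of_real \<epsilon> * \<i>)" for \<epsilon> :: real
  define J where "J = insert None (Some ` I)"
  define P where "P z = Im (snd z * cnj (fst z))" for z :: "complex \<times> complex"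
  have J: "finite J" "card J = Suc (card I)"
    using I by (auto simp: J_def card_image)
  \<comment> \<open>The denominator is cleared because the quotient may be undefined at \<epsilon> =
    0, whereas this expression is continuous and passes to the limit.\<close>
  have pos: "Im (esym J (Suc (Suc j)) (y \<epsilon>) * cnj (esym J (Suc j) (y \<epsilon>))) > 0" if "\<epsilon> > 0" for \<epsilon>
  proof -
    have "esym J (Suc j) (y \<epsilon>) \<noteq> 0 \<and>
        Im (esym J (Suc (Suc j)) (y \<epsilon>) / esym J (Suc j) (y \<epsilon>)) > 0"
      using J True that by (intro esym_upper_half_plane) (auto simp: J_def y_def)
    then show ?thesis
      by (simp add: Im_complex_div_gt_0)
  qed
  have "((\<lambda>\<epsilon>. Im (esym J (Suc (Suc j)) (y \<epsilon>) * cnj (esym J (Suc j) (y \<epsilon>))))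
      \<longlongrightarrow> Im (esym J (Suc (Suc j)) (y 0) * cnj (esym J (Suc j) (y 0)))) (at_right 0)"
    using J(1) by (intro tendsto_Im tendsto_mult tendsto_cnj tendsto_esym)
      (auto simp: J_def y_def intro!: tendsto_eq_intros)
  then have "0 \<le> Im (esym J (Suc (Suc j)) (y 0) * cnj (esym J (Suc j) (y 0)))"
    by (rule tendsto_lowerbound)
      (auto simp: eventually_at_right_field simp del: times_complex.sel intro!: exI[of _ 1] less_imp_le[OF pos])
  moreover have "esym J (Suc m) (y 0) = of_real (esym I (Suc m) x) + \<i> * of_real (esym I m x)" for m
  proof -
    have "esym (Some ` I) m' (y 0) = of_real (esym I m' x)" for m'
      by (subst esym_reindex) (auto simp: y_def o_def esym_of_real)
    then show ?thesis
      using I by (simp add: J_def esym_insert) (simp add: y_def)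
  qed
  ultimately show ?thesis
    by (simp add: power2_eq_square mult.commute)
qed

subsection \<open>The positivity cone and concavity of the quotients\<close>

text \<open>The Garding cone in the variables \<open>I\<close>. The condition at j = 0 holds
  automatically; for finite \<open>I\<close>, membership forces \<open>k\<close> to be at most the
  number of variables.\<close>

definition esym_cone :: "'i set \<Rightarrow> nat \<Rightarrow> ('i \<Rightarrow> real) set" where
  "esym_cone I k = {x. \<forall>j\<le>k. esym I j x > 0}"

lemma esym_cone_pos: "x \<in> esym_cone I k \<Longrightarrow> j \<le> k \<Longrightarrow> esym I j x > 0"
  by (simp add: esym_cone_def)

lemma esym_cone_antimono: "k \<le> m \<Longrightarrow> esym_cone I m \<subseteq> esym_cone I k"
  by (auto simp: esym_cone_def)

text \<open>Let b be the first nonpositive reduced function, a > 0 its predecessor and c its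
  successor. Positivity of b + x_i a gives x_i a > -b, and multiplying c + x_i b > 0 by a gives 0 <
  a c + (x_i a) b \<le> a c - b^2, against Newton's inequality.\<close>

lemma esym_cone_remove:
  assumes I: "finite I" "i \<in> I" and x: "x \<in> esym_cone I (Suc k)"
  shows "x \<in> esym_cone (I - {i}) k"
proof -
  have "j \<le> k \<longrightarrow> esym (I - {i}) j x > 0" for j
  proof (induct j)
    case (Suc j)
    show ?case
    proof (intro impI, rule ccontr)
      define a b c where "a = esym (I - {i}) j x" and "b = esym (I - {i}) (Suc j) x"
        and "c = esym (I - {i}) (Suc (Suc j)) x"
      assume j: "Suc j \<le> k" and "\<not> esym (I - {i}) (Suc j) x > 0"
      then have b: "b \<le> 0" and a: "a > 0" using Suc by (auto simp: a_def b_def)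
      have "b + x i * a > 0" "c + x i * b > 0"
        using esym_cone_pos[OF x, of "Suc j"] esym_cone_pos[OF x, of "Suc (Suc j)"] j
        by (simp_all add: esym_remove[OF I] a_def b_def c_def)
      moreover have "a * c \<le> b\<^sup>2"
        using I esym_newton[of "I - {i}" j x] by (simp add: a_def b_def c_def)
      moreover have "a * c + (x i * a) * b = a * (c + x i * b)" by (simp add: algebra_simps)
      then have "a * c + (x i * a) * b > 0" using calculation a by simp
      moreover have "(x i * a) * b \<le> (- b) * b"
        using b calculation by (intro mult_right_mono_neg) auto
      ultimately show False by (simp add: power2_eq_square)
    qed
  qed simp
  then show ?thesis by (simp add: esym_cone_def)
qed

definition esym_ratio :: "'i set \<Rightarrow> nat \<Rightarrow> ('i \<Rightarrow> real) \<Rightarrow> real" where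
  "esym_ratio I j x = esym I (Suc j) x / esym I j x"

lemma esym_ratio_pos: "x \<in> esym_cone I k \<Longrightarrow> j < k \<Longrightarrow> esym_ratio I j x > 0"
  unfolding esym_ratio_def by (intro divide_pos_pos esym_cone_pos) auto

text \<open>The recursion of the upper half plane argument, now over the reals. The coordinate or
  the reduced quotient may be negative here; only their sum has a sign, and this suffices for the
  concavity of the parallel sum.\<close>

lemma esym_ratio_Suc:
  assumes I: "finite I" and x: "x \<in> esym_cone I (Suc (Suc k))"
  shows "\<And>i. i \<in> I \<Longrightarrow> x i + esym_ratio (I - {i}) k x > 0"
    and "of_nat (Suc (Suc k)) * esym_ratio I (Suc k) x
      = (\<Sum>i\<in>I. x i * esym_ratio (I - {i}) k x / (x i + esym_ratio (I - {i}) k x))"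
proof -
  have *: "x i + esym_ratio (I - {i}) k x = esym I (Suc k) x / esym (I - {i}) k x"
    "esym (I - {i}) k x > 0" if "i \<in> I" for i
  proof -
    have "x \<in> esym_cone (I - {i}) (Suc k)" by (rule esym_cone_remove[OF I that x])
    then show "esym (I - {i}) k x > 0" by (rule esym_cone_pos) simp
    then show "x i + esym_ratio (I - {i}) k x = esym I (Suc k) x / esym (I - {i}) k x"
      by (simp add: esym_ratio_def esym_remove[OF I that] field_simps)
  qed
  have pos: "esym I (Suc k) x > 0" by (rule esym_cone_pos[OF x]) simp
  show "x i + esym_ratio (I - {i}) k x > 0" if "i \<in> I" for i
    using *[OF that] pos by simp
  have "of_nat (Suc (Suc k)) * esym_ratio I (Suc k) x
      = (\<Sum>i\<in>I. x i * esym (I - {i}) (Suc k) x / esym I (Suc k) x)"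
    using Suc_mult_esym_Suc[OF I, of "Suc k" x]
    by (simp add: esym_ratio_def sum_divide_distrib del: of_nat_Suc)
  also have "\<dots> = (\<Sum>i\<in>I. x i * esym_ratio (I - {i}) k x / (x i + esym_ratio (I - {i}) k x))"
  proof (rule sum.cong[OF refl])
    fix i assume i: "i \<in> I"
    show "x i * esym (I - {i}) (Suc k) x / esym I (Suc k) x
        = x i * esym_ratio (I - {i}) k x / (x i + esym_ratio (I - {i}) k x)"
      using *(2)[OF i] pos unfolding *(1)[OF i] by (simp add: esym_ratio_def)
  qed
  finally show "of_nat (Suc (Suc k)) * esym_ratio I (Suc k) x
      = (\<Sum>i\<in>I. x i * esym_ratio (I - {i}) k x / (x i + esym_ratio (I - {i}) k x))" .
qed

text \<open>After multiplication by a + b the difference of the two sides is the square of (1-t) a -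
  t b. For fixed t the right side is linear in (a, b), so the parallel sum is an infimum of linear
  functions, attained at t = a / (a + b).\<close>

lemma parallel_sum_le:
  fixes a b t :: real
  assumes "a + b > 0"
  shows "a * b / (a + b) \<le> (1 - t)\<^sup>2 * a + t\<^sup>2 * b"
proof -
  have "(a + b) * ((1 - t)\<^sup>2 * a + t\<^sup>2 * b) - a * b = ((1 - t) * a - t * b)\<^sup>2"
    by (simp add: power2_eq_square algebra_simps)
  then have "a * b \<le> ((1 - t)\<^sup>2 * a + t\<^sup>2 * b) * (a + b)"
    by (smt (verit) zero_le_power2 mult.commute)
  then show ?thesis using assms by (simp add: pos_divide_le_eq)
qed

lemma parallel_sum_eq:
  fixes a b :: real
  assumes "a + b > 0"
  shows "a * b / (a + b) = (1 - a / (a + b))\<^sup>2 * a + (a / (a + b))\<^sup>2 * b"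
proof -
  have "1 - a / (a + b) = b / (a + b)" using assms by (simp add: field_simps)
  then have "(1 - a / (a + b))\<^sup>2 * a + (a / (a + b))\<^sup>2 * b = a * b * (a + b) / (a + b)\<^sup>2"
    by (simp add: power_divide add_divide_distrib[symmetric]) (simp add: power2_eq_square algebra_simps)
  then show ?thesis using assms by (simp add: power2_eq_square)
qed

text \<open>Each quotient is a sum of parallel sums of a coordinate and a lower quotient in the
  remaining variables, so affine majorants are obtained by induction.\<close>
lemma esym_ratio_supergradient:
  assumes "finite I" "v \<in> esym_cone I (Suc k)"
  shows "\<exists>c. esym_ratio I k v = (\<Sum>i\<in>I. c i * v i)
    \<and> (\<forall>w\<in>esym_cone I (Suc k). esym_ratio I k w \<le> (\<Sum>i\<in>I. c i * w i))"
  using assms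
proof (induct k arbitrary: I)
  case 0
  have "esym_ratio I 0 w = (\<Sum>i\<in>I. 1 * w i)" for w
    using Suc_mult_esym_Suc[OF 0(1), of 0 w] by (simp add: esym_ratio_def)
  then show ?case by (intro exI[of _ "\<lambda>_. 1"]) auto
next
  case (Suc k)
  note I = \<open>finite I\<close>
  let ?r = "\<lambda>i. esym_ratio (I - {i}) k"
  have "\<forall>i\<in>I. \<exists>c. ?r i v = (\<Sum>m\<in>I - {i}. c m * v m)
    \<and> (\<forall>w\<in>esym_cone (I - {i}) (Suc k). ?r i w \<le> (\<Sum>m\<in>I - {i}. c m * w m))"
    using Suc.hyps I esym_cone_remove[OF I _ Suc.prems(2)] by (intro ballI) simp
  from bchoice[OF this] obtain c where c0: "\<forall>i\<in>I. ?r i v = (\<Sum>m\<in>I - {i}. c i m * v m)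
    \<and> (\<forall>w\<in>esym_cone (I - {i}) (Suc k). ?r i w \<le> (\<Sum>m\<in>I - {i}. c i m * w m))" ..
  then have c: "\<And>i. i \<in> I \<Longrightarrow> ?r i v = (\<Sum>m\<in>I - {i}. c i m * v m)"
    "\<And>i w. i \<in> I \<Longrightarrow> w \<in> esym_cone (I - {i}) (Suc k) \<Longrightarrow> ?r i w \<le> (\<Sum>m\<in>I - {i}. c i m * w m)"
    by auto
  define t where "t i = v i / (v i + ?r i v)" for i
  \<comment> \<open>The total coefficient of \<open>w m\<close>: once as the deleted variable, with
    weight (1 - t m)^2, and once through the reduced majorant of every other index i, with weight (t
    i)^2. The weights \<open>t\<close> are optimal at \<open>v\<close>, which makes the majorant
    touch there.\<close>
  define d where "d m = ((1 - t m)\<^sup>2 + (\<Sum>i\<in>I - {m}. (t i)\<^sup>2 * c i m)) / real (Suc (Suc k))" for m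
  have d: "real (Suc (Suc k)) * (\<Sum>m\<in>I. d m * w m)
      = (\<Sum>i\<in>I. (1 - t i)\<^sup>2 * w i + (t i)\<^sup>2 * (\<Sum>m\<in>I - {i}. c i m * w m))" for w
  proof -
    have "(\<Sum>i\<in>I. \<Sum>m\<in>I - {i}. (t i)\<^sup>2 * c i m * w m) = (\<Sum>m\<in>I. \<Sum>i\<in>I - {m}. (t i)\<^sup>2 * c i m * w m)"
    proof -
      have "I - {i} = {m \<in> I. m \<noteq> i}" "I - {i} = {m \<in> I. i \<noteq> m}" for i by auto
      then show ?thesis using sum.swap_restrict[OF I I, of "\<lambda>i m. (t i)\<^sup>2 * c i m * w m" "\<lambda>i m. m \<noteq> i"]
        by simp
    qed
    moreover have "real (Suc (Suc k)) * (\<Sum>m\<in>I. d m * w m)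
        = (\<Sum>m\<in>I. (1 - t m)\<^sup>2 * w m + (\<Sum>i\<in>I - {m}. (t i)\<^sup>2 * c i m * w m))"
      unfolding sum_distrib_left d_def
      by (intro sum.cong refl) (simp add: distrib_right sum_distrib_right del: of_nat_Suc)
    ultimately show ?thesis
      by (simp add: sum.distrib sum_distrib_left mult.assoc)
  qed
  have pos: "real (Suc (Suc k)) > 0" by simp
  show ?case
  proof (intro exI[of _ d] conjI ballI)
    have "real (Suc (Suc k)) * esym_ratio I (Suc k) v = real (Suc (Suc k)) * (\<Sum>m\<in>I. d m * v m)"
      unfolding d esym_ratio_Suc(2)[OF I Suc(3)]
    proof (intro sum.cong refl)
      fix i assume i: "i \<in> I"
      show "v i * ?r i v / (v i + ?r i v) = (1 - t i)\<^sup>2 * v i + (t i)\<^sup>2 * (\<Sum>m\<in>I - {i}. c i m * v m)"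
        using parallel_sum_eq[OF esym_ratio_Suc(1)[OF I Suc(3) i]] c(1)[OF i] by (simp add: t_def)
    qed
    then show "esym_ratio I (Suc k) v = (\<Sum>m\<in>I. d m * v m)" using pos by simp
  next
    fix w assume w: "w \<in> esym_cone I (Suc (Suc k))"
    have "real (Suc (Suc k)) * esym_ratio I (Suc k) w \<le> real (Suc (Suc k)) * (\<Sum>m\<in>I. d m * w m)"
      unfolding d esym_ratio_Suc(2)[OF I w]
    proof (intro sum_mono)
      fix i assume i: "i \<in> I"
      have "?r i w \<le> (\<Sum>m\<in>I - {i}. c i m * w m)"
        using c(2)[OF i] esym_cone_remove[OF I i w] by blast
      then have "(t i)\<^sup>2 * ?r i w \<le> (t i)\<^sup>2 * (\<Sum>m\<in>I - {i}. c i m * w m)"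
        by (intro mult_left_mono) auto
      then show "w i * ?r i w / (w i + ?r i w)
          \<le> (1 - t i)\<^sup>2 * w i + (t i)\<^sup>2 * (\<Sum>m\<in>I - {i}. c i m * w m)"
        using parallel_sum_le[OF esym_ratio_Suc(1)[OF I w i], of "t i"] by linarith
    qed
    then show "esym_ratio I (Suc k) w \<le> (\<Sum>m\<in>I. d m * w m)" using pos by simp
  qed
qed

lemma ln_esym_quotient:
  assumes "x \<in> esym_cone I k" "l \<le> k"
  shows "ln (esym I k x / esym I l x) = (\<Sum>j=l..<k. ln (esym_ratio I j x))"
  using assms(2,1)
proof (induct k rule: dec_induct)
  case base
  then have "esym I l x > 0" by (rule esym_cone_pos) simp
  then show ?case by simp
next
  case (step k)
  have *: "esym I l x > 0" "esym I k x > 0" "esym I (Suc k) x > 0"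
    using step by (auto intro!: esym_cone_pos[OF step(4)])
  moreover have "x \<in> esym_cone I k" using step(4) esym_cone_antimono[of k "Suc k" I] by auto
  ultimately show ?case using step by (simp add: esym_ratio_def ln_div)
qed

text \<open>Adds the majorants of the quotients, each normalized by its value at \<open>v\<close>,
  and uses ln y \<le> y - 1. The first conclusion keeps the sum of normalized quotients, since it
  yields positivity of \<open>L\<close> on the cone and the lower bound for its trace.\<close>

lemma log_esym_quotient_supergradient:
  assumes I: "finite I" and v: "v \<in> esym_cone I k" and "l \<le> k"
  obtains L where
    "\<And>w. w \<in> esym_cone I k \<Longrightarrow>
      (\<Sum>j=l..<k. esym_ratio I j w / esym_ratio I j v) \<le> (\<Sum>i\<in>I. L i * w i)"
    "\<And>w. w \<in> esym_cone I k \<Longrightarrow>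
      ln (esym I k w / esym I l w) - ln (esym I k v / esym I l v) \<le> (\<Sum>i\<in>I. L i * (w i - v i))"
proof -
  have "\<forall>j\<in>{..<k}. \<exists>c. esym_ratio I j v = (\<Sum>i\<in>I. c i * v i)
    \<and> (\<forall>w\<in>esym_cone I (Suc j). esym_ratio I j w \<le> (\<Sum>i\<in>I. c i * w i))"
  proof
    fix j assume "j \<in> {..<k}"
    then have "v \<in> esym_cone I (Suc j)" using v esym_cone_antimono[of "Suc j" k I] by auto
    then show "\<exists>c. esym_ratio I j v = (\<Sum>i\<in>I. c i * v i)
    \<and> (\<forall>w\<in>esym_cone I (Suc j). esym_ratio I j w \<le> (\<Sum>i\<in>I. c i * w i))"
      by (rule esym_ratio_supergradient[OF I])
  qed
  then obtain c where c: "\<And>j. j < k \<Longrightarrow> esym_ratio I j v = (\<Sum>i\<in>I. c j i * v i)"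
    "\<And>j w. j < k \<Longrightarrow> w \<in> esym_cone I (Suc j) \<Longrightarrow> esym_ratio I j w \<le> (\<Sum>i\<in>I. c j i * w i)"
    unfolding bchoice_iff by (metis lessThan_iff)
  define L where "L i = (\<Sum>j=l..<k. c j i / esym_ratio I j v)" for i
  have L: "(\<Sum>i\<in>I. L i * w i) = (\<Sum>j=l..<k. (\<Sum>i\<in>I. c j i * w i) / esym_ratio I j v)" for w
    unfolding L_def sum_distrib_right by (subst sum.swap) (simp add: sum_divide_distrib)
  have vpos: "esym_ratio I j v > 0" if "j < k" for j
    by (rule esym_ratio_pos[OF v that])
  have le: "esym_ratio I j w / esym_ratio I j v \<le> (\<Sum>i\<in>I. c j i * w i) / esym_ratio I j v"
    if "j < k" "w \<in> esym_cone I k" for j w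
    using that esym_cone_antimono[of "Suc j" k I] c(2)[of j w] vpos[of j]
    by (intro divide_right_mono) auto
  show ?thesis
  proof (rule that[of L])
    fix w assume w: "w \<in> esym_cone I k"
    show 1: "(\<Sum>j=l..<k. esym_ratio I j w / esym_ratio I j v) \<le> (\<Sum>i\<in>I. L i * w i)"
      unfolding L using le w by (intro sum_mono) auto
    have "ln (esym I k w / esym I l w) - ln (esym I k v / esym I l v)
        = (\<Sum>j=l..<k. ln (esym_ratio I j w / esym_ratio I j v))"
      unfolding ln_esym_quotient[OF w \<open>l \<le> k\<close>] ln_esym_quotient[OF v \<open>l \<le> k\<close>]
        sum_subtractf[symmetric]
    proof (rule sum.cong[OF refl])
      fix j assume "j \<in> {l..<k}"
      then have "esym_ratio I j w > 0" "esym_ratio I j v > 0"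
        using vpos esym_ratio_pos[OF w] by auto
      then show "ln (esym_ratio I j w) - ln (esym_ratio I j v)
          = ln (esym_ratio I j w / esym_ratio I j v)" by (simp add: ln_div)
    qed
    also have "\<dots> \<le> (\<Sum>j=l..<k. esym_ratio I j w / esym_ratio I j v - 1)"
      using vpos esym_ratio_pos[OF w] by (intro sum_mono ln_le_minus_one) auto
    also have "\<dots> \<le> (\<Sum>i\<in>I. L i * w i) - (\<Sum>i\<in>I. L i * v i)"
    proof -
      \<comment> \<open>Each majorant touches at \<open>v\<close>, so the normalized summands are 1
        there; they cancel the -1 of the logarithm inequality.\<close>
      have "(\<Sum>i\<in>I. L i * v i) = (\<Sum>j=l..<k. 1)"
        unfolding L using c(1) vpos by (intro sum.cong) (auto simp: less_imp_neq[symmetric])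
      then show ?thesis using 1 by (simp add: sum_subtractf)
    qed
    finally show "ln (esym I k w / esym I l w) - ln (esym I k v / esym I l v)
        \<le> (\<Sum>i\<in>I. L i * (w i - v i))"
      by (simp add: right_diff_distrib sum_subtractf)
  qed
qed

subsection \<open>Ellipticity\<close>

lemma esym_const_1: "finite I \<Longrightarrow> esym I j (\<lambda>_. 1 :: real) = real (card I choose j)"
proof (induct I arbitrary: j rule: finite_induct)
  case empty
  then show ?case by (cases j) auto
next
  case (insert i I)
  then show ?case by (cases j) (auto simp: esym_insert)
qed

lemma esym_fun_upd_const_1:
  assumes "finite I" "i \<in> I"
  shows "esym I (Suc j) ((\<lambda>_. 1 :: real)(i := s))
    = real (card I - 1 choose Suc j) + s * real (card I - 1 choose j)"
proof -
  have "esym (I - {i}) m ((\<lambda>_. 1)(i := s)) = real (card I - 1 choose m)" for m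
    using assms esym_cong[of "I - {i}" "(\<lambda>_. 1)(i := s)" "\<lambda>_. 1" m] by (simp add: esym_const_1)
  then show ?thesis by (simp add: esym_remove[OF assms])
qed

lemma binomial_le_mult_binomial_Suc:
  assumes "j < n"
  shows "(n choose j) \<le> n * (n choose Suc j)"
proof -
  have "(n choose j) \<le> (n - j) * (n choose j)" using assms by simp
  also have "\<dots> = Suc j * (n choose Suc j)"
    using binomial_absorb_comp[of n j] binomial_absorption[of j n] by simp
  also have "\<dots> \<le> n * (n choose Suc j)" using assms by (intro mult_right_mono) auto
  finally show ?thesis .
qed

lemma const_1_in_esym_cone:
  assumes "finite I" "k \<le> card I"
  shows "(\<lambda>_. 1) \<in> esym_cone I k"
  using assms by (auto simp: esym_cone_def esym_const_1 zero_less_binomial)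

text \<open>With n variables and m < k, e_{m+1} equals C(n-1, m+1) + s C(n-1, m), where C(n-1, m)
  \<le> (n-1) C(n-1, m+1); hence s \<ge> -1/n cannot cancel the first term. The strict bound k < n
  keeps that term positive: for k = n the cone is the positive orthant and admits no negative
  coordinate.\<close>

lemma fun_upd_const_1_in_esym_cone:
  assumes I: "finite I" "i \<in> I" and k: "k < card I" and s: "s \<ge> - 1 / real (card I)"
  shows "(\<lambda>_. 1)(i := s) \<in> esym_cone I k"
  unfolding esym_cone_def
proof (intro CollectI allI impI)
  fix j assume j: "j \<le> k"
  show "esym I j ((\<lambda>_. 1)(i := s)) > 0"
  proof (cases j)
    case (Suc m)
    define n where "n = card I - 1"
    have n: "real (card I) = real n + 1" "m < n" using Suc j k by (auto simp: n_def)
    have "real (n choose m) \<le> real n * real (n choose Suc m)"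
      using binomial_le_mult_binomial_Suc[OF n(2)] by (metis of_nat_le_iff of_nat_mult)
    moreover have "real (n choose Suc m) > 0" using n by (simp add: zero_less_binomial_iff)
    ultimately have "real (n choose m) < (real n + 1) * real (n choose Suc m)"
      unfolding distrib_right by linarith
    then have "real (n choose m) / (real n + 1) < real (n choose Suc m)"
      by (simp add: field_simps)
    moreover have "- 1 / (real n + 1) * real (n choose m) \<le> s * real (n choose m)"
      using s n by (intro mult_right_mono) auto
    ultimately show ?thesis unfolding Suc esym_fun_upd_const_1[OF I] n_def[symmetric] by simp
  qed simp
qed

text \<open>The lower bound for the trace of the linearization and the gap between the trace and each
  coefficient are read off from the test vectors \<open>(1, \<dots>, 1)\<close> and \<open>(1, \<dots>, - 1/n, \<dots>, 1)\<close>.\<close>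
lemma log_esym_quotient_linearization:
  assumes I: "finite I" and v: "v \<in> esym_cone I k" and "l < k" "k < card I"
    and M: "esym I k v / esym I l v \<le> M"
  obtains L :: "'i \<Rightarrow> real" where
    "\<And>w. w \<in> esym_cone I k \<Longrightarrow>
      ln (esym I k w / esym I l w) - ln (esym I k v / esym I l v) \<le> (\<Sum>i\<in>I. L i * (w i - v i))"
    "1 \<le> real (card I) * max 1 M * sum L I"
    "\<And>i. i \<in> I \<Longrightarrow> sum L I \<le> (real (card I) + 1) * (sum L I - L i)"
    "\<And>i. i \<in> I \<Longrightarrow> sum L I - L i \<le> 2 * sum L I"
proof -
  obtain L where L1: "\<And>w. w \<in> esym_cone I k \<Longrightarrow>
      (\<Sum>j=l..<k. esym_ratio I j w / esym_ratio I j v) \<le> (\<Sum>i\<in>I. L i * w i)"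
    and L2: "\<And>w. w \<in> esym_cone I k \<Longrightarrow>
      ln (esym I k w / esym I l w) - ln (esym I k v / esym I l v) \<le> (\<Sum>i\<in>I. L i * (w i - v i))"
    by (rule log_esym_quotient_supergradient[OF I v less_imp_le[OF \<open>l < k\<close>]]) blast
  have vpos: "esym_ratio I j v > 0" if "j < k" for j
    by (rule esym_ratio_pos[OF v that])
  \<comment> \<open>Both comparisons of a coefficient with the trace are this positivity evaluated
    at a test vector with one modified coordinate; the value 2 used below yields sum L + L i \<ge>
    0.\<close>
  have pos: "0 \<le> (\<Sum>i\<in>I. L i * w i)" if w: "w \<in> esym_cone I k" for w
    using vpos esym_ratio_pos[OF w]
    by (intro order_trans[OF _ L1[OF w]] sum_nonneg) (auto intro!: less_imp_le[OF divide_pos_pos])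
  have upd: "(\<Sum>m\<in>I. L m * ((\<lambda>_. 1)(i := s)) m) = sum L I - L i + s * L i" if "i \<in> I" for i s
  proof -
    have "(\<Sum>m\<in>I. L m * ((\<lambda>_. 1)(i := s)) m) = L i * s + (\<Sum>m\<in>I - {i}. L m)"
      using I that by (subst sum.remove[of _ i]) auto
    then show ?thesis using I that by (simp add: sum.remove[of I i L])
  qed
  show ?thesis
  proof (rule that[OF L2])
    show "sum L I - L i \<le> 2 * sum L I" if "i \<in> I" for i
    proof -
      have "(\<lambda>_. 1)(i := 2) \<in> esym_cone I k"
        by (rule fun_upd_const_1_in_esym_cone[OF I that \<open>k < card I\<close>])
          (rule order_trans[of _ 0], auto)
      from pos[OF this] show ?thesis using upd[OF that] by simp
    qed
    show "sum L I \<le> (real (card I) + 1) * (sum L I - L i)" if i: "i \<in> I" for i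
    proof -
      have n: "real (card I) > 0" using \<open>k < card I\<close> by simp
      have "(\<lambda>_. 1)(i := - 1 / real (card I)) \<in> esym_cone I k"
        by (rule fun_upd_const_1_in_esym_cone[OF I that \<open>k < card I\<close>]) simp
      from pos[OF this] have "0 \<le> sum L I - L i + - 1 / real (card I) * L i"
        using upd[OF that] by simp
      then have "0 \<le> real (card I) * (sum L I - L i + - 1 / real (card I) * L i)"
        using n by simp
      also have "\<dots> = (real (card I) + 1) * (sum L I - L i) - sum L I"
        using n by (simp add: field_simps)
      finally show ?thesis by simp
    qed
    have one: "(\<lambda>_. 1) \<in> esym_cone I k"
      by (rule const_1_in_esym_cone) (use I \<open>k < card I\<close> in auto)
    \<comment> \<open>The quotients multiply to at most \<open>M\<close>, so not all of them exceed
      \<open>max 1 M\<close>. The 1 makes the logarithms of all factors nonnegative, so that the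
      factor with index \<open>l\<close> alone gives the contradiction.\<close>
    have "\<exists>j\<in>{l..<k}. esym_ratio I j v \<le> max 1 M"
    proof (rule ccontr)
      assume "\<not> ?thesis"
      then have gt: "esym_ratio I j v > max 1 M" if "j \<in> {l..<k}" for j
        using that by (meson not_le)
      have quot: "esym I k v / esym I l v > 0"
        using esym_cone_pos[OF v] \<open>l < k\<close> by simp
      have "ln (max 1 M) < ln (esym_ratio I l v)"
        using gt[of l] \<open>l < k\<close> vpos[of l] by (subst ln_less_cancel_iff) auto
      also have "\<dots> \<le> (\<Sum>j=l..<k. ln (esym_ratio I j v))"
      proof (rule member_le_sum)
        show "0 \<le> ln (esym_ratio I j v)" if "j \<in> {l..<k} - {l}" for j
          using gt[of j] that by (intro ln_ge_zero) auto
      qed (use \<open>l < k\<close> in auto)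
      also have "\<dots> = ln (esym I k v / esym I l v)"
        using ln_esym_quotient[OF v] \<open>l < k\<close> by simp
      also have "\<dots> \<le> ln (max 1 M)"
        using quot M by (subst ln_le_cancel_iff) auto
      finally show False by simp
    qed
    then obtain j where j: "j \<in> {l..<k}" "esym_ratio I j v \<le> max 1 M" by blast
    \<comment> \<open>At (1, ..., 1) the quotient is a ratio of consecutive binomials, at least 1/n.
      The single summand \<open>j\<close> of the first supergradient inequality then bounds the
      trace from below.\<close>
    have r1: "1 \<le> real (card I) * esym_ratio I j (\<lambda>_. 1)"
    proof -
      have "real (card I choose j) \<le> real (card I) * real (card I choose Suc j)"
        using binomial_le_mult_binomial_Suc[of j "card I"] j \<open>k < card I\<close>
        by (metis atLeastLessThan_iff less_trans of_nat_le_iff of_nat_mult)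
      moreover have "real (card I choose j) > 0" using j \<open>k < card I\<close> by simp
      ultimately show ?thesis by (simp add: esym_ratio_def esym_const_1 I pos_le_divide_eq)
    qed
    have "esym_ratio I j (\<lambda>_. 1) / esym_ratio I j v
        \<le> (\<Sum>j=l..<k. esym_ratio I j (\<lambda>_. 1) / esym_ratio I j v)"
      using j vpos esym_ratio_pos[OF one]
      by (intro member_le_sum) (auto intro!: less_imp_le[OF divide_pos_pos])
    also have "\<dots> \<le> sum L I" using L1[OF one] by simp
    finally have "esym_ratio I j (\<lambda>_. 1) \<le> esym_ratio I j v * sum L I"
      using vpos[of j] j by (simp add: divide_le_eq mult.commute)
    also have "\<dots> \<le> max 1 M * sum L I"
      using j(2) pos[OF one] by (intro mult_right_mono) auto
    finally have "real (card I) * esym_ratio I j (\<lambda>_. 1) \<le> real (card I) * (max 1 M * sum L I)"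
      by (intro mult_left_mono) auto
    then show "1 \<le> real (card I) * max 1 M * sum L I" using r1 by (simp add: mult.assoc)
  qed
qed

section \<open>Symmetric matrices\<close>

text \<open>First variation of the Rayleigh quotient in the direction of the residual z = f e - m e,
  which lies in \<open>V\<close> by invariance.\<close>

lemma selfadjoint_max_eigenvector:
  fixes f :: "'a::euclidean_space \<Rightarrow> 'a"
  assumes f: "linear f" and sa: "\<And>x y. f x \<bullet> y = x \<bullet> f y"
    and V: "subspace V" "f ` V \<subseteq> V" and e: "e \<in> V" "norm e = 1"
    and max: "\<And>x. x \<in> V \<Longrightarrow> norm x = 1 \<Longrightarrow> x \<bullet> f x \<le> e \<bullet> f e"
  shows "f e = (e \<bullet> f e) *\<^sub>R e"
proof -
  define m where "m = e \<bullet> f e"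
  define z where "z = f e - m *\<^sub>R e"
  define c where "c = m * (z \<bullet> z) - z \<bullet> f z"
  have le: "y \<bullet> f y \<le> m * (y \<bullet> y)" if y: "y \<in> V" for y
  proof (cases "y = 0")
    case False
    have "(y /\<^sub>R norm y) \<bullet> f (y /\<^sub>R norm y) \<le> m"
      unfolding m_def using y False V by (intro max) (auto intro: subspace_scale)
    then have "y \<bullet> f y / (norm y)\<^sup>2 \<le> m"
      using f by (simp add: linear_scale power2_eq_square field_simps)
    then show ?thesis using False
      by (simp add: power2_norm_eq_inner[symmetric] divide_le_eq)
  qed (use f in \<open>simp add: linear_0\<close>)
  have zV: "z \<in> V" using V e by (auto simp: z_def intro!: subspace_diff subspace_scale)
  have ee: "e \<bullet> e = 1" using e by (simp add: norm_eq_1)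
  have ez: "e \<bullet> z = 0" using ee by (simp add: z_def m_def inner_diff_right)
  have ezz: "z \<bullet> f e = z \<bullet> z"
  proof -
    have "f e = z + m *\<^sub>R e" by (simp add: z_def)
    then show ?thesis using ez by (simp add: inner_add_right inner_commute)
  qed
  have "0 \<le> - 2 * t * (z \<bullet> z) + t\<^sup>2 * c" for t
  proof -
    have "e + t *\<^sub>R z \<in> V" using V e zV by (intro subspace_add subspace_scale)
    from le[OF this]
    have "m + 2 * t * (z \<bullet> f e) + t\<^sup>2 * (z \<bullet> f z) \<le> m * (1 + t\<^sup>2 * (z \<bullet> z))"
      using f ez ee sa[of z e]
      by (simp add: linear_add linear_scale inner_simps m_def inner_commute algebra_simps power2_eq_square)
    then show ?thesis by (simp add: c_def ezz algebra_simps)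
  qed
  \<comment> \<open>So small that the negative first order term beats the second order one: the sum
    becomes t^2 (c - 2 (1 + |c|)), which is negative unless t = 0.\<close>
  moreover define t where "t = (z \<bullet> z) / (1 + \<bar>c\<bar>)"
  ultimately have "0 \<le> - 2 * t * (z \<bullet> z) + t\<^sup>2 * c" by blast
  moreover have zt: "z \<bullet> z = t * (1 + \<bar>c\<bar>)" by (simp add: t_def)
  ultimately have "0 \<le> t\<^sup>2 * (c - 2 * (1 + \<bar>c\<bar>))"
    by (simp add: power2_eq_square algebra_simps)
  moreover have "c - 2 * (1 + \<bar>c\<bar>) < 0"
    using abs_ge_zero[of c] abs_ge_self[of c] by argo
  ultimately have "t = 0"
    by (smt (verit) mult_pos_neg zero_less_power2)
  then have "z = 0" using zt by simp
  then show ?thesis by (simp add: z_def m_def)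
qed

text \<open>The orthogonal complement of the eigenvectors already found is invariant by
  self-adjointness and nonzero while m is below the dimension; the Rayleigh quotient attains its
  maximum on its unit sphere.\<close>

lemma selfadjoint_orthonormal_eigenvectors:
  fixes f :: "'a::euclidean_space \<Rightarrow> 'a"
  assumes f: "linear f" and sa: "\<And>x y. f x \<bullet> y = x \<bullet> f y" and "m \<le> DIM('a)"
  shows "\<exists>S. finite S \<and> card S = m \<and> pairwise orthogonal S
    \<and> (\<forall>s\<in>S. norm s = 1 \<and> (\<exists>c. f s = c *\<^sub>R s))"
  using \<open>m \<le> DIM('a)\<close>
proof (induct m)
  case 0
  then show ?case by (intro exI[of _ "{}"]) auto
next
  case (Suc m)
  then obtain S where S: "finite S" "card S = m" "pairwise orthogonal S"
    "\<And>s. s \<in> S \<Longrightarrow> norm s = 1" "\<And>s. s \<in> S \<Longrightarrow> \<exists>c. f s = c *\<^sub>R s" by auto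
  define V where "V = {x. \<forall>s\<in>S. s \<bullet> x = 0}"
  have V: "subspace V" by (auto simp: V_def subspace_def inner_simps)
  have fV: "f ` V \<subseteq> V"
  proof
    fix y assume "y \<in> f ` V"
    then obtain x where x: "x \<in> V" "y = f x" by auto
    have "s \<bullet> f x = 0" if "s \<in> S" for s
      using S(5)[OF that] x(1) that sa[of s x] by (auto simp: V_def)
    then show "y \<in> V" using x by (auto simp: V_def)
  qed
  have "dim S \<le> m" using dim_le_card'[OF S(1)] S(2) by simp
  then have "dim S < DIM('a)" using Suc by simp
  then obtain x where x: "x \<noteq> 0" "\<And>y. y \<in> span S \<Longrightarrow> orthogonal x y"
    by (metis orthogonal_to_subspace_exists)
  have "x \<in> V" using x(2) span_base by (auto simp: V_def orthogonal_def inner_commute)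
  then have ne: "x /\<^sub>R norm x \<in> V \<inter> sphere 0 1"
    using x(1) V by (auto intro: subspace_scale)
  have comp: "compact (V \<inter> sphere 0 1)"
    by (intro closed_Int_compact closed_subspace V compact_sphere)
  have "continuous_on (V \<inter> sphere 0 1) (\<lambda>x. x \<bullet> f x)"
    using f by (intro continuous_intros linear_continuous_on linear_conv_bounded_linear[THEN iffD1])
  from continuous_attains_sup[OF comp _ this] ne
  obtain e where e: "e \<in> V \<inter> sphere 0 1" "\<And>y. y \<in> V \<inter> sphere 0 1 \<Longrightarrow> y \<bullet> f y \<le> e \<bullet> f e"
    by blast
  have "f e = (e \<bullet> f e) *\<^sub>R e"
    using e by (intro selfadjoint_max_eigenvector[OF f sa V fV]) auto
  moreover have "e \<notin> S"
    using e(1) norm_eq_1[of e] by (auto simp: V_def)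
  ultimately show ?case
    using S e(1) by (intro exI[of _ "insert e S"])
      (auto simp: pairwise_insert V_def orthogonal_def[of _ e] orthogonal_def[of e] inner_commute)
qed

text \<open>Guarantees a witness for the choice operator in \<open>eigvals\<close>.\<close>

lemma symmetric_matrix_diagonalization:
  fixes A :: "real^'n^'n"
  assumes "transpose A = A"
  shows "\<exists>v Q. orthogonal_matrix Q \<and> A = Q ** diag_mat v ** transpose Q"
proof -
  have "(A *v x) \<bullet> y = x \<bullet> (A *v y)" for x y
    using dot_lmul_matrix[of x A y] assms by (metis transpose_matrix_vector)
  then obtain S :: "(real^'n) set" where S: "finite S" "card S = CARD('n)" "pairwise orthogonal S"
    "\<And>s. s \<in> S \<Longrightarrow> norm s = 1" "\<And>s. s \<in> S \<Longrightarrow> \<exists>c. A *v s = c *\<^sub>R s"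
    using selfadjoint_orthonormal_eigenvectors[OF matrix_vector_mul_linear, of A "CARD('n)"] by auto
  obtain b where b: "bij_betw b (UNIV :: 'n set) S"
    using finite_same_card_bij[of "UNIV :: 'n set" S] S by auto
  then have bS: "b i \<in> S" for i by (auto simp: bij_betw_def)
  then have "\<forall>i. \<exists>c. A *v b i = c *\<^sub>R b i" using S(5) by blast
  from choice[OF this] obtain c where c: "\<And>i. A *v b i = c i *\<^sub>R b i" by blast
  define Q where "Q = (\<chi> i j. b j $ i)"
  have col: "column i Q = b i" for i by (simp add: Q_def column_def vec_eq_iff)
  have "i \<noteq> j \<Longrightarrow> b i \<noteq> b j" for i j using b by (auto simp: bij_betw_def inj_on_def)
  then have Q: "orthogonal_matrix Q"
    using S(4)[OF bS] pairwiseD[OF S(3) bS bS] by (auto simp: orthogonal_matrix_orthonormal_columns col)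
  have "A ** Q = Q ** diag_mat (\<chi> i. c i)"
  proof -
    have "(A ** Q) $ i $ j = (Q ** diag_mat (\<chi> i. c i)) $ i $ j" for i j
    proof -
      have "(A ** Q) $ i $ j = (A *v b j) $ i"
        by (simp add: matrix_matrix_mult_def matrix_vector_mult_def Q_def)
      also have "\<dots> = (Q ** diag_mat (\<chi> i. c i)) $ i $ j"
        unfolding c by (simp add: matrix_matrix_mult_def Q_def diag_mat_def if_distrib[of "\<lambda>x. _ * x"] cong: if_cong)
      finally show ?thesis .
    qed
    then show ?thesis by (simp add: vec_eq_iff)
  qed
  moreover have "A ** Q ** transpose Q = A"
    using Q by (simp add: orthogonal_matrix_def matrix_mul_assoc[symmetric])
  ultimately show ?thesis using Q by metis
qed

section \<open>Orthonormal bases and the quadratic form in terms of \<open>eigvals\<close>\<close>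

text \<open>Indexed by the coordinate type itself, so such a family is automatically a
  basis.\<close>

definition orthonormal :: "('n::finite \<Rightarrow> real^'n) \<Rightarrow> bool" where
  "orthonormal p \<longleftrightarrow> (\<forall>i j. p i \<bullet> p j = (if i = j then 1 else 0))"

lemma orthonormal_expand:
  assumes "orthonormal p"
  shows "x = (\<Sum>i\<in>UNIV. (p i \<bullet> x) *\<^sub>R p i)"
proof -
  define Q where "Q = (\<chi> i j. p j $ i)"
  have col: "column i Q = p i" for i by (simp add: Q_def column_def vec_eq_iff)
  have "orthogonal_matrix Q"
    using assms by (auto simp: orthogonal_matrix_orthonormal_columns col orthonormal_def
        norm_eq_1 orthogonal_def)
  then have "Q *v (transpose Q *v x) = x"
    by (simp add: orthogonal_matrix_def matrix_vector_mul_assoc del: transpose_matrix_vector)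
  moreover have "(transpose Q *v x) $ i = p i \<bullet> x" for i
    by (simp add: matrix_vector_mult_def transpose_def Q_def inner_vec_def del: transpose_matrix_vector)
  ultimately show ?thesis
    unfolding matrix_mult_sum[of Q] col by (simp add: scalar_mult_eq_scaleR del: transpose_matrix_vector)
qed

lemma orthonormal_sum_inner_square:
  assumes "orthonormal p"
  shows "(\<Sum>i\<in>UNIV. (p i \<bullet> x)\<^sup>2) = x \<bullet> x"
proof -
  have "x \<bullet> x = x \<bullet> (\<Sum>i\<in>UNIV. (p i \<bullet> x) *\<^sub>R p i)"
    using orthonormal_expand[OF assms, of x] by simp
  then show ?thesis by (simp add: inner_sum_right inner_commute power2_eq_square)
qed

lemma eigvals_expand:
  fixes A :: "real^'n^'n"
  assumes "transpose A = A"
  obtains p where "orthonormal p"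
    "\<And>x. x \<bullet> (A *v x) = (\<Sum>i\<in>UNIV. eigvals A $ i * (p i \<bullet> x)\<^sup>2)"
proof -
  have "\<exists>Q. orthogonal_matrix Q \<and> A = Q ** diag_mat (eigvals A) ** transpose Q"
    unfolding eigvals_def by (rule someI_ex[OF symmetric_matrix_diagonalization[OF assms]])
  then obtain Q where Q: "orthogonal_matrix Q" "A = Q ** diag_mat (eigvals A) ** transpose Q" by auto
  show ?thesis
  proof (rule that[of "\<lambda>i. column i Q"])
    show "orthonormal (\<lambda>i. column i Q)"
      using Q(1) by (auto simp: orthogonal_matrix_orthonormal_columns orthonormal_def
          norm_eq_1 orthogonal_def)
    fix x
    have T: "(transpose Q *v x) $ i = column i Q \<bullet> x" for i
      by (simp add: matrix_vector_mult_def transpose_def column_def inner_vec_def del: transpose_matrix_vector)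
    have D: "(diag_mat (eigvals A) *v y) $ i = eigvals A $ i * y $ i" for y i
      by (simp add: matrix_vector_mult_def diag_mat_def if_distrib[of "\<lambda>x. x * _"] cong: if_cong)
    have "A *v x = Q *v (diag_mat (eigvals A) *v (transpose Q *v x))"
      using Q(2) by (metis matrix_vector_mul_assoc)
    also have "\<dots> = (\<Sum>i\<in>UNIV. (eigvals A $ i * (column i Q \<bullet> x)) *\<^sub>R column i Q)"
      by (subst matrix_mult_sum) (simp add: D T scalar_mult_eq_scaleR del: transpose_matrix_vector)
    finally show "x \<bullet> (A *v x) = (\<Sum>i\<in>UNIV. eigvals A $ i * (column i Q \<bullet> x)\<^sup>2)"
      by (simp add: inner_sum_right inner_commute power2_eq_square mult.assoc)
  qed
qed

subsection \<open>Doubly stochastic averages\<close>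

text \<open>Move the full mass of the row of a maximal weight \<open>L a\<close> and of the column of a minimal
  value \<open>w b\<close> to their common entry; this does not increase the bilinear form.\<close>
lemma doubly_stochastic_ge_permutation:
  fixes S :: "'i \<Rightarrow> 'j \<Rightarrow> real"
  assumes "finite I" "finite J" "card I = card J"
    and "\<And>i j. i \<in> I \<Longrightarrow> j \<in> J \<Longrightarrow> S i j \<ge> 0"
    and "\<And>i. i \<in> I \<Longrightarrow> (\<Sum>j\<in>J. S i j) = 1" and "\<And>j. j \<in> J \<Longrightarrow> (\<Sum>i\<in>I. S i j) = 1"
  shows "\<exists>\<pi>. bij_betw \<pi> I J \<and> (\<Sum>i\<in>I. L i * w (\<pi> i)) \<le> (\<Sum>i\<in>I. \<Sum>j\<in>J. L i * S i j * w j)"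
  using assms
proof (induct "card I" arbitrary: I J S)
  case 0
  then show ?case by (auto simp: bij_betw_def)
next
  case (Suc n)
  have ne: "I \<noteq> {}" "J \<noteq> {}" using Suc by auto
  obtain a where a: "a \<in> I" "\<And>i. i \<in> I \<Longrightarrow> L i \<le> L a"
  proof -
    have "Max (L ` I) \<in> L ` I" using Suc(3) ne by (intro Max_in) auto
    then obtain a where "a \<in> I" "L a = Max (L ` I)" by auto
    then show thesis using Suc(3) by (intro that[of a]) auto
  qed
  obtain b where b: "b \<in> J" "\<And>j. j \<in> J \<Longrightarrow> w b \<le> w j"
  proof -
    have "Min (w ` J) \<in> w ` J" using Suc(4) ne by (intro Min_in) auto
    then obtain b where "b \<in> J" "w b = Min (w ` J)" by auto
    then show thesis using Suc(4) by (intro that[of b]) auto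
  qed
  define I' J' where "I' = I - {a}" and "J' = J - {b}"
  have fin: "finite I'" "finite J'" and I: "I = insert a I'" "a \<notin> I'" and J: "J = insert b J'" "b \<notin> J'"
    using Suc(3,4) a b by (auto simp: I'_def J'_def)
  have card: "n = card I'" "card I' = card J'"
    using Suc(2,5) fin I J by auto
  define s where "s = S a b"
  have row: "(\<Sum>j\<in>J'. S i j) = 1 - S i b" if "i \<in> I" for i
    using Suc(7)[OF that] fin J by simp
  have col: "(\<Sum>i\<in>I'. S i j) = 1 - S a j" if "j \<in> J" for j
    using Suc(8)[OF that] fin I by simp
  have nn: "S i j \<ge> 0" if "i \<in> I" "j \<in> J" for i j using Suc(6) that .
  \<comment> \<open>Deleting row a and column b removes S i b from row i and S a j from column j;
    the rank one correction restores both marginals. For s = 1 the division yields 0, which is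
    right, since row a and column b then vanish off their common entry.\<close>
  define S' where "S' i j = S i j + S i b * S a j / (1 - s)" for i j
  have s1: "s \<le> 1"
    using row[of a] a b nn sum_nonneg[of J' "S a"] J by (force simp: s_def)
  have zero1: "S i b = 0" if "s = 1" "i \<in> I'" for i
  proof -
    have "(\<Sum>i\<in>I'. S i b) = 0" using col[OF b(1)] that by (simp add: s_def)
    then show ?thesis
      using fin(1) nn b(1) I that(2) by (subst (asm) sum_nonneg_eq_0_iff) auto
  qed
  have zero2: "S a j = 0" if "s = 1" "j \<in> J'" for j
  proof -
    have "(\<Sum>j\<in>J'. S a j) = 0" using row[OF a(1)] that by (simp add: s_def)
    then show ?thesis
      using fin(2) nn a(1) J that(2) by (subst (asm) sum_nonneg_eq_0_iff) auto
  qed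
  have "\<exists>\<pi>. bij_betw \<pi> I' J' \<and>
      (\<Sum>i\<in>I'. L i * w (\<pi> i)) \<le> (\<Sum>i\<in>I'. \<Sum>j\<in>J'. L i * S' i j * w j)"
  proof (rule Suc.hyps(1)[OF card(1) fin card(2)])
    show "S' i j \<ge> 0" if "i \<in> I'" "j \<in> J'" for i j
      using nn[of i j] nn[of i b] nn[of a j] s1 that I J by (simp add: S'_def)
    show "(\<Sum>j\<in>J'. S' i j) = 1" if i: "i \<in> I'" for i
    proof -
      have "(\<Sum>j\<in>J'. S' i j) = (\<Sum>j\<in>J'. S i j) + S i b * (\<Sum>j\<in>J'. S a j) / (1 - s)"
        by (simp add: S'_def sum.distrib sum_distrib_left sum_divide_distrib)
      also have "\<dots> = 1"
        using row[of i] row[OF a(1)] i I zero1[OF _ i] by (cases "s = 1") (simp_all add: s_def[symmetric])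
      finally show ?thesis .
    qed
    show "(\<Sum>i\<in>I'. S' i j) = 1" if j: "j \<in> J'" for j
    proof -
      have "(\<Sum>i\<in>I'. S' i j) = (\<Sum>i\<in>I'. S i j) + (\<Sum>i\<in>I'. S i b) * S a j / (1 - s)"
        by (simp add: S'_def sum.distrib sum_distrib_right sum_divide_distrib)
      also have "\<dots> = 1"
        using col[of j] col[OF b(1)] j J zero2[OF _ j] by (cases "s = 1") (simp_all add: s_def[symmetric])
      finally show ?thesis .
    qed
  qed
  then obtain \<pi> where \<pi>: "bij_betw \<pi> I' J'"
    "(\<Sum>i\<in>I'. L i * w (\<pi> i)) \<le> (\<Sum>i\<in>I'. \<Sum>j\<in>J'. L i * S' i j * w j)" by auto
  have split: "(\<Sum>i\<in>I. \<Sum>j\<in>J. L i * S i j * w j)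
      = L a * s * w b + (\<Sum>j\<in>J'. L a * S a j * w j) + (\<Sum>i\<in>I'. L i * S i b * w b)
        + (\<Sum>i\<in>I'. \<Sum>j\<in>J'. L i * S i j * w j)"
    using fin I J by (simp add: s_def sum.distrib)
  have main: "L a * w b + (\<Sum>i\<in>I'. \<Sum>j\<in>J'. L i * S' i j * w j)
      \<le> (\<Sum>i\<in>I. \<Sum>j\<in>J. L i * S i j * w j)"
  proof (cases "s = 1")
    case True
    then show ?thesis unfolding split using zero1[OF True] zero2[OF True] True
      by (simp add: S'_def)
  next
    case False
    then have s: "1 - s > 0" using s1 by simp
    have ra: "(\<Sum>j\<in>J'. S a j) = 1 - s" and cb: "(\<Sum>i\<in>I'. S i b) = 1 - s"
      using row[OF a(1)] col[OF b(1)] by (auto simp: s_def)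
    \<comment> \<open>Averages \<open>f\<close> over the redistributed mass, whose total is 1 - s;
      \<open>D1\<close> and \<open>D2\<close> evaluate it when \<open>f\<close> depends on one index
      only.\<close>
    define D where "D f = (\<Sum>i\<in>I'. \<Sum>j\<in>J'. S i b * S a j * f i j) / (1 - s)" for f :: "'i \<Rightarrow> 'j \<Rightarrow> real"
    have D1: "D (\<lambda>i j. g j) = (\<Sum>j\<in>J'. S a j * g j)" for g
    proof -
      have "(\<Sum>i\<in>I'. \<Sum>j\<in>J'. S i b * S a j * g j) = (\<Sum>i\<in>I'. S i b) * (\<Sum>j\<in>J'. S a j * g j)"
        by (simp add: sum_product mult.assoc)
      then show ?thesis using s by (simp add: D_def cb)
    qed
    have D2: "D (\<lambda>i j. g i) = (\<Sum>i\<in>I'. S i b * g i)" for g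
    proof -
      have "(\<Sum>i\<in>I'. \<Sum>j\<in>J'. S i b * S a j * g i) = (\<Sum>i\<in>I'. S i b * g i) * (\<Sum>j\<in>J'. S a j)"
        unfolding sum_product by (intro sum.cong refl) (simp add: mult_ac)
      then show ?thesis using s by (simp add: D_def ra)
    qed
    have D3: "D (\<lambda>i j. L a * w b) = L a * w b * (1 - s)"
      using D1[of "\<lambda>_. L a * w b"] by (simp add: sum_distrib_right[symmetric] ra mult.commute)
    \<comment> \<open>The exchange inequality: maximality of \<open>L a\<close> and minimality of
      \<open>w b\<close> make both factors nonnegative, and expanding the product compares the
      redistributed mass with the original.\<close>
    have "0 \<le> D (\<lambda>i j. (L a - L i) * (w j - w b))"
      unfolding D_def using s a b I J nn by (intro divide_nonneg_pos sum_nonneg mult_nonneg_nonneg) auto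
    also have "D (\<lambda>i j. (L a - L i) * (w j - w b))
        = D (\<lambda>i j. L a * w j) + D (\<lambda>i j. L i * w b) - D (\<lambda>i j. L i * w j) - D (\<lambda>i j. L a * w b)"
      unfolding D_def add_divide_distrib[symmetric] diff_divide_distrib[symmetric]
          sum.distrib[symmetric] sum_subtractf[symmetric]
      by (intro arg_cong[of _ _ "\<lambda>x. x / (1 - s)"] sum.cong refl) (simp add: algebra_simps)
    also have "D (\<lambda>i j. L a * w j) = (\<Sum>j\<in>J'. L a * S a j * w j)"
      by (simp add: D1 mult_ac)
    also have "D (\<lambda>i j. L i * w b) = (\<Sum>i\<in>I'. L i * S i b * w b)"
      by (simp add: D2 mult_ac)
    finally have 1: "D (\<lambda>i j. L i * w j) + L a * w b * (1 - s)
        \<le> (\<Sum>j\<in>J'. L a * S a j * w j) + (\<Sum>i\<in>I'. L i * S i b * w b)"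
      by (simp add: D3)
    have 2: "(\<Sum>i\<in>I'. \<Sum>j\<in>J'. L i * S' i j * w j)
        = (\<Sum>i\<in>I'. \<Sum>j\<in>J'. L i * S i j * w j) + D (\<lambda>i j. L i * w j)"
      unfolding S'_def D_def sum_divide_distrib sum.distrib[symmetric]
      by (intro sum.cong refl) (simp add: algebra_simps)
    show ?thesis unfolding split 2 using 1 by (simp add: algebra_simps)
  qed
  define \<rho> where "\<rho> = \<pi>(a := b)"
  have "bij_betw \<rho> I J"
  proof -
    have "bij_betw \<rho> I' J'" using \<pi>(1) I(2) by (subst bij_betw_cong[of _ _ \<pi>]) (auto simp: \<rho>_def)
    moreover have "\<rho> a = b" by (simp add: \<rho>_def)
    ultimately show ?thesis using I J notIn_Un_bij_betw[of a I' \<rho> J'] by simp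
  qed
  moreover have "(\<Sum>i\<in>I. L i * w (\<rho> i)) = L a * w b + (\<Sum>i\<in>I'. L i * w (\<pi> i))"
    using fin I by (simp add: \<rho>_def) (intro sum.cong; auto)
  ultimately show ?case using \<pi>(2) main by (intro exI[of _ \<rho>]) auto
qed

subsection \<open>The linearized matrix inequality\<close>

lemma sigma_eq_esym: "sigma j v = esym UNIV j (($) v)"
  by (simp add: sigma_def esym_eq_sum_prod)

lemma Gamma_iff_esym_cone: "v \<in> Gamma k \<longleftrightarrow> ($) v \<in> esym_cone UNIV k"
proof -
  have "(\<forall>j\<in>{1..k}. 0 < esym UNIV j (($) v)) \<longleftrightarrow> (\<forall>j\<le>k. 0 < esym UNIV j (($) v))"
    by (metis atLeastAtMost_iff esym_0 le_simps(3) less_one not_le zero_less_one le_zero_eq)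
  then show ?thesis by (simp add: Gamma_def esym_cone_def sigma_eq_esym)
qed

lemma esym_permute: "bij \<pi> \<Longrightarrow> esym UNIV j (x \<circ> \<pi>) = esym UNIV j x"
  using esym_reindex[of \<pi> UNIV j x] by (simp add: bij_def)

text \<open>Here \<open>q\<close> diagonalizes \<open>A\<close>. If \<open>p\<close> diagonalizes
  \<open>B\<close>, the squares (p_j . q_i)^2 form a doubly stochastic matrix, and averaging the
  eigenvalues of \<open>B\<close> with it gives the numbers q_i . B q_i. Some permutation of the
  eigenvalues of \<open>B\<close> pairs with \<open>L\<close> to no more than this average, and
  permutations change neither the cone nor the quotient, so the vector inequality applies.\<close>

lemma matrix_log_quotient_linearization:
  fixes A :: "real^'n^'n"
  assumes A: "transpose A = A" and v: "eigvals A \<in> Gamma k" and kl: "l < k" "k < CARD('n)"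
    and M: "sigma_mat k A / sigma_mat l A \<le> M"
  obtains L :: "'n \<Rightarrow> real" and q :: "'n \<Rightarrow> real^'n" where
    "orthonormal q"
    "\<And>B. transpose B = B \<Longrightarrow> eigvals B \<in> Gamma k \<Longrightarrow>
      ln (sigma_mat k B / sigma_mat l B) - ln (sigma_mat k A / sigma_mat l A)
        \<le> (\<Sum>i\<in>UNIV. L i * (q i \<bullet> (B *v q i) - q i \<bullet> (A *v q i)))"
    "1 \<le> real CARD('n) * max 1 M * sum L UNIV"
    "\<And>i. sum L UNIV \<le> (real CARD('n) + 1) * (sum L UNIV - L i)"
    "\<And>i. sum L UNIV - L i \<le> 2 * sum L UNIV"
proof -
  let ?v = "($) (eigvals A)"
  have v': "?v \<in> esym_cone UNIV k" using v by (simp add: Gamma_iff_esym_cone)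
  have M': "esym UNIV k ?v / esym UNIV l ?v \<le> M"
    using M by (simp add: sigma_mat_def sigma_eq_esym)
  from log_esym_quotient_linearization[OF finite v' kl M']
  obtain L where L: "\<And>w. w \<in> esym_cone UNIV k \<Longrightarrow>
      ln (esym UNIV k w / esym UNIV l w) - ln (esym UNIV k ?v / esym UNIV l ?v)
        \<le> (\<Sum>i\<in>UNIV. L i * (w i - ?v i))"
    and L': "1 \<le> real CARD('n) * max 1 M * sum L UNIV"
    "\<And>i. sum L UNIV \<le> (real CARD('n) + 1) * (sum L UNIV - L i)"
    "\<And>i. sum L UNIV - L i \<le> 2 * sum L UNIV" by auto
  obtain q where q: "orthonormal q" "\<And>x. x \<bullet> (A *v x) = (\<Sum>i\<in>UNIV. eigvals A $ i * (q i \<bullet> x)\<^sup>2)"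
    using eigvals_expand[OF A] by blast
  have qA: "q i \<bullet> (A *v q i) = ?v i" for i
  proof -
    have "q i \<bullet> (A *v q i) = (\<Sum>j\<in>UNIV. if j = i then eigvals A $ j else 0)"
      unfolding q(2) using q(1) by (intro sum.cong) (auto simp: orthonormal_def)
    then show ?thesis by simp
  qed
  show ?thesis
  proof (rule that[OF q(1) _ L'])
    fix B :: "real^'n^'n" assume B: "transpose B = B" "eigvals B \<in> Gamma k"
    let ?w = "($) (eigvals B)"
    obtain p where p: "orthonormal p" "\<And>x. x \<bullet> (B *v x) = (\<Sum>j\<in>UNIV. eigvals B $ j * (p j \<bullet> x)\<^sup>2)"
      using eigvals_expand[OF B(1)] by blast
    have "\<exists>\<pi>. bij_betw \<pi> UNIV UNIV \<and> (\<Sum>i\<in>UNIV. L i * ?w (\<pi> i))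
        \<le> (\<Sum>i\<in>UNIV. \<Sum>j\<in>UNIV. L i * (p j \<bullet> q i)\<^sup>2 * ?w j)"
    proof (rule doubly_stochastic_ge_permutation)
      show "(\<Sum>j\<in>UNIV. (p j \<bullet> q i)\<^sup>2) = 1" for i
        using orthonormal_sum_inner_square[OF p(1), of "q i"] q(1) by (simp add: orthonormal_def)
      show "(\<Sum>i\<in>UNIV. (p j \<bullet> q i)\<^sup>2) = 1" for j
        using orthonormal_sum_inner_square[OF q(1), of "p j"] p(1)
        by (simp add: orthonormal_def inner_commute)
    qed auto
    then obtain \<pi> where \<pi>: "bij \<pi>" "(\<Sum>i\<in>UNIV. L i * ?w (\<pi> i))
        \<le> (\<Sum>i\<in>UNIV. \<Sum>j\<in>UNIV. L i * (p j \<bullet> q i)\<^sup>2 * ?w j)" by auto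
    have "(\<Sum>i\<in>UNIV. \<Sum>j\<in>UNIV. L i * (p j \<bullet> q i)\<^sup>2 * ?w j) = (\<Sum>i\<in>UNIV. L i * (q i \<bullet> (B *v q i)))"
      by (simp add: p(2) sum_distrib_left mult_ac)
    moreover have "?w \<circ> \<pi> \<in> esym_cone UNIV k"
      using B(2) by (simp add: Gamma_iff_esym_cone esym_cone_def esym_permute[OF \<pi>(1)])
    from L[OF this] have "ln (esym UNIV k ?w / esym UNIV l ?w) - ln (esym UNIV k ?v / esym UNIV l ?v)
        \<le> (\<Sum>i\<in>UNIV. L i * ?w (\<pi> i)) - (\<Sum>i\<in>UNIV. L i * ?v i)"
      unfolding esym_permute[OF \<pi>(1)] by (simp add: right_diff_distrib sum_subtractf)
    ultimately show "ln (sigma_mat k B / sigma_mat l B) - ln (sigma_mat k A / sigma_mat l A)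
        \<le> (\<Sum>i\<in>UNIV. L i * (q i \<bullet> (B *v q i) - q i \<bullet> (A *v q i)))"
      using \<pi>(2) by (simp add: sigma_mat_def sigma_eq_esym qA right_diff_distrib sum_subtractf)
  qed
qed

section \<open>Directional derivatives\<close>

lemma has_derivative_along_line:
  fixes g :: "'a::real_normed_vector \<Rightarrow> real"
  assumes "(g has_derivative g') (at (x + t *\<^sub>R b))"
  shows "((\<lambda>t. g (x + t *\<^sub>R b)) has_real_derivative g' b) (at t)"
proof -
  have "((\<lambda>t. x + t *\<^sub>R b) has_derivative (\<lambda>h. h *\<^sub>R b)) (at t)"
    by (auto intro!: derivative_eq_intros)
  from has_derivative_compose[OF this assms]
  have "((\<lambda>t. g (x + t *\<^sub>R b)) has_derivative (\<lambda>h. g' (h *\<^sub>R b))) (at t)" .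
  moreover have "(\<lambda>h. g' (h *\<^sub>R b)) = (*) (g' b)"
    using linear_scale[OF has_derivative_linear[OF assms]] by (auto simp: mult.commute)
  ultimately show ?thesis by (simp add: has_field_derivative_def)
qed

lemma partial_eq_has_derivative:
  assumes "(g has_derivative g') (at x)"
  shows "partial b g x = g' b"
  unfolding partial_def
  by (rule DERIV_imp_deriv) (use has_derivative_along_line[of g g' x 0 b] assms in simp)

lemma has_derivative_partial:
  assumes "g differentiable (at x)"
  shows "(g has_derivative (\<lambda>b. partial b g x)) (at x)"
proof -
  obtain g' where g: "(g has_derivative g') (at x)" using assms by (auto simp: differentiable_def)
  then have "(\<lambda>b. partial b g x) = g'" by (auto simp: partial_eq_has_derivative)
  then show ?thesis using g by simp
qed

lemma linear_partial: "g differentiable (at x) \<Longrightarrow> linear (\<lambda>b. partial b g x)"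
  using has_derivative_linear[OF has_derivative_partial] .

lemma has_real_derivative_along_line:
  assumes "g differentiable (at (x + t *\<^sub>R b))"
  shows "((\<lambda>t. g (x + t *\<^sub>R b)) has_real_derivative partial b g (x + t *\<^sub>R b)) (at t)"
  by (rule has_derivative_along_line[OF has_derivative_partial[OF assms]])

lemma partial_eq_sum_Basis:
  fixes g :: "'a::euclidean_space \<Rightarrow> real"
  assumes "g differentiable (at x)"
  shows "partial b g x = (\<Sum>i\<in>Basis. (b \<bullet> i) * partial i g x)"
proof -
  have "partial b g x = partial (\<Sum>i\<in>Basis. (b \<bullet> i) *\<^sub>R i) g x"
    by (simp add: euclidean_representation)
  then show ?thesis
    by (simp add: linear_sum[OF linear_partial[OF assms]] linear_scale[OF linear_partial[OF assms]])
qed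

lemma partial_add:
  "g differentiable (at x) \<Longrightarrow> h differentiable (at x) \<Longrightarrow>
    partial b (\<lambda>x. g x + h x) x = partial b g x + partial b h x"
  using partial_eq_has_derivative[OF has_derivative_add[OF has_derivative_partial has_derivative_partial]] .

lemma partial_cmult:
  "g differentiable (at x) \<Longrightarrow> partial b (\<lambda>x. c * g x) x = c * partial b g x"
  using partial_eq_has_derivative[OF has_derivative_mult_right[OF has_derivative_partial]] .

lemma differentiable_cong_on_open:
  fixes g :: "'a::real_normed_vector \<Rightarrow> real"
  assumes "open S" "x \<in> S" "\<And>y. y \<in> S \<Longrightarrow> g y = h y" "g differentiable (at x)"
  shows "h differentiable (at x)"
  using has_derivative_transform_within_open[OF has_derivative_partial[OF assms(4)] assms(1,2,3)]
  by (rule differentiableI)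

lemma partial_cong_on_open:
  assumes "open S" "x \<in> S" "\<And>y. y \<in> S \<Longrightarrow> g y = h y"
  shows "partial b g x = partial b h x"
proof -
  have "\<forall>\<^sub>F t in nhds 0. x + t *\<^sub>R b \<in> S"
  proof (rule topological_tendstoD[OF _ assms(1)])
    have "((\<lambda>t. x + t *\<^sub>R b) \<longlongrightarrow> x + 0 *\<^sub>R b) (nhds 0)"
      by (intro tendsto_intros filterlim_ident)
    then show "((\<lambda>t. x + t *\<^sub>R b) \<longlongrightarrow> x) (nhds 0)" by simp
  qed (rule assms)
  then have "\<forall>\<^sub>F t in nhds 0. g (x + t *\<^sub>R b) = h (x + t *\<^sub>R b)"
    by eventually_elim (rule assms(3))
  then show ?thesis unfolding partial_def by (intro deriv_cong_ev) auto
qed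

section \<open>Differentiability classes on open sets\<close>

lemma cont_diff_cong:
  assumes "open S" "\<And>y. y \<in> S \<Longrightarrow> g y = h y" "cont_diff m S g"
  shows "cont_diff m S h"
  using assms(2,3)
proof (induct m arbitrary: g h)
  case 0
  then show ?case by (simp cong: continuous_on_cong)
next
  case (Suc m)
  have "continuous_on S h" using Suc(2,3) by (simp cong: continuous_on_cong)
  moreover have "\<forall>x\<in>S. h differentiable (at x)"
    using differentiable_cong_on_open[OF assms(1) _ Suc(2)] Suc(3) by auto
  moreover have "cont_diff m S (partial b h)" if "b \<in> Basis" for b
  proof (rule Suc(1))
    show "partial b g y = partial b h y" if "y \<in> S" for y
      by (rule partial_cong_on_open[OF assms(1) that Suc(2)])
    show "cont_diff m S (partial b g)" using Suc(3) that by simp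
  qed
  ultimately show ?case by simp
qed

lemma cont_diff_add:
  assumes "open S" "cont_diff m S g" "cont_diff m S h"
  shows "cont_diff m S (\<lambda>x. g x + h x)"
  using assms(2,3)
proof (induct m arbitrary: g h)
  case 0
  then show ?case by (auto intro: continuous_on_add)
next
  case (Suc m)
  have "cont_diff m S (partial b (\<lambda>x. g x + h x))" if "b \<in> Basis" for b
    by (rule cont_diff_cong[OF assms(1) _ Suc(1)[of "partial b g" "partial b h"]])
      (use Suc that in \<open>auto simp: partial_add\<close>)
  then show ?case using Suc by (auto intro: continuous_on_add)
qed

lemma cont_diff_cmult:
  assumes "open S" "cont_diff m S g"
  shows "cont_diff m S (\<lambda>x. c * g x)"
  using assms(2)
proof (induct m arbitrary: g)
  case 0
  then show ?case by (auto intro: continuous_on_mult_left)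
next
  case (Suc m)
  have "cont_diff m S (partial b (\<lambda>x. c * g x))" if "b \<in> Basis" for b
    by (rule cont_diff_cong[OF assms(1) _ Suc(1)[of "partial b g"]])
      (use Suc that in \<open>auto simp: partial_cmult\<close>)
  then show ?case using Suc by (auto intro: continuous_on_mult_left)
qed

lemma cont_diff_zero: "cont_diff m S (\<lambda>x. 0)"
proof (induct m)
  case (Suc m)
  have "partial b (\<lambda>x. 0 :: real) = (\<lambda>x. 0)" for b :: 'a
    by (auto simp: partial_def)
  then show ?case using Suc by simp
qed simp

lemma cont_diff_sum:
  assumes "open S" "finite I" "\<And>i. i \<in> I \<Longrightarrow> cont_diff m S (g i)"
  shows "cont_diff m S (\<lambda>x. \<Sum>i\<in>I. g i x)"
  using assms(2,3) by (induct I) (auto intro: cont_diff_add[OF assms(1)] cont_diff_zero)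

text \<open>\<open>cont_diff\<close> speaks of coordinate directions only. Linearity of the
  derivative extends it to arbitrary directions, which is what allows differentiation along
  \<open>e\<close> and along the basis \<open>q\<close>.\<close>

lemma cont_diff_partial:
  assumes "open S" "cont_diff (Suc m) S g"
  shows "cont_diff m S (partial b g)"
proof (rule cont_diff_cong[OF assms(1)])
  show "cont_diff m S (\<lambda>x. \<Sum>i\<in>Basis. (b \<bullet> i) * partial i g x)"
    using assms by (intro cont_diff_sum cont_diff_cmult) auto
  show "(\<Sum>i\<in>Basis. (b \<bullet> i) * partial i g x) = partial b g x" if "x \<in> S" for x
    using assms that by (intro partial_eq_sum_Basis[symmetric]) auto
qed

lemma smooth_on_partial: "open S \<Longrightarrow> smooth_on S g \<Longrightarrow> smooth_on S (partial b g)"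
  unfolding smooth_on_def using cont_diff_partial by blast

lemma smooth_on_differentiable: "smooth_on S g \<Longrightarrow> x \<in> S \<Longrightarrow> g differentiable (at x)"
  unfolding smooth_on_def by (metis cont_diff.simps(2))

lemma smooth_on_continuous: "smooth_on S g \<Longrightarrow> continuous_on S g"
  unfolding smooth_on_def by (metis cont_diff.simps(1))

section \<open>Symmetry of mixed second derivatives\<close>

text \<open>Two mean value theorems, first along \<open>a\<close> for the increment in
  \<open>b\<close>, then along \<open>b\<close>. The second difference is symmetric in
  \<open>a\<close> and \<open>b\<close>, so both mixed derivatives represent it at nearby
  points.\<close>

lemma second_difference_mean_value:
  fixes g :: "'a::euclidean_space \<Rightarrow> real"
  assumes S: "\<And>s t. 0 \<le> s \<Longrightarrow> s \<le> h \<Longrightarrow> 0 \<le> t \<Longrightarrow> t \<le> h \<Longrightarrow> x + s *\<^sub>R a + t *\<^sub>R b \<in> S"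
    and g: "\<And>y. y \<in> S \<Longrightarrow> g differentiable (at y)" "\<And>y. y \<in> S \<Longrightarrow> partial a g differentiable (at y)"
    and "h > 0"
  obtains s t where "0 < s" "s < h" "0 < t" "t < h"
    "g (x + h *\<^sub>R a + h *\<^sub>R b) - g (x + h *\<^sub>R a) - (g (x + h *\<^sub>R b) - g x)
      = h * h * partial b (partial a g) (x + s *\<^sub>R a + t *\<^sub>R b)"
proof -
  define F where "F s = g ((x + h *\<^sub>R b) + s *\<^sub>R a) - g (x + s *\<^sub>R a)" for s
  have F: "(F has_real_derivative
      (partial a g ((x + h *\<^sub>R b) + s *\<^sub>R a) - partial a g (x + s *\<^sub>R a))) (at s)"
    if "0 \<le> s" "s \<le> h" for s
    unfolding F_def using S[of s h] S[of s 0] that \<open>h > 0\<close>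
    by (intro DERIV_diff has_real_derivative_along_line g) (auto simp: algebra_simps)
  obtain s where s: "0 < s" "s < h"
    "F h - F 0 = (h - 0) * (partial a g ((x + h *\<^sub>R b) + s *\<^sub>R a) - partial a g (x + s *\<^sub>R a))"
    using MVT2[OF \<open>h > 0\<close> F] by auto
  define G where "G t = partial a g ((x + s *\<^sub>R a) + t *\<^sub>R b)" for t
  have G: "(G has_real_derivative partial b (partial a g) ((x + s *\<^sub>R a) + t *\<^sub>R b)) (at t)"
    if "0 \<le> t" "t \<le> h" for t
    unfolding G_def using S[of s t] that s
    by (intro has_real_derivative_along_line g) auto
  obtain t where t: "0 < t" "t < h"
    "G h - G 0 = (h - 0) * partial b (partial a g) ((x + s *\<^sub>R a) + t *\<^sub>R b)"
    using MVT2[OF \<open>h > 0\<close> G] by auto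
  show ?thesis
  proof (rule that[OF s(1,2) t(1,2)])
    show "g (x + h *\<^sub>R a + h *\<^sub>R b) - g (x + h *\<^sub>R a) - (g (x + h *\<^sub>R b) - g x)
      = h * h * partial b (partial a g) (x + s *\<^sub>R a + t *\<^sub>R b)"
      using s(3) t(3) by (simp add: F_def G_def algebra_simps)
  qed
qed

lemma partial_commute:
  fixes g :: "'a::euclidean_space \<Rightarrow> real"
  assumes S: "open S" "x \<in> S" and g: "cont_diff 2 S g"
  shows "partial a (partial b g) x = partial b (partial a g) x"
proof (rule ccontr)
  assume ne: "partial a (partial b g) x \<noteq> partial b (partial a g) x"
  define \<epsilon> where "\<epsilon> = \<bar>partial a (partial b g) x - partial b (partial a g) x\<bar> / 2"
  have \<epsilon>: "\<epsilon> > 0" using ne by (simp add: \<epsilon>_def)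
  have g1: "cont_diff 1 S (partial c g)" for c
    using cont_diff_partial[OF S(1), of 1 g c] g by (simp add: numeral_2_eq_2)
  then have g2: "continuous_on S (partial d (partial c g))" for c d
    using cont_diff_partial[OF S(1), of 0 "partial c g" d] by simp
  have diff: "g differentiable (at y)" "partial c g differentiable (at y)" if "y \<in> S" for y c
    using g g1[of c] that by (auto simp: numeral_2_eq_2)
  obtain d where d: "d > 0" "ball x d \<subseteq> S" using S open_contains_ball by blast
  have "\<exists>e>0. \<forall>y\<in>ball x e. \<bar>partial d' (partial c g) y - partial d' (partial c g) x\<bar> < \<epsilon>" for c d'
  proof -
    have "continuous (at x) (partial d' (partial c g))"
      using g2 S continuous_on_eq_continuous_at by blast
    then obtain e where "e > 0"
      "\<And>y. norm (y - x) < e \<Longrightarrow> \<bar>partial d' (partial c g) y - partial d' (partial c g) x\<bar> < \<epsilon>"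
      unfolding continuous_at_eps_delta dist_norm real_norm_def using \<epsilon> by blast
    then show ?thesis by (intro exI[of _ e]) (auto simp: dist_norm norm_minus_commute)
  qed
  then have ex: "\<exists>e>0. \<forall>y\<in>ball x e. \<bar>partial a (partial b g) y - partial a (partial b g) x\<bar> < \<epsilon>"
    "\<exists>e>0. \<forall>y\<in>ball x e. \<bar>partial b (partial a g) y - partial b (partial a g) x\<bar> < \<epsilon>" by simp_all
  obtain e1 e2 where e: "e1 > 0" "e2 > 0"
    "\<And>y. y \<in> ball x e1 \<Longrightarrow> \<bar>partial a (partial b g) y - partial a (partial b g) x\<bar> < \<epsilon>"
    "\<And>y. y \<in> ball x e2 \<Longrightarrow> \<bar>partial b (partial a g) y - partial b (partial a g) x\<bar> < \<epsilon>"
    using ex by (elim exE conjE) blast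
  define r where "r = min d (min e1 e2)"
  \<comment> \<open>Chosen so that the parallelogram at \<open>x\<close> with sides h a and h b
    stays inside the ball of radius r.\<close>
  define h where "h = r / (2 * (1 + norm a + norm b))"
  have r: "r > 0" using d e by (simp add: r_def)
  have den: "2 * (1 + norm a + norm b) > 0" by (smt (verit) norm_ge_zero)
  have h: "h > 0" using r den by (simp add: h_def)
  have "h * (norm a + norm b) \<le> h * (1 + norm a + norm b)" using h by (intro mult_left_mono) auto
  also have "\<dots> = r / 2" using den by (simp add: h_def field_simps)
  finally have hr: "h * (norm a + norm b) < r" using r by simp
  have near: "x + s *\<^sub>R a' + t *\<^sub>R b' \<in> ball x r"
    if "0 \<le> s" "s \<le> h" "0 \<le> t" "t \<le> h" "norm a' + norm b' = norm a + norm b" for s t a' b'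
  proof -
    have "dist x (x + s *\<^sub>R a' + t *\<^sub>R b') = norm (s *\<^sub>R a' + t *\<^sub>R b')"
      by (metis add.assoc add_diff_cancel_left' dist_commute dist_norm)
    also have "\<dots> \<le> s * norm a' + t * norm b'" using that norm_triangle_ineq[of "s *\<^sub>R a'" "t *\<^sub>R b'"] by simp
    also have "\<dots> \<le> h * norm a' + h * norm b'"
      using that by (intro add_mono mult_right_mono) auto
    also have "\<dots> = h * (norm a + norm b)"
      using that(5) by (metis distrib_left)
    finally show ?thesis using hr by simp
  qed
  have sub: "ball x r \<subseteq> S" using d by (auto simp: r_def)
  obtain s t where st: "0 < s" "s < h" "0 < t" "t < h"
    "g (x + h *\<^sub>R a + h *\<^sub>R b) - g (x + h *\<^sub>R a) - (g (x + h *\<^sub>R b) - g x)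
      = h * h * partial b (partial a g) (x + s *\<^sub>R a + t *\<^sub>R b)"
    by (rule second_difference_mean_value[of h x a b "ball x r" g]) (use near sub diff h in auto)
  obtain s' t' where st': "0 < s'" "s' < h" "0 < t'" "t' < h"
    "g (x + h *\<^sub>R b + h *\<^sub>R a) - g (x + h *\<^sub>R b) - (g (x + h *\<^sub>R a) - g x)
      = h * h * partial a (partial b g) (x + s' *\<^sub>R b + t' *\<^sub>R a)"
    by (rule second_difference_mean_value[of h x b a "ball x r" g])
      (use near sub diff h in \<open>auto simp: add.commute\<close>)
  have "x + h *\<^sub>R b + h *\<^sub>R a = x + h *\<^sub>R a + h *\<^sub>R b" by (simp add: algebra_simps)
  then have "h * h * partial b (partial a g) (x + s *\<^sub>R a + t *\<^sub>R b)
      = h * h * partial a (partial b g) (x + s' *\<^sub>R b + t' *\<^sub>R a)"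
    using st(5) st'(5) by (simp add: algebra_simps)
  then have "partial b (partial a g) (x + s *\<^sub>R a + t *\<^sub>R b)
      = partial a (partial b g) (x + s' *\<^sub>R b + t' *\<^sub>R a)" using h by simp
  moreover have "x + s *\<^sub>R a + t *\<^sub>R b \<in> ball x e2" "x + s' *\<^sub>R b + t' *\<^sub>R a \<in> ball x e1"
    using near[of s t a b] near[of s' t' b a] st st' by (auto simp: r_def)
  ultimately have "\<bar>partial a (partial b g) x - partial b (partial a g) x\<bar> < 2 * \<epsilon>"
    using e(3)[of "x + s' *\<^sub>R b + t' *\<^sub>R a"] e(4)[of "x + s *\<^sub>R a + t *\<^sub>R b"] by linarith
  then show False by (simp add: \<epsilon>_def)
qed

lemma smooth_on_partial_commute:
  "open S \<Longrightarrow> smooth_on S g \<Longrightarrow> x \<in> S \<Longrightarrow> partial a (partial b g) x = partial b (partial a g) x"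
  using partial_commute smooth_on_def by blast

section \<open>Second order conditions along a line and chain rules\<close>

text \<open>If c were positive, \<phi>' would be positive just to the right of 0, and the mean value
  theorem would give a larger value of \<phi> there.\<close>

lemma second_derivative_local_max:
  fixes \<phi> \<phi>' :: "real \<Rightarrow> real"
  assumes d: "d > 0" and \<phi>: "\<And>t. \<bar>t\<bar> < d \<Longrightarrow> (\<phi> has_real_derivative \<phi>' t) (at t)"
    and \<phi>': "(\<phi>' has_real_derivative c) (at 0)" and max: "\<And>t. \<bar>t\<bar> < d \<Longrightarrow> \<phi> t \<le> \<phi> 0"
  shows "\<phi>' 0 = 0" "c \<le> 0"
proof -
  show 0: "\<phi>' 0 = 0"
    by (rule DERIV_local_max[OF \<phi>[of 0] d]) (use d max in auto)
  show "c \<le> 0"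
  proof (rule ccontr)
    assume "\<not> c \<le> 0"
    then obtain e where e: "e > 0" "\<And>h. h > 0 \<Longrightarrow> h < e \<Longrightarrow> \<phi>' h > 0"
      using DERIV_pos_inc_right[OF \<phi>'] 0 by auto
    define t where "t = min d e / 2"
    have t: "t > 0" "t < d" "t < e" using d e by (auto simp: t_def)
    obtain z where "0 < z" "z < t" "\<phi> t - \<phi> 0 = (t - 0) * \<phi>' z"
      using MVT2[OF t(1), of \<phi> \<phi>'] \<phi> t by (auto simp: abs_if)
    then show False using e(2)[of z] t max[of t] mult_pos_pos[of t "\<phi>' z"] by (auto simp del: zero_less_mult_iff mult_pos_pos)
  qed
qed

lemma second_derivative_local_min:
  fixes \<phi> \<phi>' :: "real \<Rightarrow> real"
  assumes d: "d > 0" and \<phi>: "\<And>t. \<bar>t\<bar> < d \<Longrightarrow> (\<phi> has_real_derivative \<phi>' t) (at t)"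
    and \<phi>': "(\<phi>' has_real_derivative c) (at 0)" and min: "\<And>t. \<bar>t\<bar> < d \<Longrightarrow> \<phi> 0 \<le> \<phi> t"
  shows "\<phi>' 0 = 0" "c \<ge> 0"
  using second_derivative_local_max[OF d DERIV_minus[OF \<phi>] DERIV_minus[OF \<phi>']] min by auto

subsection \<open>Composition with a curve\<close>

lemma has_real_derivative_compose_curve:
  fixes g :: "'b::euclidean_space \<Rightarrow> real"
  assumes "g differentiable (at (c t))" "(c has_vector_derivative c') (at t)"
  shows "((\<lambda>t. g (c t)) has_real_derivative (\<Sum>b\<in>Basis. (c' \<bullet> b) * partial b g (c t))) (at t)"
proof -
  have "((\<lambda>t. g (c t)) has_derivative (\<lambda>h. partial (h *\<^sub>R c') g (c t))) (at t)"
    using assms(2) unfolding has_vector_derivative_def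
    by (rule has_derivative_compose[of c "\<lambda>h. h *\<^sub>R c'" t UNIV g "\<lambda>b. partial b g (c t)"])
      (rule has_derivative_partial[OF assms(1)])
  moreover have "partial (h *\<^sub>R c') g (c t) = (\<Sum>b\<in>Basis. (c' \<bullet> b) * partial b g (c t)) * h" for h
    using linear_scale[OF linear_partial[OF assms(1)]] partial_eq_sum_Basis[OF assms(1), of c']
    by simp
  ultimately show ?thesis by (simp add: has_field_derivative_def)
qed

lemma abs_sum_Basis_inner_le:
  fixes y :: "'b::euclidean_space"
  assumes "\<And>b. b \<in> Basis \<Longrightarrow> \<bar>p b\<bar> \<le> M"
  shows "\<bar>\<Sum>b\<in>Basis. (y \<bullet> b) * p b\<bar> \<le> DIM('b) * (norm y * M)"
proof -
  have "\<bar>\<Sum>b\<in>Basis. (y \<bullet> b) * p b\<bar> \<le> (\<Sum>b\<in>(Basis :: 'b set). norm y * M)"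
    using assms by (intro order_trans[OF sum_abs] sum_mono)
      (auto simp: abs_mult intro!: mult_mono Basis_le_norm)
  then show ?thesis by simp
qed

text \<open>Along the curve (ln f)'' = (Df . c'' + D^2 f (c', c')) / f - ((f o c)' / f)^2. As
  \<open>C2_bounded_by\<close> controls coordinate derivatives only, powers of the dimension appear.
  The second derivative is bounded from below, the side compared with the linearized
  operator.\<close>

lemma ln_compose_curve_derivatives:
  fixes f :: "'b::euclidean_space \<Rightarrow> real"
  assumes W: "open W" and f: "cont_diff 2 W f" "C2_bounded_by W f M"
    and f0: "f0 > 0" "\<And>w. w \<in> W \<Longrightarrow> f w \<ge> f0"
    and c: "\<And>t. \<bar>t\<bar> < d \<Longrightarrow> c t \<in> W" "\<And>t. \<bar>t\<bar> < d \<Longrightarrow> (c has_vector_derivative c' t) (at t)"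
      "(c' has_vector_derivative c'') (at 0)" and d: "d > 0"
  obtains p p' where "\<forall>t. \<bar>t\<bar> < d \<longrightarrow> ((\<lambda>t. ln (f (c t))) has_real_derivative p t) (at t)"
    "(p has_real_derivative p') (at 0)"
    "\<bar>p 0\<bar> \<le> real DIM('b) * M / f0 * norm (c' 0)"
    "p' \<ge> - (real DIM('b) * M / f0 * norm c'' + ((real DIM('b))\<^sup>2 * M / f0 + (real DIM('b) * M / f0)\<^sup>2) * (norm (c' 0))\<^sup>2)"
proof -
  let ?n = "real DIM('b)"
  define g where "g t = (\<Sum>b\<in>Basis. (c' t \<bullet> b) * partial b f (c t))" for t
  define g' where "g' = (\<Sum>b\<in>Basis. (c'' \<bullet> b) * partial b f (c 0)
      + (c' 0 \<bullet> b) * (\<Sum>a\<in>Basis. (c' 0 \<bullet> a) * partial a (partial b f) (c 0)))"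
  have diff: "f differentiable (at w)" "b \<in> Basis \<Longrightarrow> partial b f differentiable (at w)" if "w \<in> W" for w b
    using f(1) that by (auto simp: numeral_2_eq_2)
  have bd: "\<bar>f w\<bar> \<le> M" "b \<in> Basis \<Longrightarrow> \<bar>partial b f w\<bar> \<le> M"
    "b \<in> Basis \<Longrightarrow> a \<in> Basis \<Longrightarrow> \<bar>partial a (partial b f) w\<bar> \<le> M" if "w \<in> W" for w a b
    using f(2) that by (auto simp: C2_bounded_by_def)
  have c0: "c 0 \<in> W" "(c has_vector_derivative c' 0) (at 0)" using c d by auto
  have M: "M \<ge> 0" using bd(1)[OF c0(1)] by linarith
  have g: "((\<lambda>t. f (c t)) has_real_derivative g t) (at t)" if "\<bar>t\<bar> < d" for t
    unfolding g_def using that c diff by (intro has_real_derivative_compose_curve) auto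
  have dg: "(g has_real_derivative g') (at 0)"
    unfolding g_def g'_def
  proof (rule DERIV_sum)
    fix b :: 'b assume b: "b \<in> Basis"
    have "((\<lambda>t. c' t \<bullet> b) has_real_derivative c'' \<bullet> b) (at 0)"
      using bounded_linear.has_vector_derivative[OF bounded_linear_inner_left c(3)]
      by (simp add: has_real_derivative_iff_has_vector_derivative)
    from DERIV_mult[OF this has_real_derivative_compose_curve[OF diff(2)[OF c0(1) b] c0(2)]]
    show "((\<lambda>t. (c' t \<bullet> b) * partial b f (c t)) has_real_derivative
      (c'' \<bullet> b) * partial b f (c 0)
      + (c' 0 \<bullet> b) * (\<Sum>a\<in>Basis. (c' 0 \<bullet> a) * partial a (partial b f) (c 0))) (at 0)"
      by (simp add: mult.commute add.commute)
  qed
  have fpos: "f w > 0" if "w \<in> W" for w using f0 that by (meson less_le_trans)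
  show ?thesis
  proof (rule that[of "\<lambda>t. g t / f (c t)" "g' / f (c 0) - (g 0 / f (c 0))\<^sup>2"])
    have "((\<lambda>t. ln (f (c t))) has_real_derivative g t / f (c t)) (at t)" if "\<bar>t\<bar> < d" for t
      using DERIV_chain2[OF DERIV_ln_divide g[OF that]] fpos[OF c(1)[OF that]] by simp
    then show "\<forall>t. \<bar>t\<bar> < d \<longrightarrow> ((\<lambda>t. ln (f (c t))) has_real_derivative g t / f (c t)) (at t)"
      by blast
    show "((\<lambda>t. g t / f (c t)) has_real_derivative g' / f (c 0) - (g 0 / f (c 0))\<^sup>2) (at 0)"
      using DERIV_divide[OF dg g[of 0]] fpos[OF c0(1)] d
      by (simp add: power2_eq_square diff_divide_distrib)
    have g0: "\<bar>g 0\<bar> \<le> ?n * (norm (c' 0) * M)"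
      unfolding g_def using bd[OF c0(1)] by (intro abs_sum_Basis_inner_le) auto
    have inv: "\<bar>y / f (c 0)\<bar> \<le> Y / f0" if "\<bar>y\<bar> \<le> Y" for y Y
      using that f0(1) f0(2)[OF c0(1)] unfolding abs_divide by (intro frac_le) auto
    show 1: "\<bar>g 0 / f (c 0)\<bar> \<le> ?n * M / f0 * norm (c' 0)"
      using inv[OF g0] by (simp add: mult_ac)
    have "g' = (\<Sum>b\<in>Basis. (c'' \<bullet> b) * partial b f (c 0))
      + (\<Sum>b\<in>Basis. (c' 0 \<bullet> b) * (\<Sum>a\<in>Basis. (c' 0 \<bullet> a) * partial a (partial b f) (c 0)))"
      by (simp add: g'_def sum.distrib)
    moreover have "\<bar>\<Sum>b\<in>Basis. (c'' \<bullet> b) * partial b f (c 0)\<bar> \<le> ?n * (norm c'' * M)"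
      using bd[OF c0(1)] by (intro abs_sum_Basis_inner_le) auto
    moreover have "\<bar>\<Sum>b\<in>Basis. (c' 0 \<bullet> b) * (\<Sum>a\<in>Basis. (c' 0 \<bullet> a) * partial a (partial b f) (c 0))\<bar>
        \<le> ?n * (norm (c' 0) * (?n * (norm (c' 0) * M)))"
      using bd[OF c0(1)] by (intro abs_sum_Basis_inner_le) auto
    ultimately have "\<bar>g'\<bar> \<le> ?n * (norm c'' * M) + ?n * (norm (c' 0) * (?n * (norm (c' 0) * M)))"
      by linarith
    from inv[OF this] have "\<bar>g' / f (c 0)\<bar> \<le> ?n * M / f0 * norm c'' + ?n\<^sup>2 * M / f0 * (norm (c' 0))\<^sup>2"
      by (simp add: add_divide_distrib power2_eq_square mult_ac)
    moreover have "(g 0 / f (c 0))\<^sup>2 \<le> (?n * M / f0 * norm (c' 0))\<^sup>2"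
      using power_mono[OF 1 abs_ge_zero, of 2] by (simp only: power2_abs)
    then have "(g 0 / f (c 0))\<^sup>2 \<le> (?n * M / f0)\<^sup>2 * (norm (c' 0))\<^sup>2"
      by (simp add: power_mult_distrib power_divide)
    ultimately show "g' / f (c 0) - (g 0 / f (c 0))\<^sup>2 \<ge>
        - (?n * M / f0 * norm c'' + (?n\<^sup>2 * M / f0 + (?n * M / f0)\<^sup>2) * (norm (c' 0))\<^sup>2)"
      unfolding distrib_right by linarith
  qed
qed

section \<open>The linearized equation\<close>

lemma partial_eq_sum_axis:
  fixes g :: "real^'n \<Rightarrow> real"
  assumes "g differentiable (at x)"
  shows "partial b g x = (\<Sum>i\<in>UNIV. b $ i * partial (axis i 1) g x)"
proof -
  have "partial b g x = partial (\<Sum>i\<in>UNIV. b $ i *\<^sub>R axis i 1) g x"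
    by (simp add: basis_expansion[of b] scalar_mult_eq_scaleR[symmetric])
  then show ?thesis
    by (simp add: linear_sum[OF linear_partial[OF assms]] linear_scale[OF linear_partial[OF assms]])
qed

context
  fixes S :: "(real^'n) set" and u :: "real^'n \<Rightarrow> real"
  assumes S: "open S" and u: "smooth_on S u"
begin

lemma smooth_partials:
  "smooth_on S (partial a u)" "smooth_on S (partial a (partial b u))"
  "smooth_on S (partial a (partial b (partial c u)))"
  by (intro smooth_on_partial S u)+

lemma inner_hess:
  assumes "x \<in> S"
  shows "a \<bullet> (hess u x *v b) = partial a (partial b u) x"
proof -
  have "partial a (partial b u) x = (\<Sum>i\<in>UNIV. a $ i * partial (axis i 1) (partial b u) x)"
    by (intro partial_eq_sum_axis smooth_on_differentiable[OF _ assms] smooth_partials)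
  also have "\<dots> = (\<Sum>i\<in>UNIV. a $ i * (\<Sum>j\<in>UNIV. b $ j * partial (axis j 1) (partial (axis i 1) u) x))"
    unfolding smooth_on_partial_commute[OF S u assms, of _ b]
    by (intro sum.cong refl arg_cong[of _ _ "(*) _"] partial_eq_sum_axis
        smooth_on_differentiable[OF _ assms] smooth_partials)
  also have "\<dots> = a \<bullet> (hess u x *v b)"
    by (simp add: inner_vec_def matrix_vector_mult_def hess_def mult.commute)
  finally show ?thesis by simp
qed

lemma transpose_hess: "x \<in> S \<Longrightarrow> transpose (hess u x) = hess u x"
  using smooth_on_partial_commute[OF S u, of x]
  by (simp add: transpose_def hess_def vec_eq_iff)

lemma transpose_eta: "x \<in> S \<Longrightarrow> transpose (eta u x) = eta u x"
  using transpose_hess[of x]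
  by (auto simp: transpose_def eta_def vec_eq_iff mat_def)

lemma partial_commute3:
  assumes "x \<in> S"
  shows "partial a (partial b (partial c u)) x = partial b (partial c (partial a u)) x"
proof -
  have "partial a (partial b (partial c u)) x = partial b (partial a (partial c u)) x"
    by (rule smooth_on_partial_commute[OF S smooth_partials(1) assms])
  also have "\<dots> = partial b (partial c (partial a u)) x"
    by (rule partial_cong_on_open[OF S assms]) (rule smooth_on_partial_commute[OF S u])
  finally show ?thesis .
qed

lemma line_in_open:
  assumes "x \<in> S"
  obtains d where "d > 0" "\<And>t. \<bar>t\<bar> < d \<Longrightarrow> x + t *\<^sub>R s \<in> S"
proof -
  obtain e where e: "e > 0" "ball x e \<subseteq> S" using S assms open_contains_ball by blast
  show thesis
  proof (rule that[of "e / (1 + norm s)"])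
    have n: "1 + norm s > 0" by (smt (verit) norm_ge_zero)
    then show "e / (1 + norm s) > 0" using e by simp
    fix t assume "\<bar>t\<bar> < e / (1 + norm s)"
    then have "\<bar>t\<bar> * (1 + norm s) < e" using n by (simp add: pos_less_divide_eq)
    then have "\<bar>t\<bar> * norm s < e" by (simp add: distrib_left)
    then show "x + t *\<^sub>R s \<in> S" using e(2) by (auto simp: dist_norm subset_eq)
  qed
qed

lemma grad_along_line:
  assumes "x + t *\<^sub>R s \<in> S" and g: "smooth_on S g"
  shows "((\<lambda>t. grad g (x + t *\<^sub>R s)) has_vector_derivative grad (partial s g) (x + t *\<^sub>R s)) (at t)"
proof -
  have grad: "grad h y = (\<Sum>i\<in>UNIV. partial (axis i 1) h y *\<^sub>R axis i 1)" for h :: "real^'n \<Rightarrow> real" and y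
    using basis_expansion[of "grad h y"] by (simp add: grad_def scalar_mult_eq_scaleR)
  have "((\<lambda>t. partial (axis i 1) g (x + t *\<^sub>R s)) has_derivative
      (*) (partial (axis i 1) (partial s g) (x + t *\<^sub>R s))) (at t)" for i
    using has_real_derivative_along_line[OF smooth_on_differentiable[OF smooth_on_partial[OF S g] assms(1)],
      of "axis i 1"]
    unfolding smooth_on_partial_commute[OF S g assms(1), of s] has_field_derivative_def .
  then have "((\<lambda>t. grad g (x + t *\<^sub>R s)) has_derivative (\<lambda>h. \<Sum>i\<in>UNIV.
      (partial (axis i 1) (partial s g) (x + t *\<^sub>R s) * h) *\<^sub>R axis i 1)) (at t)"
    unfolding grad[of g] by (intro has_derivative_sum has_derivative_scaleR_left)
  then show ?thesis
    unfolding has_vector_derivative_def grad[of "partial s g"]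
    by (simp add: scaleR_sum_right mult.commute)
qed

end

lemma orthonormal_trace:
  fixes A :: "real^'n^'n"
  assumes "orthonormal q"
  shows "(\<Sum>i\<in>UNIV. q i \<bullet> (A *v q i)) = (\<Sum>i\<in>UNIV. A $ i $ i)"
proof -
  have delta: "(\<Sum>i\<in>UNIV. q i $ k * q i $ l) = (if k = l then 1 else 0)" for k l
  proof -
    have "(axis l 1 :: real^'n) $ k = (\<Sum>i\<in>UNIV. (q i \<bullet> axis l 1) *\<^sub>R q i) $ k"
      using orthonormal_expand[OF assms, of "axis l 1"] by simp
    then have "(\<Sum>i\<in>UNIV. q i $ k * q i $ l) = (axis l 1 :: real^'n) $ k"
      by (simp add: inner_axis mult.commute)
    then show ?thesis by (simp add: axis_def)
  qed
  have "(\<Sum>i\<in>UNIV. q i \<bullet> (A *v q i)) = (\<Sum>i\<in>UNIV. \<Sum>k\<in>UNIV. \<Sum>l\<in>UNIV. A $ k $ l * (q i $ k * q i $ l))"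
    by (simp add: inner_vec_def matrix_vector_mult_def sum_distrib_left mult_ac)
  also have "\<dots> = (\<Sum>k\<in>UNIV. \<Sum>i\<in>UNIV. \<Sum>l\<in>UNIV. A $ k $ l * (q i $ k * q i $ l))"
    by (rule sum.swap)
  also have "\<dots> = (\<Sum>k\<in>UNIV. \<Sum>l\<in>UNIV. \<Sum>i\<in>UNIV. A $ k $ l * (q i $ k * q i $ l))"
    by (intro sum.cong refl sum.swap)
  also have "\<dots> = (\<Sum>k\<in>UNIV. A $ k $ k)"
    by (simp add: sum_distrib_left[symmetric] delta if_distrib[of "\<lambda>x. _ * x"] cong: if_cong)
  finally show ?thesis .
qed

lemma inner_eta:
  fixes u :: "real^'n \<Rightarrow> real"
  assumes "open S" "smooth_on S u" "x \<in> S" and q: "orthonormal q"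
  shows "q i \<bullet> (eta u x *v q i)
    = (\<Sum>j\<in>UNIV. partial (q j) (partial (q j) u) x) - partial (q i) (partial (q i) u) x"
proof -
  have "eta u x *v q i = laplacian u x *\<^sub>R q i - hess u x *v q i"
    by (simp add: eta_def matrix_vector_mult_diff_rdistrib scaleR_matrix_vector_assoc[symmetric])
  moreover have "q i \<bullet> q i = 1" using q by (simp add: orthonormal_def)
  moreover have "laplacian u x = (\<Sum>j\<in>UNIV. partial (q j) (partial (q j) u) x)"
    using orthonormal_trace[OF q, of "hess u x"]
    by (simp add: laplacian_def inner_hess[OF assms(1-3)])
  ultimately show ?thesis
    by (simp add: inner_diff_right inner_hess[OF assms(1-3)])
qed

text \<open>In the basis \<open>q\<close> the matrix \<open>eta\<close> has the diagonal entries
  \<Delta>u - u_ii. Moving the trace from the increments h_i onto the coefficients L_i turns them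
  into a_i = T - L_i.\<close>

lemma quotient_linearization:
  fixes u :: "real^'n \<Rightarrow> real"
  assumes S: "open S" and u: "smooth_on S u" and x0: "x0 \<in> S"
    and \<Gamma>: "\<And>x. x \<in> S \<Longrightarrow> eigvals (eta u x) \<in> Gamma k" and kl: "l < k" "k < CARD('n)"
    and eq: "\<And>x. x \<in> S \<Longrightarrow> sigma_mat k (eta u x) / sigma_mat l (eta u x) = F x"
    and M: "F x0 \<le> M"
  obtains q :: "'n \<Rightarrow> real^'n" and T :: real and a :: "'n \<Rightarrow> real" where
    "orthonormal q" "1 \<le> real CARD('n) * max 1 M * T"
    "\<forall>i. T \<le> (real CARD('n) + 1) * a i" "\<forall>i. a i \<le> 2 * T"
    "\<forall>x\<in>S. ln (F x) - ln (F x0)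
      \<le> (\<Sum>i\<in>UNIV. a i * (partial (q i) (partial (q i) u) x - partial (q i) (partial (q i) u) x0))"
proof -
  have M': "sigma_mat k (eta u x0) / sigma_mat l (eta u x0) \<le> M" using eq[OF x0] M by simp
  obtain L :: "'n \<Rightarrow> real" and q :: "'n \<Rightarrow> real^'n" where q: "orthonormal q"
    and L: "\<And>B. transpose B = B \<Longrightarrow> eigvals B \<in> Gamma k \<Longrightarrow>
      ln (sigma_mat k B / sigma_mat l B) - ln (sigma_mat k (eta u x0) / sigma_mat l (eta u x0))
        \<le> (\<Sum>i\<in>UNIV. L i * (q i \<bullet> (B *v q i) - q i \<bullet> (eta u x0 *v q i)))"
    and T: "1 \<le> real CARD('n) * max 1 M * sum L UNIV"
      "\<And>i. sum L UNIV \<le> (real CARD('n) + 1) * (sum L UNIV - L i)"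
      "\<And>i. sum L UNIV - L i \<le> 2 * sum L UNIV"
    by (rule matrix_log_quotient_linearization[OF transpose_eta[OF S u x0] \<Gamma>[OF x0] kl M']) blast
  show ?thesis
  proof (rule that[of q "sum L UNIV" "\<lambda>i. sum L UNIV - L i", OF q T(1)])
    show "\<forall>i. sum L UNIV \<le> (real CARD('n) + 1) * (sum L UNIV - L i)"
      "\<forall>i. sum L UNIV - L i \<le> 2 * sum L UNIV" using T(2,3) by blast+
  next
    show "\<forall>x\<in>S. ln (F x) - ln (F x0) \<le> (\<Sum>i\<in>UNIV. (sum L UNIV - L i) *
        (partial (q i) (partial (q i) u) x - partial (q i) (partial (q i) u) x0))"
    proof
      fix x assume x: "x \<in> S"
      define h where "h i = partial (q i) (partial (q i) u) x - partial (q i) (partial (q i) u) x0" for i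
      have "q i \<bullet> (eta u x *v q i) - q i \<bullet> (eta u x0 *v q i) = sum h UNIV - h i" for i
        unfolding inner_eta[OF S u x q] inner_eta[OF S u x0 q] by (simp add: h_def sum_subtractf)
      then have "ln (F x) - ln (F x0) \<le> (\<Sum>i\<in>UNIV. L i * (sum h UNIV - h i))"
        using L[OF transpose_eta[OF S u x] \<Gamma>[OF x]] eq[OF x] eq[OF x0] by simp
      also have "\<dots> = (\<Sum>i\<in>UNIV. (sum L UNIV - L i) * h i)"
        by (simp add: right_diff_distrib left_diff_distrib sum_subtractf sum_distrib_left[symmetric]
            sum_distrib_right[symmetric])
      finally show "ln (F x) - ln (F x0) \<le> (\<Sum>i\<in>UNIV. (sum L UNIV - L i) *
          (partial (q i) (partial (q i) u) x - partial (q i) (partial (q i) u) x0))"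
        by (simp add: h_def)
    qed
  qed
qed

lemma norm_triple_le: "norm (a, b, c) \<le> norm a + norm b + norm c"
  using norm_Pair_le[of a "(b, c)"] norm_Pair_le[of b c] by linarith

text \<open>No differentiability of the eigenvalues is used: the linearization touches the logarithm of
  the equation from above at \<open>x0\<close>, so the first and second derivatives along lines compare.\<close>
lemma differentiated_equation:
  fixes u :: "real^'n \<Rightarrow> real" and f :: "(real^'n) \<times> real \<times> (real^'n) \<Rightarrow> real"
  assumes S: "open S" and u: "smooth_on S u" and x0: "x0 \<in> S"
    and \<Gamma>: "\<And>x. x \<in> S \<Longrightarrow> eigvals (eta u x) \<in> Gamma k" and kl: "l < k" "k < CARD('n)"
    and eq: "\<And>x. x \<in> S \<Longrightarrow> sigma_mat k (eta u x) / sigma_mat l (eta u x) = f (x, u x, grad u x)"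
    and f: "cont_diff 2 (S \<times> UNIV \<times> UNIV) f" "C2_bounded_by (S \<times> UNIV \<times> UNIV) f M"
    and f0: "f0 > 0" "\<And>w. w \<in> S \<times> UNIV \<times> UNIV \<Longrightarrow> f w \<ge> f0"
  defines "A \<equiv> real DIM((real^'n) \<times> real \<times> (real^'n)) * M / f0"
    and "B \<equiv> (real DIM((real^'n) \<times> real \<times> (real^'n)))\<^sup>2 * M / f0
      + (real DIM((real^'n) \<times> real \<times> (real^'n)) * M / f0)\<^sup>2"
  obtains q :: "'n \<Rightarrow> real^'n" and T :: real and a :: "'n \<Rightarrow> real" where
    "orthonormal q" "1 \<le> real CARD('n) * max 1 M * T"
    "\<forall>i. T \<le> (real CARD('n) + 1) * a i" "\<forall>i. a i \<le> 2 * T"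
    "\<forall>s. \<bar>\<Sum>i\<in>UNIV. a i * partial (q i) (partial (q i) (partial s u)) x0\<bar>
      \<le> A * (norm s + \<bar>partial s u x0\<bar> + norm (grad (partial s u) x0))"
    "\<forall>s. - (A * (\<bar>partial s (partial s u) x0\<bar> + norm (grad (partial s (partial s u)) x0))
        + B * (norm s + \<bar>partial s u x0\<bar> + norm (grad (partial s u) x0))\<^sup>2)
      \<le> (\<Sum>i\<in>UNIV. a i * partial (q i) (partial (q i) (partial s (partial s u))) x0)"
proof -
  let ?W = "S \<times> UNIV \<times> UNIV :: ((real^'n) \<times> real \<times> (real^'n)) set"
  define F where "F x = f (x, u x, grad u x)" for x
  have W: "open ?W" using S by (intro open_Times) auto
  have M: "F x0 \<le> M" "M \<ge> 0"
  proof -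
    have w: "(x0, u x0, grad u x0) \<in> ?W" using x0 by simp
    then have "\<bar>F x0\<bar> \<le> M" using f(2) unfolding C2_bounded_by_def F_def by blast
    moreover have "F x0 \<ge> f0" using f0(2)[OF w] by (simp add: F_def)
    ultimately show "F x0 \<le> M" "M \<ge> 0" using f0(1) by auto
  qed
  have AB: "A \<ge> 0" "B \<ge> 0" using M f0 by (simp_all add: A_def B_def)
  have eqF: "sigma_mat k (eta u x) / sigma_mat l (eta u x) = F x" if "x \<in> S" for x
    using eq[OF that] by (simp add: F_def)
  obtain q :: "'n \<Rightarrow> real^'n" and a :: "'n \<Rightarrow> real" and T :: real where
    q: "orthonormal q" and aT: "1 \<le> real CARD('n) * max 1 M * T"
    "\<forall>i. T \<le> (real CARD('n) + 1) * a i" "\<forall>i. a i \<le> 2 * T"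
    and lin: "\<forall>x\<in>S. ln (F x) - ln (F x0)
      \<le> (\<Sum>i\<in>UNIV. a i * (partial (q i) (partial (q i) u) x - partial (q i) (partial (q i) u) x0))"
    by (rule quotient_linearization[OF S u x0 \<Gamma> kl eqF M(1)])
  have main: "\<bar>\<Sum>i\<in>UNIV. a i * partial (q i) (partial (q i) (partial s u)) x0\<bar>
      \<le> A * (norm s + \<bar>partial s u x0\<bar> + norm (grad (partial s u) x0)) \<and>
    - (A * (\<bar>partial s (partial s u) x0\<bar> + norm (grad (partial s (partial s u)) x0))
        + B * (norm s + \<bar>partial s u x0\<bar> + norm (grad (partial s u) x0))\<^sup>2)
      \<le> (\<Sum>i\<in>UNIV. a i * partial (q i) (partial (q i) (partial s (partial s u))) x0)" for s
  proof -
    obtain d where d: "d > 0" "\<And>t. \<bar>t\<bar> < d \<Longrightarrow> x0 + t *\<^sub>R s \<in> S"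
      by (rule line_in_open[OF S u x0, of s]) blast
    define c where "c t = (x0 + t *\<^sub>R s, u (x0 + t *\<^sub>R s), grad u (x0 + t *\<^sub>R s))" for t
    define c' where "c' t = (s, partial s u (x0 + t *\<^sub>R s), grad (partial s u) (x0 + t *\<^sub>R s))" for t
    define c'' where "c'' = (0 :: real^'n, partial s (partial s u) x0, grad (partial s (partial s u)) x0)"
    have line: "((\<lambda>t. g (x0 + t *\<^sub>R s)) has_vector_derivative partial s g (x0 + t *\<^sub>R s)) (at t)"
      if "smooth_on S g" "\<bar>t\<bar> < d" for g t
      using has_real_derivative_along_line[OF smooth_on_differentiable[OF that(1) d(2)[OF that(2)]]]
      by (simp add: has_real_derivative_iff_has_vector_derivative)
    have pair: "((\<lambda>t. (f1 t, f2 t)) has_vector_derivative (d1, d2)) (at t)"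
      if "(f1 has_vector_derivative d1) (at t)" "(f2 has_vector_derivative d2) (at t)"
      for t :: real and f1 :: "real \<Rightarrow> 'x::real_normed_vector" and f2 :: "real \<Rightarrow> 'y::real_normed_vector" and d1 d2
      using has_derivative_Pair[OF that[unfolded has_vector_derivative_def]]
      by (simp add: has_vector_derivative_def)
    have c: "(c has_vector_derivative c' t) (at t)" if "\<bar>t\<bar> < d" for t
      unfolding c_def c'_def
      by (intro pair line[OF u that] grad_along_line[OF S u d(2)[OF that] u])
        (auto intro!: derivative_eq_intros)
    have c': "(c' has_vector_derivative c'') (at 0)"
    proof -
      have "(c' has_vector_derivative (0, partial s (partial s u) (x0 + 0 *\<^sub>R s),
          grad (partial s (partial s u)) (x0 + 0 *\<^sub>R s))) (at 0)"
        unfolding c'_def using d x0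
        by (intro pair line smooth_partials[OF S u] grad_along_line[OF S u])
          (auto intro!: derivative_eq_intros)
      then show ?thesis by (simp add: c''_def)
    qed
    have cW: "c t \<in> ?W" if "\<bar>t\<bar> < d" for t using d(2)[OF that] by (simp add: c_def)
    obtain p p' where p: "\<forall>t. \<bar>t\<bar> < d \<longrightarrow> ((\<lambda>t. ln (f (c t))) has_real_derivative p t) (at t)"
      "(p has_real_derivative p') (at 0)" "\<bar>p 0\<bar> \<le> A * norm (c' 0)"
      "p' \<ge> - (A * norm c'' + B * (norm (c' 0))\<^sup>2)"
      unfolding A_def B_def by (rule ln_compose_curve_derivatives[OF W f f0 cW c c' d(1)]) blast
    have qs: "smooth_on S (partial (q i) (partial (q i) u))" for i
      by (rule smooth_partials[OF S u])
    \<comment> \<open>The majorant minus ln f has a minimum at t = 0. The vanishing first derivative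
      gives an equation, hence the two-sided bound on the operator applied to u_s; the second
      derivative gives the lower bound for u_ss.\<close>
    define \<phi> where "\<phi> t = (\<Sum>i\<in>UNIV. a i * partial (q i) (partial (q i) u) (x0 + t *\<^sub>R s)) - ln (f (c t))" for t
    define \<phi>' where "\<phi>' t = (\<Sum>i\<in>UNIV. a i * partial s (partial (q i) (partial (q i) u)) (x0 + t *\<^sub>R s)) - p t" for t
    define \<phi>'' where "\<phi>'' = (\<Sum>i\<in>UNIV. a i * partial s (partial s (partial (q i) (partial (q i) u))) (x0 + 0 *\<^sub>R s)) - p'"
    have "(\<phi> has_real_derivative \<phi>' t) (at t)" if t: "\<bar>t\<bar> < d" for t
      unfolding \<phi>_def \<phi>'_def
      by (intro DERIV_diff DERIV_sum DERIV_cmult p(1)[rule_format, OF t] has_real_derivative_along_line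
          smooth_on_differentiable[OF qs d(2)[OF t]])
    moreover have "(\<phi>' has_real_derivative \<phi>'') (at 0)"
      unfolding \<phi>'_def \<phi>''_def
      by (intro DERIV_diff DERIV_sum DERIV_cmult p(2) has_real_derivative_along_line
          smooth_on_differentiable[of S] smooth_partials[OF S u]) (use d x0 in auto)
    moreover have "\<phi> 0 \<le> \<phi> t" if t: "\<bar>t\<bar> < d" for t
      using bspec[OF lin d(2)[OF t]]
      by (simp add: \<phi>_def c_def F_def right_diff_distrib sum_subtractf)
    ultimately have \<phi>: "\<phi>' 0 = 0" "\<phi>'' \<ge> 0"
      using second_derivative_local_min[OF d(1)] by blast+
    have p0: "p 0 = (\<Sum>i\<in>UNIV. a i * partial (q i) (partial (q i) (partial s u)) x0)"
      using \<phi>(1) by (simp add: \<phi>'_def partial_commute3[OF S u x0])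
    have "partial s (partial s (partial b (partial b u))) x0 = partial b (partial b (partial s (partial s u))) x0" for b
    proof -
      have "partial s (partial s (partial b (partial b u))) x0 = partial s (partial b (partial b (partial s u))) x0"
        by (rule partial_cong_on_open[OF S x0]) (rule partial_commute3[OF S u])
      also have "\<dots> = partial b (partial b (partial s (partial s u))) x0"
        by (rule partial_commute3[OF S smooth_partials(1)[OF S u] x0])
      finally show ?thesis .
    qed
    then have p': "p' \<le> (\<Sum>i\<in>UNIV. a i * partial (q i) (partial (q i) (partial s (partial s u))) x0)"
      using \<phi>(2) by (simp add: \<phi>''_def)
    have n1: "norm (c' 0) \<le> norm s + \<bar>partial s u x0\<bar> + norm (grad (partial s u) x0)"
      using norm_triple_le[of s "partial s u x0" "grad (partial s u) x0"] by (simp add: c'_def)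
    have n2: "norm c'' \<le> \<bar>partial s (partial s u) x0\<bar> + norm (grad (partial s (partial s u)) x0)"
      using norm_triple_le[of "0 :: real^'n" "partial s (partial s u) x0" "grad (partial s (partial s u)) x0"]
      by (simp add: c''_def)
    have "A * norm (c' 0) \<le> A * (norm s + \<bar>partial s u x0\<bar> + norm (grad (partial s u) x0))"
      using n1 AB by (intro mult_left_mono)
    moreover have "A * norm c'' \<le> A * (\<bar>partial s (partial s u) x0\<bar> + norm (grad (partial s (partial s u)) x0))"
      using n2 AB by (intro mult_left_mono)
    moreover have "B * (norm (c' 0))\<^sup>2 \<le> B * (norm s + \<bar>partial s u x0\<bar> + norm (grad (partial s u) x0))\<^sup>2"
      using n1 AB by (intro mult_left_mono power_mono) auto
    ultimately show ?thesis using p(3,4) p' unfolding p0[symmetric] by linarith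
  qed
  show ?thesis
    by (rule that[OF q aT]) (use main in blast)+
qed

section \<open>The test function\<close>

lemma sum_eigvals:
  fixes A :: "real^'n^'n"
  assumes "transpose A = A"
  shows "(\<Sum>i\<in>UNIV. eigvals A $ i) = (\<Sum>i\<in>UNIV. A $ i $ i)"
proof -
  obtain p where p: "orthonormal p" "\<And>x. x \<bullet> (A *v x) = (\<Sum>i\<in>UNIV. eigvals A $ i * (p i \<bullet> x)\<^sup>2)"
    by (rule eigvals_expand[OF assms]) blast
  have "p i \<bullet> (A *v p i) = eigvals A $ i" for i
  proof -
    have "p i \<bullet> (A *v p i) = (\<Sum>j\<in>UNIV. if j = i then eigvals A $ j else 0)"
      unfolding p(2) using p(1) by (intro sum.cong) (auto simp: orthonormal_def)
    then show ?thesis by simp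
  qed
  then show ?thesis using orthonormal_trace[OF p(1), of A] by simp
qed

text \<open>sigma_1 of \<open>eta\<close> is its trace, that is (n - 1) \<Delta>u.\<close>

lemma laplacian_pos:
  fixes u :: "real^'n \<Rightarrow> real"
  assumes "open S" "smooth_on S u" "x \<in> S" and v: "eigvals (eta u x) \<in> Gamma k" and "1 \<le> k"
  shows "laplacian u x > 0"
proof -
  have "esym UNIV 1 (($) (eigvals (eta u x))) = (\<Sum>i\<in>UNIV. eigvals (eta u x) $ i)"
    using Suc_mult_esym_Suc[of UNIV 0 "($) (eigvals (eta u x))"] by simp
  moreover have "0 < sigma 1 (eigvals (eta u x))" using v \<open>1 \<le> k\<close> by (simp add: Gamma_def)
  ultimately have "0 < (\<Sum>i\<in>UNIV. eta u x $ i $ i)"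
    using sum_eigvals[OF transpose_eta[OF assms(1-3)]] by (simp add: sigma_eq_esym)
  also have "\<dots> = (real CARD('n) - 1) * laplacian u x"
    by (simp add: eta_def mat_def sum_subtractf laplacian_def algebra_simps)
  finally have "0 < (real CARD('n) - 1) * laplacian u x" .
  moreover have "CARD('n) \<ge> 1" by (simp add: Suc_leI)
  then have "real CARD('n) - 1 \<ge> 0" by simp
  ultimately show ?thesis by (simp add: zero_less_mult_iff)
qed

text \<open>Upper bounds for the pure second derivatives control all entries: the diagonal from below by
  the trace, the others by polarization.\<close>
lemma hess_entry_bound:
  fixes H :: "real^'n^'n"
  assumes sym: "transpose H = H" and tr: "(\<Sum>i\<in>UNIV. H $ i $ i) \<ge> 0"
    and le: "\<And>e. norm e = 1 \<Longrightarrow> e \<bullet> (H *v e) \<le> w"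
  shows "\<bar>H $ i $ j\<bar> \<le> real CARD('n) * w"
proof -
  let ?n = "real CARD('n)"
  have n: "?n \<ge> 1" by (simp add: Suc_leI)
  have sym': "H $ i $ j = H $ j $ i" for i j using sym by (metis transpose_def vec_lambda_beta)
  have quad: "(a *\<^sub>R axis i 1 + b *\<^sub>R axis j 1) \<bullet> (H *v (a *\<^sub>R axis i 1 + b *\<^sub>R axis j 1))
      = a\<^sup>2 * H $ i $ i + b\<^sup>2 * H $ j $ j + 2 * a * b * H $ i $ j" for a b i j
    using sym'[of i j]
    by (simp add: matrix_vector_right_distrib matrix_vector_mult_scaleR matrix_vector_mult_basis
        inner_add_left inner_add_right inner_axis' column_def power2_eq_square algebra_simps)
  have diag: "H $ i $ i \<le> w" for i
    using le[of "1 *\<^sub>R axis i 1 + 0 *\<^sub>R axis i 1"] unfolding quad by simp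
  have lower: "H $ i $ i \<ge> - (?n - 1) * w" for i
  proof -
    have "0 \<le> H $ i $ i + (\<Sum>j\<in>UNIV - {i}. H $ j $ j)"
      using tr by (simp add: sum.remove[of UNIV i])
    also have "(\<Sum>j\<in>UNIV - {i}. H $ j $ j) \<le> (\<Sum>j\<in>UNIV - {i}. w)"
      by (intro sum_mono diag)
    also have "\<dots> = (?n - 1) * w" using n by (simp add: card_Diff_singleton of_nat_diff Suc_leI)
    finally show ?thesis by (simp add: algebra_simps)
  qed
  have "0 \<le> ?n * w" using diag[of i] lower[of i] by (simp add: algebra_simps)
  then have w: "w \<ge> 0" using n by (simp add: zero_le_mult_iff)
  show ?thesis
  proof (cases "i = j")
    case True
    have "w \<le> ?n * w" using mult_right_mono[OF n w] by simp
    then show ?thesis using True diag[of i] lower[of i] w by (simp add: algebra_simps abs_le_iff)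
  next
    case False
    have half: "(1 / sqrt 2)\<^sup>2 = (1 / 2 :: real)" "(1 / sqrt 2) * (1 / sqrt 2) = (1 / 2 :: real)"
      by (simp_all add: power2_eq_square real_sqrt_mult_self)
    \<comment> \<open>With s = 1 and s = -1 these are the polarization directions (e_i + e_j) / sqrt
      2 and (e_i - e_j) / sqrt 2.\<close>
    have "norm ((1 / sqrt 2) *\<^sub>R axis i 1 + (s / sqrt 2) *\<^sub>R axis j 1 :: real^'n) = 1" if "s\<^sup>2 = 1" for s
    proof -
      have "((1 / sqrt 2) *\<^sub>R axis i 1 + (s / sqrt 2) *\<^sub>R axis j 1 :: real^'n)
          \<bullet> ((1 / sqrt 2) *\<^sub>R axis i 1 + (s / sqrt 2) *\<^sub>R axis j 1) = 1"
        using False that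
        by (simp add: inner_add_left inner_add_right inner_axis_axis power2_eq_square)
      then show ?thesis by (simp add: norm_eq_1)
    qed
    from le[OF this] have "(1 / sqrt 2)\<^sup>2 * H $ i $ i + (s / sqrt 2)\<^sup>2 * H $ j $ j
        + 2 * (1 / sqrt 2) * (s / sqrt 2) * H $ i $ j \<le> w" if "s\<^sup>2 = 1" for s
      unfolding quad using that by blast
    from this[of 1] this[of "-1"]
    have "\<bar>H $ i $ j\<bar> \<le> w - (H $ i $ i + H $ j $ j) / 2"
      by (simp add: power_divide add_divide_distrib)
    also have "\<dots> \<le> w + (?n - 1) * w" using lower[of i] lower[of j]
      unfolding mult_minus_left by argo
    finally show ?thesis by (simp add: algebra_simps)
  qed
qed

lemma norm_matrix_vector_entry_bound:
  fixes H :: "real^'n^'n"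
  assumes "\<And>i j. \<bar>H $ i $ j\<bar> \<le> c" "norm s = 1"
  shows "norm (H *v s) \<le> (real CARD('n))\<^sup>2 * c"
proof -
  have "\<bar>(H *v s) $ i\<bar> \<le> real CARD('n) * c" for i
  proof -
    have "\<bar>(H *v s) $ i\<bar> \<le> (\<Sum>j\<in>UNIV. \<bar>H $ i $ j * s $ j\<bar>)"
      by (simp add: matrix_vector_mult_def sum_abs)
    also have "\<dots> \<le> (\<Sum>j\<in>(UNIV :: 'n set). c * 1)"
      using assms component_le_norm_cart[of s] unfolding abs_mult
      by (intro sum_mono mult_mono) (auto intro: order_trans[OF abs_ge_zero])
    finally show ?thesis by simp
  qed
  then have "(\<Sum>i\<in>UNIV. \<bar>(H *v s) $ i\<bar>) \<le> (\<Sum>i\<in>(UNIV :: 'n set). real CARD('n) * c)"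
    by (intro sum_mono)
  then show ?thesis
    using norm_le_l1_cart[of "H *v s"] by (simp add: power2_eq_square mult.assoc)
qed

lemma norm_matrix_entry_bound:
  fixes H :: "real^'n^'n"
  assumes "\<And>i j. \<bar>H $ i $ j\<bar> \<le> c"
  shows "norm H \<le> (real CARD('n))\<^sup>2 * c"
proof -
  have "norm (H $ i) \<le> real CARD('n) * c" for i
  proof -
    have "(\<Sum>j\<in>UNIV. \<bar>H $ i $ j\<bar>) \<le> (\<Sum>j\<in>(UNIV :: 'n set). c)" by (intro sum_mono assms)
    then show ?thesis using norm_le_l1_cart[of "H $ i"] by simp
  qed
  then have "(\<Sum>i\<in>UNIV. norm (H $ i)) \<le> (\<Sum>i\<in>(UNIV :: 'n set). real CARD('n) * c)"
    by (intro sum_mono)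
  moreover have "norm H \<le> (\<Sum>i\<in>UNIV. norm (H $ i))"
    unfolding norm_vec_def by (rule L2_set_le_sum) simp
  ultimately show ?thesis by (simp add: power2_eq_square mult.assoc)
qed

text \<open>The exponent \<open>1/2\<close> of \<open>\<gamma>\<close> makes the squared gradient of \<open>\<gamma>\<close> produced by the first order
  condition cancel against the one in the second derivative.\<close>
lemma weighted_quotient_max:
  fixes \<alpha> \<beta> \<gamma> \<alpha>' \<beta>' \<gamma>' :: "real \<Rightarrow> real"
  assumes d: "d > 0"
    and \<alpha>: "\<And>t. \<bar>t\<bar> < d \<Longrightarrow> (\<alpha> has_real_derivative \<alpha>' t) (at t)" "(\<alpha>' has_real_derivative \<alpha>'') (at 0)"
    and \<beta>: "\<And>t. \<bar>t\<bar> < d \<Longrightarrow> (\<beta> has_real_derivative \<beta>' t) (at t)" "(\<beta>' has_real_derivative \<beta>'') (at 0)"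
    and \<gamma>: "\<And>t. \<bar>t\<bar> < d \<Longrightarrow> (\<gamma> has_real_derivative \<gamma>' t) (at t)" "(\<gamma>' has_real_derivative \<gamma>'') (at 0)"
    and pos: "\<alpha> 0 > 0" "\<beta> 0 > 0" "\<And>t. \<bar>t\<bar> < d \<Longrightarrow> \<gamma> t > 0"
    and max: "\<And>t. \<bar>t\<bar> < d \<Longrightarrow> \<alpha> t > 0 \<Longrightarrow> \<alpha> t * \<beta> t / sqrt (\<gamma> t) \<le> \<alpha> 0 * \<beta> 0 / sqrt (\<gamma> 0)"
  shows "\<beta>' 0 / \<beta> 0 = \<gamma>' 0 / (2 * \<gamma> 0) - \<alpha>' 0 / \<alpha> 0"
    and "\<alpha>'' / \<alpha> 0 - 3 * (\<alpha>' 0 / \<alpha> 0)\<^sup>2 + \<beta>'' / \<beta> 0 - \<gamma>'' / (2 * \<gamma> 0) \<le> 0"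
proof -
  have "\<alpha> \<midarrow>0\<rightarrow> \<alpha> 0" "\<beta> \<midarrow>0\<rightarrow> \<beta> 0"
    using DERIV_isCont[OF \<alpha>(1)[of 0]] DERIV_isCont[OF \<beta>(1)[of 0]] d by (simp_all add: isCont_def)
  then have "\<forall>\<^sub>F t in at 0. \<alpha> t > 0 \<and> \<beta> t > 0"
    by (intro eventually_conj order_tendstoD(1)[OF _ pos(1)] order_tendstoD(1)[OF _ pos(2)])
  then obtain d0 where d0: "d0 > 0" "\<And>t. t \<noteq> 0 \<Longrightarrow> \<bar>t\<bar> < d0 \<Longrightarrow> \<alpha> t > 0 \<and> \<beta> t > 0"
    unfolding eventually_at by (auto simp: dist_norm)
  define r where "r = min d d0"
  have r: "r > 0" "r \<le> d" using d d0 by (auto simp: r_def)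
  have p: "\<alpha> t > 0" "\<beta> t > 0" "\<gamma> t > 0" if "\<bar>t\<bar> < r" for t
    using d0(2)[of t] pos that by (cases "t = 0"; auto simp: r_def)+
  define \<phi> where "\<phi> t = ln (\<alpha> t) + ln (\<beta> t) - ln (\<gamma> t) / 2" for t
  define \<phi>' where "\<phi>' t = \<alpha>' t / \<alpha> t + \<beta>' t / \<beta> t - \<gamma>' t / \<gamma> t / 2" for t
  have ln': "((\<lambda>t. ln (g t)) has_real_derivative g' t / g t) (at t)"
    if "(g has_real_derivative g' t) (at t)" "g t > 0" for g g' :: "real \<Rightarrow> real" and t
    using DERIV_chain2[OF DERIV_ln_divide that(1)] that(2) by simp
  have quot: "((\<lambda>t. g' t / g t) has_real_derivative g'' / g 0 - (g' 0 / g 0)\<^sup>2) (at 0)"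
    if "(g has_real_derivative g' 0) (at 0)" "(g' has_real_derivative g'') (at 0)" "g 0 > 0"
    for g g' :: "real \<Rightarrow> real" and g''
    using DERIV_divide[OF that(2,1)] that(3) by (simp add: power2_eq_square diff_divide_distrib)
  have 1: "(\<phi> has_real_derivative \<phi>' t) (at t)" if t: "\<bar>t\<bar> < r" for t
    unfolding \<phi>_def \<phi>'_def
    by (intro DERIV_diff DERIV_add DERIV_cdivide ln' \<alpha> \<beta> \<gamma> p) (use t r in auto)
  have 2: "(\<phi>' has_real_derivative (\<alpha>'' / \<alpha> 0 - (\<alpha>' 0 / \<alpha> 0)\<^sup>2) + (\<beta>'' / \<beta> 0 - (\<beta>' 0 / \<beta> 0)\<^sup>2)
      - (\<gamma>'' / \<gamma> 0 - (\<gamma>' 0 / \<gamma> 0)\<^sup>2) / 2) (at 0)"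
    unfolding \<phi>'_def
    by (intro DERIV_diff DERIV_add DERIV_cdivide quot \<alpha> \<beta> \<gamma> p) (use r d in auto)
  have \<phi>eq: "\<phi> t = ln (\<alpha> t * \<beta> t / sqrt (\<gamma> t))" if "\<bar>t\<bar> < r" for t
    using p[OF that] by (simp add: \<phi>_def ln_mult ln_div ln_sqrt)
  have 3: "\<phi> t \<le> \<phi> 0" if t: "\<bar>t\<bar> < r" for t
  proof -
    have "\<alpha> t * \<beta> t / sqrt (\<gamma> t) > 0" using p[OF t] by simp
    moreover have "\<alpha> 0 * \<beta> 0 / sqrt (\<gamma> 0) > 0" using p[of 0] r by simp
    ultimately show ?thesis
      using max[of t] t r p(1)[OF t] \<phi>eq[OF t] \<phi>eq[of 0] by simp
  qed
  note * = second_derivative_local_max[OF r(1) 1 2 3]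
  have second: "\<alpha>'' / \<alpha> 0 - (\<alpha>' 0 / \<alpha> 0)\<^sup>2 + (\<beta>'' / \<beta> 0 - (\<beta>' 0 / \<beta> 0)\<^sup>2)
      - (\<gamma>'' / \<gamma> 0 - (\<gamma>' 0 / \<gamma> 0)\<^sup>2) / 2 \<le> 0" by (rule *(2))
  show first: "\<beta>' 0 / \<beta> 0 = \<gamma>' 0 / (2 * \<gamma> 0) - \<alpha>' 0 / \<alpha> 0"
    using *(1) by (simp add: \<phi>'_def)
  define x y where "x = \<alpha>' 0 / \<alpha> 0" and "y = \<gamma>' 0 / \<gamma> 0"
  have b: "\<beta>' 0 / \<beta> 0 = y / 2 - x" using first by (simp add: x_def y_def)
  \<comment> \<open>Parallelogram law: the term y^2 / 2 is exactly what -(ln \<gamma>) / 2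
    contributes, and 2 x^2 joins the x^2 of the cutoff, whence the factor 3.\<close>
  have "0 \<le> (y / 2 + x)\<^sup>2" by simp
  then have "(y / 2 - x)\<^sup>2 \<le> 2 * x\<^sup>2 + y\<^sup>2 / 2" by (simp add: power2_eq_square field_simps)
  moreover have "\<gamma>'' / (2 * \<gamma> 0) = \<gamma>'' / \<gamma> 0 / 2" by simp
  ultimately show "\<alpha>'' / \<alpha> 0 - 3 * (\<alpha>' 0 / \<alpha> 0)\<^sup>2 + \<beta>'' / \<beta> 0 - \<gamma>'' / (2 * \<gamma> 0) \<le> 0"
    using second unfolding b x_def[symmetric] y_def[symmetric] by argo
qed

lemma grad_partial_eq_hess:
  fixes u :: "real^'n \<Rightarrow> real"
  assumes "open S" "smooth_on S u" "x \<in> S"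
  shows "grad (partial s u) x = hess u x *v s"
proof -
  have "axis i 1 \<bullet> (hess u x *v s) = partial (axis i 1) (partial s u) x" for i
    by (rule inner_hess[OF assms])
  then show ?thesis by (simp add: grad_def vec_eq_iff inner_axis')
qed

text \<open>The direction \<open>e\<close> stays fixed while the point moves along \<open>q\<close>.
  The favourable term |D u_q|^2 / N comes from -\<gamma>'' / (2 \<gamma>) with \<gamma> = K -
  |Du|^2; the cutoff contributes -2 from its second derivative and 12 = 3 * 2^2 from the square of
  its first.\<close>

lemma max_point_line_inequality:
  fixes u :: "real^'n \<Rightarrow> real"
  assumes S: "open S" and u: "smooth_on S u" and x0: "x0 \<in> S"
    and K: "\<And>x. x \<in> S \<Longrightarrow> (norm (grad u x))\<^sup>2 < K"
    and pos: "R - (norm x0)\<^sup>2 > 0" "partial e (partial e u) x0 > 0"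
    and max: "\<And>x. x \<in> S \<Longrightarrow> R - (norm x)\<^sup>2 > 0 \<Longrightarrow>
      (R - (norm x)\<^sup>2) * partial e (partial e u) x / sqrt (K - (norm (grad u x))\<^sup>2)
      \<le> (R - (norm x0)\<^sup>2) * partial e (partial e u) x0 / sqrt (K - (norm (grad u x0))\<^sup>2)"
    and q: "norm q = 1"
  defines "z \<equiv> R - (norm x0)\<^sup>2" and "w \<equiv> partial e (partial e u)"
    and "N \<equiv> K - (norm (grad u x0))\<^sup>2"
  shows "partial q w x0 / w x0 = 2 * (x0 \<bullet> q) / z - grad u x0 \<bullet> grad (partial q u) x0 / N"
    and "- 2 / z - 12 * (x0 \<bullet> q)\<^sup>2 / z\<^sup>2 + partial q (partial q w) x0 / w x0
      + ((norm (grad (partial q u) x0))\<^sup>2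
        + (\<Sum>m\<in>UNIV. grad u x0 $ m * partial q (partial q (partial (axis m 1) u)) x0)) / N \<le> 0"
proof -
  obtain d where d: "d > 0" "\<And>t. \<bar>t\<bar> < d \<Longrightarrow> x0 + t *\<^sub>R q \<in> S"
    by (rule line_in_open[OF S u x0, of q]) blast
  define \<alpha> where "\<alpha> t = R - (norm (x0 + t *\<^sub>R q))\<^sup>2" for t
  define \<alpha>' where "\<alpha>' t = - 2 * (x0 \<bullet> q) - 2 * t" for t
  define \<beta> where "\<beta> t = w (x0 + t *\<^sub>R q)" for t
  define \<beta>' where "\<beta>' t = partial q w (x0 + t *\<^sub>R q)" for t
  define \<gamma> where "\<gamma> t = K - (norm (grad u (x0 + t *\<^sub>R q)))\<^sup>2" for t
  let ?p = "\<lambda>m. partial (axis m 1) u"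
  define \<gamma>' where "\<gamma>' t = - 2 * (\<Sum>m\<in>UNIV. ?p m (x0 + t *\<^sub>R q) * partial q (?p m) (x0 + t *\<^sub>R q))" for t
  define \<gamma>'' where "\<gamma>'' = - 2 * (\<Sum>m\<in>UNIV. ?p m x0 * partial q (partial q (?p m)) x0
    + partial q (?p m) x0 * partial q (?p m) x0)"
  have qq: "q \<bullet> q = 1" using q by (simp add: norm_eq_1)
  have w: "smooth_on S w" unfolding w_def by (rule smooth_partials[OF S u])
  have line: "((\<lambda>t. g (x0 + t *\<^sub>R q)) has_real_derivative partial q g (x0 + t *\<^sub>R q)) (at t)"
    if "smooth_on S g" "\<bar>t\<bar> < d" for g t
    by (rule has_real_derivative_along_line[OF smooth_on_differentiable[OF that(1) d(2)[OF that(2)]]])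
  have line0: "((\<lambda>t. g (x0 + t *\<^sub>R q)) has_real_derivative partial q g x0) (at 0)"
    if "smooth_on S g" for g
    using line[OF that, of 0] d(1) by simp
  have \<alpha>eq: "\<alpha> t = R - (x0 \<bullet> x0 + 2 * t * (x0 \<bullet> q) + t * t)" for t
    by (simp add: \<alpha>_def power2_norm_eq_inner inner_add_left inner_add_right inner_commute qq algebra_simps)
  have \<gamma>eq: "\<gamma> t = K - (\<Sum>m\<in>UNIV. ?p m (x0 + t *\<^sub>R q) * ?p m (x0 + t *\<^sub>R q))" for t
    by (simp add: \<gamma>_def power2_norm_eq_inner inner_vec_def grad_def)
  have 1: "(\<alpha> has_real_derivative \<alpha>' t) (at t)" for t
    unfolding \<alpha>eq \<alpha>'_def by (auto intro!: derivative_eq_intros)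
  have 2: "(\<alpha>' has_real_derivative - 2) (at 0)"
    unfolding \<alpha>'_def by (auto intro!: derivative_eq_intros)
  have 3: "(\<beta> has_real_derivative \<beta>' t) (at t)" if "\<bar>t\<bar> < d" for t
    unfolding \<beta>_def \<beta>'_def by (rule line[OF w that])
  have 4: "(\<beta>' has_real_derivative partial q (partial q w) x0) (at 0)"
    unfolding \<beta>'_def by (rule line0[OF smooth_on_partial[OF S w]])
  have 5: "(\<gamma> has_real_derivative \<gamma>' t) (at t)" if t: "\<bar>t\<bar> < d" for t
  proof -
    have "(\<gamma> has_real_derivative 0 - (\<Sum>m\<in>UNIV. partial q (?p m) (x0 + t *\<^sub>R q) * ?p m (x0 + t *\<^sub>R q)
        + partial q (?p m) (x0 + t *\<^sub>R q) * ?p m (x0 + t *\<^sub>R q))) (at t)"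
      unfolding \<gamma>eq
      by (intro DERIV_diff DERIV_const DERIV_sum DERIV_mult line smooth_partials[OF S u] t)
    moreover have "0 - (\<Sum>m\<in>UNIV. partial q (?p m) (x0 + t *\<^sub>R q) * ?p m (x0 + t *\<^sub>R q)
        + partial q (?p m) (x0 + t *\<^sub>R q) * ?p m (x0 + t *\<^sub>R q)) = \<gamma>' t"
      unfolding \<gamma>'_def sum_distrib_left diff_0 sum_negf[symmetric]
      by (intro sum.cong refl) (simp add: mult.commute)
    ultimately show ?thesis by simp
  qed
  have 6: "(\<gamma>' has_real_derivative \<gamma>'') (at 0)"
  proof -
    have "((\<lambda>t. \<Sum>m\<in>UNIV. ?p m (x0 + t *\<^sub>R q) * partial q (?p m) (x0 + t *\<^sub>R q)) has_real_derivative
      (\<Sum>m\<in>UNIV. partial q (?p m) x0 * partial q (?p m) (x0 + 0 *\<^sub>R q)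
        + partial q (partial q (?p m)) x0 * ?p m (x0 + 0 *\<^sub>R q))) (at 0)"
      by (intro DERIV_sum DERIV_mult line0 smooth_partials[OF S u])
    from DERIV_cmult[OF this, of "- 2"] show ?thesis
      unfolding \<gamma>'_def \<gamma>''_def by (simp add: mult.commute add.commute)
  qed
  have p: "\<alpha> 0 > 0" "\<beta> 0 > 0" "\<And>t. \<bar>t\<bar> < d \<Longrightarrow> \<gamma> t > 0"
    using pos K[OF d(2)] by (auto simp: \<alpha>_def \<beta>_def \<gamma>_def w_def)
  have m: "\<alpha> t * \<beta> t / sqrt (\<gamma> t) \<le> \<alpha> 0 * \<beta> 0 / sqrt (\<gamma> 0)" if "\<bar>t\<bar> < d" "\<alpha> t > 0" for t
    using max[OF d(2)[OF that(1)]] that(2) by (simp add: \<alpha>_def \<beta>_def \<gamma>_def w_def)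
  note * = weighted_quotient_max[OF d(1) 1 2 3 4 5 6 p m]
  have comm: "partial q (?p m) x0 = grad (partial q u) x0 $ m" for m
    by (simp add: grad_def smooth_on_partial_commute[OF S u x0])
  have gu: "?p m x0 = grad u x0 $ m" for m by (simp add: grad_def)
  have 0: "\<alpha> 0 = z" "\<alpha>' 0 = - 2 * (x0 \<bullet> q)" "\<beta> 0 = w x0" "\<beta>' 0 = partial q w x0" "\<gamma> 0 = N"
    "\<gamma>' 0 = - 2 * (grad u x0 \<bullet> grad (partial q u) x0)"
    by (simp_all add: \<alpha>_def z_def \<alpha>'_def \<beta>_def \<beta>'_def \<gamma>_def N_def \<gamma>'_def comm gu inner_vec_def)
  have g2: "\<gamma>'' = - 2 * ((norm (grad (partial q u) x0))\<^sup>2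
      + (\<Sum>m\<in>UNIV. grad u x0 $ m * partial q (partial q (?p m)) x0))"
    by (simp add: \<gamma>''_def comm gu sum.distrib power2_norm_eq_inner inner_vec_def)
  show "partial q w x0 / w x0 = 2 * (x0 \<bullet> q) / z - grad u x0 \<bullet> grad (partial q u) x0 / N"
    using *(1) unfolding 0 by simp
  have h: "\<gamma>'' / (2 * N) = - (((norm (grad (partial q u) x0))\<^sup>2
      + (\<Sum>m\<in>UNIV. grad u x0 $ m * partial q (partial q (?p m)) x0)) / N)"
  proof -
    have "- 2 * a / (2 * N) = - (a / N)" for a by simp
    then show ?thesis unfolding g2 .
  qed
  have sq: "3 * (- 2 * (x0 \<bullet> q) / z)\<^sup>2 = 12 * (x0 \<bullet> q)\<^sup>2 / z\<^sup>2"
    by (simp add: power_divide power_mult_distrib)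
  show "- 2 / z - 12 * (x0 \<bullet> q)\<^sup>2 / z\<^sup>2 + partial q (partial q w) x0 / w x0
      + ((norm (grad (partial q u) x0))\<^sup>2
        + (\<Sum>m\<in>UNIV. grad u x0 $ m * partial q (partial q (?p m)) x0)) / N \<le> 0"
    using *(2) unfolding 0 h sq by simp
qed

section \<open>The estimate\<close>

lemma le_of_square_le:
  fixes y C :: real
  assumes "y\<^sup>2 \<le> C * (1 + y)" "C \<ge> 0"
  shows "y \<le> C + 1"
proof (rule ccontr)
  assume "\<not> y \<le> C + 1"
  then have y: "y > C + 1" by simp
  then have "(C + 1) * y < y * y" using assms(2) by (intro mult_strict_right_mono) auto
  then show False using assms y by (simp add: power2_eq_square algebra_simps)
qed

text \<open>The inequality at the maximum point, with \<open>T\<close> the trace of the linearized operator,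
  \<open>z\<close> the cutoff, \<open>w\<close> the second derivative and \<open>g\<close> the size of its gradient.\<close>
lemma maximum_point_arithmetic:
  fixes n K T z w A B M1 P g t0 :: real
  assumes n: "n \<ge> 1" "K \<ge> 1" and t0: "t0 > 0" "1 \<le> t0 * T" and z: "0 < z" "z \<le> 1" and w: "w \<ge> 1"
    and nn: "A \<ge> 0" "B \<ge> 0" "M1 \<ge> 0" "P \<ge> 0"
    and g: "g \<le> n * (w * (2 / z + M1 * (P * w)))"
    and main: "T / (n + 1) * w\<^sup>2 / K \<le> 28 * n * T / z\<^sup>2
      + (A * (w + g) + B * (1 + M1 + P * w)\<^sup>2) / w + n * M1 * (A * (1 + M1 + P * w))"
  shows "z * w \<le> (n + 1) * K * (28 * n + t0 * (A + 2 * A * n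
    + (A * n * M1 * P + B * (1 + M1 + P)\<^sup>2 + n * M1 * A * (1 + M1 + P)))) + 1"
proof -
  define R where "R = 1 + M1 + P"
  define D where "D = A * n * M1 * P + B * R\<^sup>2 + n * M1 * A * R"
  define E where "E = A + 2 * A * n"
  define y where "y = z * w"
  have y: "y > 0" using z w by (simp add: y_def)
  have "0 < t0 * T" using t0(2) by linarith
  then have T: "T > 0" using t0(1) by (simp add: zero_less_mult_iff)
  have R: "0 \<le> 1 + M1 + P * w" "1 + M1 + P * w \<le> R * w"
  proof -
    have "(1 + M1) * 1 \<le> (1 + M1) * w" using w nn by (intro mult_left_mono) auto
    then show "1 + M1 + P * w \<le> R * w" by (simp add: R_def algebra_simps)
    show "0 \<le> 1 + M1 + P * w" using w nn by simp
  qed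
  have R0: "R \<ge> 0" using nn by (simp add: R_def)
  have DE: "D \<ge> 0" "E \<ge> 0" using nn n R0 by (simp_all add: D_def E_def)
  have a: "A * (w + g) / w \<le> A + A * n * (2 / z + M1 * P * w)"
  proof -
    have "A * (w + g) \<le> A * (w + n * (w * (2 / z + M1 * (P * w))))"
      using g nn by (intro mult_left_mono) auto
    also have "\<dots> = w * (A + A * n * (2 / z + M1 * P * w))" by (simp add: algebra_simps)
    finally show ?thesis using w by (simp add: pos_divide_le_eq mult.commute)
  qed
  have b: "B * (1 + M1 + P * w)\<^sup>2 / w \<le> B * R\<^sup>2 * w"
  proof -
    have "B * (1 + M1 + P * w)\<^sup>2 \<le> B * (R * w)\<^sup>2"
      using R nn by (intro mult_left_mono power_mono)
    also have "\<dots> = w * (B * R\<^sup>2 * w)" by (simp add: power2_eq_square)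
    finally show ?thesis using w by (simp add: pos_divide_le_eq mult.commute)
  qed
  have c: "n * M1 * (A * (1 + M1 + P * w)) \<le> n * M1 * A * R * w"
  proof -
    have "n * M1 * A * (1 + M1 + P * w) \<le> n * M1 * A * (R * w)"
      using R nn n by (intro mult_left_mono) auto
    then show ?thesis by (simp add: mult_ac)
  qed
  have e: "(A * (w + g) + B * (1 + M1 + P * w)\<^sup>2) / w + n * M1 * (A * (1 + M1 + P * w)) \<le> E / z + D * w"
  proof -
    have "A \<le> A / z" using nn z by (simp add: pos_le_divide_eq mult_left_le)
    then show ?thesis using a b c
      by (simp add: E_def D_def add_divide_distrib algebra_simps)
  qed
  \<comment> \<open>Multiplication by z^2 clears the cutoff denominators; with z \<le> 1 everything
    is then expressed through y = z w.\<close>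
  have "T / (n + 1) * w\<^sup>2 / K * z\<^sup>2 \<le> (28 * n * T / z\<^sup>2 + (E / z + D * w)) * z\<^sup>2"
    using main e by (intro mult_right_mono) auto
  also have "\<dots> = 28 * n * T + E * z + D * w * z * z"
    using z by (simp add: power2_eq_square field_simps)
  also have "\<dots> \<le> 28 * n * T + E + D * y"
  proof -
    have "E * z \<le> E" using DE z by (simp add: mult_left_le)
    moreover have "D * w * z * z \<le> D * w * z * 1" using DE z w by (intro mult_left_mono) auto
    ultimately show ?thesis by (simp add: y_def mult_ac)
  qed
  \<comment> \<open>The terms from \<open>f\<close> lack the factor \<open>T\<close>; the lower
    bound \<open>1 \<le> t0 * T\<close> supplies it, so that \<open>T\<close>, however large,
    cancels and y^2 \<le> C (1 + y) remains.\<close>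
  also have "\<dots> \<le> 28 * n * T + (E + D * y) * (t0 * T)"
  proof -
    have "(E + D * y) * 1 \<le> (E + D * y) * (t0 * T)"
      using DE y t0 by (intro mult_left_mono) auto
    then show ?thesis by simp
  qed
  also have "\<dots> = T * (28 * n + t0 * (E + D * y))" by (simp add: algebra_simps)
  finally have "T * (y\<^sup>2 / ((n + 1) * K)) \<le> T * (28 * n + t0 * (E + D * y))"
    by (simp add: y_def power_mult_distrib mult_ac)
  then have "y\<^sup>2 / ((n + 1) * K) \<le> 28 * n + t0 * (E + D * y)"
    by (rule mult_left_le_imp_le[OF _ T])
  then have "y\<^sup>2 \<le> (28 * n + t0 * (E + D * y)) * ((n + 1) * K)"
    using n by (simp add: pos_divide_le_eq)
  also have "\<dots> \<le> ((28 * n + t0 * (E + D)) * (1 + y)) * ((n + 1) * K)"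
  proof (rule mult_right_mono)
    have "0 \<le> 28 * n * y" "0 \<le> t0 * (D + E * y)" using n y t0 DE by auto
    then show "28 * n + t0 * (E + D * y) \<le> (28 * n + t0 * (E + D)) * (1 + y)"
      by (simp add: algebra_simps)
  qed (use n in auto)
  also have "\<dots> = (n + 1) * K * (28 * n + t0 * (E + D)) * (1 + y)" by (simp add: mult_ac)
  finally have "y \<le> (n + 1) * K * (28 * n + t0 * (E + D)) + 1"
    using n t0 DE by (intro le_of_square_le) auto
  then show ?thesis by (simp add: y_def E_def D_def R_def)
qed

text \<open>For unit e, u_ee^2 \<le> |D^2 u e|^2 by Cauchy-Schwarz; expanding |D^2 u e|^2 in
  \<open>q\<close> and applying Cauchy-Schwarz to each component gives the sum. With a_i \<ge> T /
  (n+1) this bounds the favourable term below.\<close>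

lemma sum_norm_grad_partial_ge:
  fixes u :: "real^'n \<Rightarrow> real"
  assumes S: "open S" and u: "smooth_on S u" and x: "x \<in> S" and q: "orthonormal q" and e: "norm e = 1"
  shows "(partial e (partial e u) x)\<^sup>2 \<le> (\<Sum>i\<in>UNIV. (norm (grad (partial (q i) u) x))\<^sup>2)"
proof -
  have cs: "(a \<bullet> b)\<^sup>2 \<le> (norm b)\<^sup>2" if "norm a = 1" for a b :: "real^'n"
    using Cauchy_Schwarz_ineq2[of a b] that power_mono[of "\<bar>a \<bullet> b\<bar>" "norm b" 2] by simp
  have sym: "e \<bullet> (hess u x *v a) = a \<bullet> (hess u x *v e)" for a
    by (simp add: inner_hess[OF S u x] smooth_on_partial_commute[OF S u x, of e])
  have "(partial e (partial e u) x)\<^sup>2 \<le> (norm (hess u x *v e))\<^sup>2"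
    using cs[OF e, of "hess u x *v e"] by (simp add: inner_hess[OF S u x])
  also have "\<dots> = (\<Sum>i\<in>UNIV. (e \<bullet> (hess u x *v q i))\<^sup>2)"
    unfolding sym orthonormal_sum_inner_square[OF q] by (simp add: power2_norm_eq_inner)
  also have "\<dots> \<le> (\<Sum>i\<in>UNIV. (norm (grad (partial (q i) u) x))\<^sup>2)"
    unfolding grad_partial_eq_hess[OF S u x] by (intro sum_mono cs e)
  finally show ?thesis .
qed

lemma norm_inner_le_one: "norm x \<le> 1 \<Longrightarrow> norm q = 1 \<Longrightarrow> \<bar>x \<bullet> q\<bar> \<le> 1"
  using Cauchy_Schwarz_ineq2[of x q] by simp

text \<open>The line inequalities in the directions \<open>q i\<close> are added with the weights
  a_i \<ge> 0. The second derivatives of u_ee and of the first partials then combine into the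
  linearized operator, which the differentiated equation bounds; the remaining gradient of u_ee is
  eliminated by the first order condition.\<close>

lemma maximum_point_estimate:
  fixes u :: "real^'n \<Rightarrow> real" and f :: "(real^'n) \<times> real \<times> (real^'n) \<Rightarrow> real"
  assumes S: "open S" "S \<subseteq> ball 0 1" and u: "smooth_on S u" and x0: "x0 \<in> S"
    and \<Gamma>: "\<And>x. x \<in> S \<Longrightarrow> eigvals (eta u x) \<in> Gamma k" and kl: "l < k" "k < CARD('n)"
    and eq: "\<And>x. x \<in> S \<Longrightarrow> sigma_mat k (eta u x) / sigma_mat l (eta u x) = f (x, u x, grad u x)"
    and f: "cont_diff 2 (S \<times> UNIV \<times> UNIV) f" "C2_bounded_by (S \<times> UNIV \<times> UNIV) f M"
    and f0: "f0 > 0" "\<And>w. w \<in> S \<times> UNIV \<times> UNIV \<Longrightarrow> f w \<ge> f0"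
    and M1: "\<And>x. x \<in> S \<Longrightarrow> norm (grad u x) \<le> M1"
    and R: "R \<le> 1" "R - (norm x0)\<^sup>2 > 0" and e: "norm e = 1"
    and max_e: "\<And>e'. norm e' = 1 \<Longrightarrow> partial e' (partial e' u) x0 \<le> partial e (partial e u) x0"
    and max: "\<And>x. x \<in> S \<Longrightarrow> R - (norm x)\<^sup>2 > 0 \<Longrightarrow>
      (R - (norm x)\<^sup>2) * partial e (partial e u) x / sqrt (M1\<^sup>2 + 1 - (norm (grad u x))\<^sup>2)
      \<le> (R - (norm x0)\<^sup>2) * partial e (partial e u) x0 / sqrt (M1\<^sup>2 + 1 - (norm (grad u x0))\<^sup>2)"
    and w1: "partial e (partial e u) x0 \<ge> 1"
  defines "n \<equiv> real CARD('n)" and "D \<equiv> real DIM((real^'n) \<times> real \<times> (real^'n))"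
  defines "A \<equiv> D * M / f0" and "B \<equiv> D\<^sup>2 * M / f0 + (D * M / f0)\<^sup>2" and "P \<equiv> n ^ 3"
  shows "(R - (norm x0)\<^sup>2) * partial e (partial e u) x0
    \<le> (n + 1) * (M1\<^sup>2 + 1) * (28 * n + n * max 1 M * (A + 2 * A * n
      + (A * n * M1 * P + B * (1 + M1 + P)\<^sup>2 + n * M1 * A * (1 + M1 + P)))) + 1"
proof -
  define w where "w = partial e (partial e u)"
  define z where "z = R - (norm x0)\<^sup>2"
  define K where "K = M1\<^sup>2 + 1"
  define N where "N = K - (norm (grad u x0))\<^sup>2"
  have n: "n \<ge> 1" unfolding n_def by (simp add: Suc_leI)
  have P: "P \<ge> 0" using n by (simp add: P_def)
  have M1': "M1 \<ge> 0" using M1[OF x0] norm_ge_zero order_trans by blast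
  have M: "M \<ge> 0"
  proof -
    have "(x0, u x0, grad u x0) \<in> S \<times> UNIV \<times> UNIV" using x0 by simp
    then have "\<bar>f (x0, u x0, grad u x0)\<bar> \<le> M" using f(2) unfolding C2_bounded_by_def by blast
    then show ?thesis by linarith
  qed
  have AB: "A \<ge> 0" "B \<ge> 0" using M f0 by (simp_all add: A_def B_def D_def)
  have gradK: "(norm (grad u x))\<^sup>2 \<le> M1\<^sup>2" if "x \<in> S" for x
    using M1[OF that] by (intro power_mono) auto
  have N: "1 \<le> N" "N \<le> K" using gradK[OF x0] by (auto simp: N_def K_def)
  have z: "0 < z" "z \<le> 1" unfolding z_def using R zero_le_power2[of "norm x0"] by linarith+
  have nx0: "norm x0 \<le> 1" using S(2) x0 by (auto simp: subset_eq dist_norm)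
  have ws: "w x0 \<ge> 1" using w1 by (simp add: w_def)
  have lap: "0 \<le> (\<Sum>i\<in>UNIV. hess u x0 $ i $ i)"
    using laplacian_pos[OF S(1) u x0 \<Gamma>[OF x0]] kl by (simp add: laplacian_def)
  have quad: "e' \<bullet> (hess u x0 *v e') \<le> w x0" if "norm e' = 1" for e'
    unfolding inner_hess[OF S(1) u x0] w_def by (rule max_e[OF that])
  have entry: "\<bar>hess u x0 $ i $ j\<bar> \<le> n * w x0" for i j
    unfolding n_def by (rule hess_entry_bound[OF transpose_hess[OF S(1) u x0] lap quad])
  \<comment> \<open>The exponent in \<open>P = n ^ 3\<close>: one n from the entry bound n w, two
    more from the norm of the matrix-vector product.\<close>
  have gradP: "norm (grad (partial s u) x0) \<le> P * w x0" if "norm s = 1" for s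
    using norm_matrix_vector_entry_bound[OF entry that]
    unfolding grad_partial_eq_hess[OF S(1) u x0] n_def[symmetric] by (simp add: P_def power2_eq_square power3_eq_cube mult_ac)
  have partM1: "\<bar>partial s u x0\<bar> \<le> M1" if "norm s = 1" for s
  proof -
    have "partial s u x0 = s \<bullet> grad u x0"
      using partial_eq_sum_axis[OF smooth_on_differentiable[OF u x0], of s] by (simp add: inner_vec_def grad_def)
    then show ?thesis using Cauchy_Schwarz_ineq2[of s "grad u x0"] M1[OF x0] that by simp
  qed
  obtain q :: "'n \<Rightarrow> real^'n" and T :: real and a :: "'n \<Rightarrow> real" where
    q: "orthonormal q" and T: "1 \<le> real CARD('n) * max 1 M * T"
    and a: "\<forall>i. T \<le> (real CARD('n) + 1) * a i" "\<forall>i. a i \<le> 2 * T"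
    and d1: "\<forall>s. \<bar>\<Sum>i\<in>UNIV. a i * partial (q i) (partial (q i) (partial s u)) x0\<bar>
      \<le> A * (norm s + \<bar>partial s u x0\<bar> + norm (grad (partial s u) x0))"
    and d2: "\<forall>s. - (A * (\<bar>partial s (partial s u) x0\<bar> + norm (grad (partial s (partial s u)) x0))
        + B * (norm s + \<bar>partial s u x0\<bar> + norm (grad (partial s u) x0))\<^sup>2)
      \<le> (\<Sum>i\<in>UNIV. a i * partial (q i) (partial (q i) (partial s (partial s u))) x0)"
    unfolding A_def B_def D_def
    by (rule differentiated_equation[OF S(1) u x0 \<Gamma> kl eq f f0])
  have "0 < (real CARD('n) * max 1 M) * T" using T by linarith
  then have T0: "T > 0" by (rule zero_less_mult_pos) (simp add: less_max_iff_disj)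
  have apos: "a i \<ge> 0" for i
  proof -
    have "0 < (real CARD('n) + 1) * a i" using a(1) T0 less_le_trans by blast
    then show ?thesis by (simp add: zero_less_mult_iff)
  qed
  have q1: "norm (q i) = 1" for i using q by (simp add: orthonormal_def norm_eq_1)
  define g where "g = norm (grad w x0)"
  define V where "V i = (\<Sum>m\<in>UNIV. grad u x0 $ m * partial (q i) (partial (q i) (partial (axis m 1) u)) x0)" for i
  have K: "(norm (grad u x))\<^sup>2 < K" if "x \<in> S" for x using gradK[OF that] by (simp add: K_def)
  have wpos: "0 < partial e (partial e u) x0" using w1 by simp
  note line = max_point_line_inequality[OF S(1) u x0 K R(2) wpos max[folded K_def]]
  have l1: "partial s w x0 / w x0 = 2 * (x0 \<bullet> s) / z - grad u x0 \<bullet> grad (partial s u) x0 / N"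
    if "norm s = 1" for s
    unfolding w_def z_def N_def by (rule line(1)) (use that in auto)
  have l2: "- 2 / z - 12 * (x0 \<bullet> q i)\<^sup>2 / z\<^sup>2 + partial (q i) (partial (q i) w) x0 / w x0
      + ((norm (grad (partial (q i) u) x0))\<^sup>2 + V i) / N \<le> 0" for i
    unfolding w_def z_def N_def V_def by (rule line(2)) (use q1 in auto)
  \<comment> \<open>Third derivatives enter through the dependence of \<open>f\<close> on Du. The
    first order condition in every coordinate direction controls them by w times (2/z plus a
    multiple of w).\<close>
  have g: "g \<le> n * (w x0 * (2 / z + M1 * (P * w x0)))"
  proof -
    have "\<bar>partial s w x0\<bar> \<le> w x0 * (2 / z + M1 * (P * w x0))" if s: "norm s = 1" for s
    proof -
      have "\<bar>grad u x0 \<bullet> grad (partial s u) x0\<bar> \<le> M1 * (P * w x0)"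
        using Cauchy_Schwarz_ineq2[of "grad u x0" "grad (partial s u) x0"]
          mult_mono[OF M1[OF x0] gradP[OF s] M1' norm_ge_zero] by linarith
      also have "\<dots> \<le> M1 * (P * w x0) * N"
        using mult_left_mono[OF N(1), of "M1 * (P * w x0)"] M1' P ws by simp
      finally have "\<bar>grad u x0 \<bullet> grad (partial s u) x0 / N\<bar> \<le> M1 * (P * w x0)"
        using N(1) by (simp add: pos_divide_le_eq)
      moreover have "\<bar>2 * (x0 \<bullet> s) / z\<bar> \<le> 2 / z"
        using norm_inner_le_one[OF nx0 s] z by (simp add: abs_mult divide_right_mono)
      ultimately have "\<bar>partial s w x0 / w x0\<bar> \<le> 2 / z + M1 * (P * w x0)"
        unfolding l1[OF s] by linarith
      then show ?thesis using ws by (simp add: abs_divide pos_divide_le_eq mult.commute)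
    qed
    then have "(\<Sum>i\<in>UNIV. \<bar>grad w x0 $ i\<bar>) \<le> (\<Sum>i\<in>(UNIV :: 'n set). w x0 * (2 / z + M1 * (P * w x0)))"
      by (intro sum_mono) (simp add: grad_def)
    then show ?thesis
      using norm_le_l1_cart[of "grad w x0"] by (simp add: g_def n_def)
  qed
  have D2: "- (A * (w x0 + g) + B * (1 + M1 + P * w x0)\<^sup>2)
      \<le> (\<Sum>i\<in>UNIV. a i * partial (q i) (partial (q i) w) x0)"
  proof -
    have "(norm e + \<bar>partial e u x0\<bar> + norm (grad (partial e u) x0))\<^sup>2 \<le> (1 + M1 + P * w x0)\<^sup>2"
      using e partM1[OF e] gradP[OF e] by (intro power_mono add_mono) auto
    then have "B * (norm e + \<bar>partial e u x0\<bar> + norm (grad (partial e u) x0))\<^sup>2 \<le> B * (1 + M1 + P * w x0)\<^sup>2"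
      using AB by (intro mult_left_mono)
    moreover have "\<bar>partial e (partial e u) x0\<bar> = w x0" using ws by (simp add: w_def)
    ultimately show ?thesis using spec[OF d2, of e] unfolding w_def[symmetric] g_def by linarith
  qed
  have D1: "\<bar>\<Sum>i\<in>UNIV. a i * partial (q i) (partial (q i) (partial (axis m 1) u)) x0\<bar>
      \<le> A * (1 + M1 + P * w x0)" for m
  proof -
    have m: "norm (axis m 1 :: real^'n) = 1" by simp
    have "A * (norm (axis m 1 :: real^'n) + \<bar>partial (axis m 1) u x0\<bar> + norm (grad (partial (axis m 1) u) x0))
        \<le> A * (1 + M1 + P * w x0)"
      using partM1[OF m] gradP[OF m] AB by (intro mult_left_mono add_mono) auto
    then show ?thesis using spec[OF d1, of "axis m 1"] by linarith
  qed
  \<comment> \<open>Exchanging the sums applies the once differentiated equation to each first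
    partial of \<open>u\<close>.\<close>
  have V: "- (n * M1 * (A * (1 + M1 + P * w x0))) \<le> (\<Sum>i\<in>UNIV. a i * V i)"
  proof -
    have "(\<Sum>i\<in>UNIV. a i * V i) = (\<Sum>m\<in>UNIV. grad u x0 $ m *
        (\<Sum>i\<in>UNIV. a i * partial (q i) (partial (q i) (partial (axis m 1) u)) x0))"
      unfolding V_def sum_distrib_left by (subst sum.swap) (simp add: mult_ac)
    moreover have "\<bar>\<Sum>m\<in>UNIV. grad u x0 $ m *
        (\<Sum>i\<in>UNIV. a i * partial (q i) (partial (q i) (partial (axis m 1) u)) x0)\<bar>
        \<le> (\<Sum>m\<in>(UNIV :: 'n set). M1 * (A * (1 + M1 + P * w x0)))"
    proof (intro order_trans[OF sum_abs] sum_mono)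
      fix m :: 'n
      have "\<bar>grad u x0 $ m\<bar> \<le> M1" using component_le_norm_cart[of "grad u x0" m] M1[OF x0] by linarith
      then show "\<bar>grad u x0 $ m * (\<Sum>i\<in>UNIV. a i * partial (q i) (partial (q i) (partial (axis m 1) u)) x0)\<bar>
          \<le> M1 * (A * (1 + M1 + P * w x0))"
        unfolding abs_mult using D1[of m] M1' by (intro mult_mono) auto
    qed
    ultimately show ?thesis by (simp add: n_def)
  qed
  have good: "T / (n + 1) * (w x0)\<^sup>2 \<le> (\<Sum>i\<in>UNIV. a i * (norm (grad (partial (q i) u) x0))\<^sup>2)"
  proof -
    have ai: "T / (n + 1) \<le> a i" for i using a(1) n by (simp add: n_def pos_divide_le_eq mult.commute)
    have "T / (n + 1) * (w x0)\<^sup>2 \<le> T / (n + 1) * (\<Sum>i\<in>UNIV. (norm (grad (partial (q i) u) x0))\<^sup>2)"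
      using sum_norm_grad_partial_ge[OF S(1) u x0 q e] T0 n unfolding w_def by (intro mult_left_mono) auto
    also have "\<dots> \<le> (\<Sum>i\<in>UNIV. a i * (norm (grad (partial (q i) u) x0))\<^sup>2)"
      unfolding sum_distrib_left using ai by (intro sum_mono mult_right_mono) auto
    finally show ?thesis .
  qed
  \<comment> \<open>As |x0| \<le> 1 and z \<le> 1, the cutoff terms are at most (2 + 12) / z^2, and
    a_i \<le> 2 T doubles this to 28.\<close>
  have cut: "- (28 * n * T / z\<^sup>2) \<le> (\<Sum>i\<in>UNIV. a i * (- 2 / z - 12 * (x0 \<bullet> q i)\<^sup>2 / z\<^sup>2))"
  proof -
    have "- (28 * T / z\<^sup>2) \<le> a i * (- 2 / z - 12 * (x0 \<bullet> q i)\<^sup>2 / z\<^sup>2)" for i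
    proof -
      have "(x0 \<bullet> q i)\<^sup>2 \<le> 1"
        using norm_inner_le_one[OF nx0 q1[of i]] by (simp add: abs_square_le_1)
      then have "12 * (x0 \<bullet> q i)\<^sup>2 / z\<^sup>2 \<le> 12 / z\<^sup>2" by (intro divide_right_mono) auto
      moreover have "2 / z \<le> 2 / z\<^sup>2"
        using z by (intro divide_left_mono) (auto simp: power2_eq_square mult_left_le)
      ultimately have "2 / z + 12 * (x0 \<bullet> q i)\<^sup>2 / z\<^sup>2 \<le> 14 / z\<^sup>2" by simp
      then have "a i * (2 / z + 12 * (x0 \<bullet> q i)\<^sup>2 / z\<^sup>2) \<le> (2 * T) * (14 / z\<^sup>2)"
        using a(2) apos[of i] T0 z by (intro mult_mono) auto
      then show ?thesis by (simp add: algebra_simps)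
    qed
    then have "(\<Sum>i\<in>(UNIV :: 'n set). - (28 * T / z\<^sup>2)) \<le> (\<Sum>i\<in>UNIV. a i * (- 2 / z - 12 * (x0 \<bullet> q i)\<^sup>2 / z\<^sup>2))"
      by (intro sum_mono)
    then show ?thesis by (simp add: n_def mult_ac)
  qed
  have "(\<Sum>i\<in>UNIV. a i * (- 2 / z - 12 * (x0 \<bullet> q i)\<^sup>2 / z\<^sup>2
      + partial (q i) (partial (q i) w) x0 / w x0
      + ((norm (grad (partial (q i) u) x0))\<^sup>2 + V i) / N)) \<le> 0"
    using l2 apos by (intro sum_nonpos mult_nonneg_nonpos)
  also have "(\<Sum>i\<in>UNIV. a i * (- 2 / z - 12 * (x0 \<bullet> q i)\<^sup>2 / z\<^sup>2
      + partial (q i) (partial (q i) w) x0 / w x0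
      + ((norm (grad (partial (q i) u) x0))\<^sup>2 + V i) / N))
    = (\<Sum>i\<in>UNIV. a i * (- 2 / z - 12 * (x0 \<bullet> q i)\<^sup>2 / z\<^sup>2))
      + (\<Sum>i\<in>UNIV. a i * partial (q i) (partial (q i) w) x0) / w x0
      + ((\<Sum>i\<in>UNIV. a i * (norm (grad (partial (q i) u) x0))\<^sup>2) + (\<Sum>i\<in>UNIV. a i * V i)) / N"
    unfolding sum_divide_distrib sum.distrib[symmetric]
    by (intro sum.cong refl) (simp add: distrib_left add_divide_distrib)
  finally have sum0: "(\<Sum>i\<in>UNIV. a i * (- 2 / z - 12 * (x0 \<bullet> q i)\<^sup>2 / z\<^sup>2))
      + (\<Sum>i\<in>UNIV. a i * partial (q i) (partial (q i) w) x0) / w x0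
      + ((\<Sum>i\<in>UNIV. a i * (norm (grad (partial (q i) u) x0))\<^sup>2) + (\<Sum>i\<in>UNIV. a i * V i)) / N \<le> 0" .
  have s2: "- ((A * (w x0 + g) + B * (1 + M1 + P * w x0)\<^sup>2) / w x0)
      \<le> (\<Sum>i\<in>UNIV. a i * partial (q i) (partial (q i) w) x0) / w x0"
    unfolding minus_divide_left by (rule divide_right_mono[OF D2]) (use ws in simp)
  have s3: "T / (n + 1) * (w x0)\<^sup>2 / K \<le> (\<Sum>i\<in>UNIV. a i * (norm (grad (partial (q i) u) x0))\<^sup>2) / N"
  proof (rule frac_le[OF _ good])
    show "0 \<le> (\<Sum>i\<in>UNIV. a i * (norm (grad (partial (q i) u) x0))\<^sup>2)"
      using apos by (intro sum_nonneg) auto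
  qed (use N in auto)
  have s4: "- (n * M1 * (A * (1 + M1 + P * w x0))) \<le> (\<Sum>i\<in>UNIV. a i * V i) / N"
  proof -
    have nn: "0 \<le> n * M1 * (A * (1 + M1 + P * w x0))" using n M1' AB P ws by simp
    have "n * M1 * (A * (1 + M1 + P * w x0)) * 1 \<le> n * M1 * (A * (1 + M1 + P * w x0)) * N"
      using nn N(1) by (intro mult_left_mono)
    then have "- (n * M1 * (A * (1 + M1 + P * w x0))) * N \<le> (\<Sum>i\<in>UNIV. a i * V i)"
      using V by (simp only: mult_minus_left mult_1_right)
    then show ?thesis using N(1) by (simp add: pos_le_divide_eq)
  qed
  have "T / (n + 1) * (w x0)\<^sup>2 / K \<le> 28 * n * T / z\<^sup>2
      + (A * (w x0 + g) + B * (1 + M1 + P * w x0)\<^sup>2) / w x0 + n * M1 * (A * (1 + M1 + P * w x0))"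
    using sum0 cut s2 s3 s4 unfolding add_divide_distrib[of "sum _ _" "sum _ _"] by linarith
  from maximum_point_arithmetic[OF n _ _ _ z ws AB M1' P g this, of "n * max 1 M"] show ?thesis
    using T n unfolding w_def[symmetric] z_def[symmetric] K_def by (simp add: n_def[symmetric] mult.assoc)
qed

section \<open>Existence of the maximum and the interior bound\<close>

lemma maximum_pair_exists:
  fixes u :: "real^'n \<Rightarrow> real"
  assumes S: "open S" and u: "smooth_on S u" and X: "compact X" "X \<subseteq> S" "X \<noteq> {}"
    and K: "\<And>x. x \<in> S \<Longrightarrow> (norm (grad u x))\<^sup>2 < K"
  obtains x0 e where "x0 \<in> X" "norm e = 1"
    "\<forall>x\<in>X. \<forall>e'. norm e' = 1 \<longrightarrow>
      (R - (norm x)\<^sup>2) * partial e' (partial e' u) x / sqrt (K - (norm (grad u x))\<^sup>2)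
      \<le> (R - (norm x0)\<^sup>2) * partial e (partial e u) x0 / sqrt (K - (norm (grad u x0))\<^sup>2)"
proof -
  let ?Y = "X \<times> (sphere 0 1 :: (real^'n) set)"
  \<comment> \<open>Written in coordinates, since joint continuity in the point and the direction is
    not visible from \<open>partial e (partial e u)\<close>.\<close>
  define G where "G p = (R - (norm (fst p))\<^sup>2) * (\<Sum>i\<in>UNIV. \<Sum>j\<in>UNIV. snd p $ i * (partial (axis j 1) (partial (axis i 1) u) (fst p) * snd p $ j))
    / sqrt (K - (\<Sum>m\<in>UNIV. (partial (axis m 1) u (fst p))\<^sup>2))" for p :: "(real^'n) \<times> (real^'n)"
  have comp: "continuous_on ?Y (\<lambda>p. g (fst p))" if "smooth_on S g" for g
    by (rule continuous_on_compose2[OF smooth_on_continuous[OF that]]) (use X(2) in \<open>auto intro!: continuous_intros\<close>)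
  have grad: "(norm (grad u x))\<^sup>2 = (\<Sum>m\<in>UNIV. (partial (axis m 1) u x)\<^sup>2)" for x
    unfolding power2_norm_eq_inner inner_vec_def by (simp add: grad_def power2_eq_square)
  have "sqrt (K - (\<Sum>m\<in>UNIV. (partial (axis m 1) u (fst p))\<^sup>2)) \<noteq> 0" if "p \<in> ?Y" for p
    using K[of "fst p"] X(2) that unfolding grad by auto
  then have "continuous_on ?Y G"
    unfolding G_def
    by (intro continuous_intros comp smooth_partials[OF S u]) auto
  moreover have "compact ?Y" using X(1) by (intro compact_Times) auto
  moreover have "(axis undefined 1 :: real^'n) \<in> sphere 0 1" by simp
  then have "?Y \<noteq> {}" using X(3) by blast
  ultimately obtain p where p: "p \<in> ?Y" "\<forall>p'\<in>?Y. G p' \<le> G p"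
    using continuous_attains_sup[of ?Y G] by blast
  have G: "G (x, e) = (R - (norm x)\<^sup>2) * partial e (partial e u) x / sqrt (K - (norm (grad u x))\<^sup>2)"
    if "x \<in> X" for x e
    using inner_hess[OF S u subsetD[OF X(2) that], of e e, symmetric]
    by (simp add: G_def grad hess_def inner_vec_def matrix_vector_mult_def sum_distrib_left)
  show ?thesis
  proof (rule that[of "fst p" "snd p"])
    show "fst p \<in> X" "norm (snd p) = 1" using p(1) by auto
    then show "\<forall>x\<in>X. \<forall>e'. norm e' = 1 \<longrightarrow>
      (R - (norm x)\<^sup>2) * partial e' (partial e' u) x / sqrt (K - (norm (grad u x))\<^sup>2)
      \<le> (R - (norm (fst p))\<^sup>2) * partial (snd p) (partial (snd p) u) (fst p)
        / sqrt (K - (norm (grad u (fst p)))\<^sup>2)"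
      using p(2) G[symmetric] by auto
  qed
qed

theorem theorem1p6:
  fixes k l :: nat and f0 M M1 :: real
  assumes "1 \<le> k" and "k < CARD('n::finite)" and "l \<le> k - 1" and "f0 > 0"
  shows "\<exists>C>0. \<forall>(f :: (real^'n) \<times> real \<times> (real^'n) \<Rightarrow> real) (u :: real^'n \<Rightarrow> real).
     ( cont_diff 2 (ball 0 1 \<times> UNIV \<times> UNIV) f
     \<and> (\<forall>w\<in>ball 0 1 \<times> UNIV \<times> UNIV. f w \<ge> f0)
     \<and> C2_bounded_by (ball 0 1 \<times> UNIV \<times> UNIV) f M
     \<and> smooth_on (ball 0 1) u
     \<and> (\<forall>x\<in>ball 0 1. \<bar>u x\<bar> \<le> M1 \<and> norm (grad u x) \<le> M1)
     \<and> (\<forall>x\<in>ball 0 1. eigvals (eta u x) \<in> Gamma k)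
     \<and> (\<forall>x\<in>ball 0 1. sigma_mat k (eta u x) / sigma_mat l (eta u x) = f (x, u x, grad u x)))
     \<longrightarrow> (\<forall>x\<in>ball 0 (1/2). norm (hess u x) \<le> C)"
proof -
  define n where "n = real CARD('n)"
  define D where "D = real DIM((real^'n) \<times> real \<times> (real^'n))"
  define A where "A = D * M / f0"
  define B where "B = D\<^sup>2 * M / f0 + (D * M / f0)\<^sup>2"
  define P where "P = n ^ 3"
  define K where "K = M1\<^sup>2 + 1"
  define C1 where "C1 = (n + 1) * K * (28 * n + n * max 1 M * (A + 2 * A * n
      + (A * n * M1 * P + B * (1 + M1 + P)\<^sup>2 + n * M1 * A * (1 + M1 + P)))) + 1"
  \<comment> \<open>16/5 inverts the lower bound 9/16 - 1/4 = 5/16 of the cutoff on the half ball,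
    and K bounds the square root in the denominator of the test function.\<close>
  define C2 where "C2 = max 1 C1 * K * (16 / 5)"
  have n: "n \<ge> 1" unfolding n_def by (simp add: Suc_leI)
  have K1: "K \<ge> 1" by (simp add: K_def)
  have C2: "C2 \<ge> 0" using K1 by (simp add: C2_def)
  show ?thesis
  proof (intro exI[of _ "n\<^sup>2 * (n * C2) + 1"] conjI allI impI ballI)
    show "0 < n\<^sup>2 * (n * C2) + 1" using n C2 by (simp add: add_nonneg_pos)
    fix f :: "(real^'n) \<times> real \<times> (real^'n) \<Rightarrow> real" and u :: "real^'n \<Rightarrow> real"
    let ?S = "ball 0 1 :: (real^'n) set"
    assume *: "cont_diff 2 (?S \<times> UNIV \<times> UNIV) f
     \<and> (\<forall>w\<in>?S \<times> UNIV \<times> UNIV. f w \<ge> f0)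
     \<and> C2_bounded_by (?S \<times> UNIV \<times> UNIV) f M
     \<and> smooth_on ?S u
     \<and> (\<forall>x\<in>?S. \<bar>u x\<bar> \<le> M1 \<and> norm (grad u x) \<le> M1)
     \<and> (\<forall>x\<in>?S. eigvals (eta u x) \<in> Gamma k)
     \<and> (\<forall>x\<in>?S. sigma_mat k (eta u x) / sigma_mat l (eta u x) = f (x, u x, grad u x))"
    have f: "cont_diff 2 (?S \<times> UNIV \<times> UNIV) f" "C2_bounded_by (?S \<times> UNIV \<times> UNIV) f M"
      and f0: "\<And>w. w \<in> ?S \<times> UNIV \<times> UNIV \<Longrightarrow> f w \<ge> f0"
      and u: "smooth_on ?S u" and M1: "\<And>x. x \<in> ?S \<Longrightarrow> norm (grad u x) \<le> M1"
      and \<Gamma>: "\<And>x. x \<in> ?S \<Longrightarrow> eigvals (eta u x) \<in> Gamma k"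
      and eq: "\<And>x. x \<in> ?S \<Longrightarrow> sigma_mat k (eta u x) / sigma_mat l (eta u x) = f (x, u x, grad u x)"
      using * by blast+
    have kl: "l < k" "k < CARD('n)" using assms by auto
    have S: "open ?S" by simp
    have gradK: "(norm (grad u x))\<^sup>2 \<le> M1\<^sup>2" if "x \<in> ?S" for x
      using M1[OF that] by (intro power_mono) auto
    have sq: "1 \<le> sqrt (K - (norm (grad u x))\<^sup>2)" "sqrt (K - (norm (grad u x))\<^sup>2) \<le> K" if "x \<in> ?S" for x
    proof -
      have "K \<le> K\<^sup>2" using mult_left_mono[OF K1, of K] K1 by (simp add: power2_eq_square)
      then show "sqrt (K - (norm (grad u x))\<^sup>2) \<le> K"
        using K1 by (intro real_le_lsqrt) (auto intro: order_trans[of _ K])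
      show "1 \<le> sqrt (K - (norm (grad u x))\<^sup>2)"
        using gradK[OF that] by (simp add: K_def)
    qed
    have ltK: "(norm (grad u x))\<^sup>2 < K" if "x \<in> ?S" for x
      using gradK[OF that] by (simp add: K_def)
    have X: "compact (cball 0 (3/4) :: (real^'n) set)" "cball 0 (3/4) \<subseteq> ?S" "cball 0 (3/4) \<noteq> ({} :: (real^'n) set)"
      by auto
    obtain x0 e where x0: "x0 \<in> cball 0 (3/4)" and e: "norm e = 1"
      and max: "\<forall>x\<in>cball 0 (3/4). \<forall>e'. norm e' = 1 \<longrightarrow>
        (9/16 - (norm x)\<^sup>2) * partial e' (partial e' u) x / sqrt (K - (norm (grad u x))\<^sup>2)
        \<le> (9/16 - (norm x0)\<^sup>2) * partial e (partial e u) x0 / sqrt (K - (norm (grad u x0))\<^sup>2)"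
      by (rule maximum_pair_exists[OF S u X ltK])
    define G where "G x e' = (9/16 - (norm x)\<^sup>2) * partial e' (partial e' u) x / sqrt (K - (norm (grad u x))\<^sup>2)"
      for x e'
    have Gmax: "G x e' \<le> G x0 e" if "norm x \<le> 3/4" "norm e' = 1" for x e'
      using max that by (simp add: G_def)
    have x0S: "x0 \<in> ?S" using x0 by auto
    have sqx0: "1 \<le> sqrt (K - (norm (grad u x0))\<^sup>2)" by (rule sq(1)[OF x0S])
    have z0: "0 \<le> 9/16 - (norm x0)\<^sup>2"
      using power_mono[of "norm x0" "3/4" 2] x0 by (simp add: power2_eq_square)
    \<comment> \<open>A positive maximum excludes the sphere of radius 3/4, where the cutoff
      vanishes, so the maximum point is interior. If u_ee is below 1 there, the product with the
      cutoff is at most 1; this is the reason for \<open>max 1 C1\<close>.\<close>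
    have Gx0: "G x0 e \<le> max 1 C1"
    proof (cases "G x0 e > 0")
      case True
      have "0 < (9/16 - (norm x0)\<^sup>2) * partial e (partial e u) x0"
        using True sqx0 by (simp add: G_def zero_less_divide_iff)
      then have pos: "0 < 9/16 - (norm x0)\<^sup>2" "0 < partial e (partial e u) x0"
        using z0 by (auto simp: zero_less_mult_iff)
      have "(9/16 - (norm x0)\<^sup>2) * partial e (partial e u) x0 \<le> max 1 C1"
      proof (cases "partial e (partial e u) x0 \<ge> 1")
        case w1: True
        have max_e: "partial e' (partial e' u) x0 \<le> partial e (partial e u) x0" if "norm e' = 1" for e'
        proof -
          have "G x0 e' \<le> G x0 e" using x0 that by (intro Gmax) auto
          then have "(9/16 - (norm x0)\<^sup>2) * partial e' (partial e' u) x0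
              \<le> (9/16 - (norm x0)\<^sup>2) * partial e (partial e u) x0"
            using sqx0 by (simp add: G_def divide_le_cancel)
          then show ?thesis using pos(1) by (rule mult_left_le_imp_le)
        qed
        \<comment> \<open>The estimate compares with all points of the unit ball where the cutoff is
          positive; these lie in the closed ball of radius 3/4 over which the maximum was
          taken.\<close>
        have max_x: "(9/16 - (norm x)\<^sup>2) * partial e (partial e u) x / sqrt (M1\<^sup>2 + 1 - (norm (grad u x))\<^sup>2)
          \<le> (9/16 - (norm x0)\<^sup>2) * partial e (partial e u) x0 / sqrt (M1\<^sup>2 + 1 - (norm (grad u x0))\<^sup>2)"
          if "9/16 - (norm x)\<^sup>2 > 0" for x
        proof -
          have "(norm x)\<^sup>2 \<le> (3/4)\<^sup>2" using that by (simp add: power2_eq_square)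
          then have "norm x \<le> 3/4" by (rule power2_le_imp_le) simp
          from Gmax[OF this e] show ?thesis by (simp add: G_def K_def)
        qed
        have "(9/16 - (norm x0)\<^sup>2) * partial e (partial e u) x0 \<le> C1"
          unfolding C1_def K_def n_def A_def B_def D_def P_def
          by (rule maximum_point_estimate[OF S order_refl u x0S \<Gamma> kl eq f \<open>f0 > 0\<close> f0 M1 _ pos(1) e max_e max_x w1]) auto
        then show ?thesis by simp
      next
        case False
        have "9/16 - (norm x0)\<^sup>2 \<le> 1" using zero_le_power2[of "norm x0"] by linarith
        then have "(9/16 - (norm x0)\<^sup>2) * partial e (partial e u) x0 \<le> 1 * 1"
          using False pos by (intro mult_mono) auto
        then show ?thesis by simp
      qed
      moreover have "G x0 e \<le> (9/16 - (norm x0)\<^sup>2) * partial e (partial e u) x0"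
      proof -
        have "(9/16 - (norm x0)\<^sup>2) * partial e (partial e u) x0 * 1
            \<le> (9/16 - (norm x0)\<^sup>2) * partial e (partial e u) x0 * sqrt (K - (norm (grad u x0))\<^sup>2)"
          using pos sqx0 by (intro mult_left_mono) auto
        then show ?thesis unfolding G_def using sqx0 by (simp add: divide_le_eq)
      qed
      ultimately show ?thesis by linarith
    qed (simp add: max_def)
    fix x assume x: "x \<in> ball (0 :: real^'n) (1/2)"
    then have xS: "x \<in> ?S" by auto
    have pure: "e' \<bullet> (hess u x *v e') \<le> C2" if e': "norm e' = 1" for e'
    proof (rule ccontr)
      assume "\<not> ?thesis"
      then have gt: "partial e' (partial e' u) x > C2" by (simp add: inner_hess[OF S u xS])
      define v where "v = partial e' (partial e' u) x"
      have v: "v > C2" "v > 0" using gt C2 by (auto simp: v_def)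
      have "(norm x)\<^sup>2 \<le> (1/2)\<^sup>2" using x by (intro power_mono) auto
      then have "5/16 \<le> 9/16 - (norm x)\<^sup>2" by (simp add: power2_eq_square)
      then have "5/16 * v \<le> (9/16 - (norm x)\<^sup>2) * v" using v by (intro mult_right_mono) auto
      moreover have "(9/16 - (norm x)\<^sup>2) * v \<le> max 1 C1 * sqrt (K - (norm (grad u x))\<^sup>2)"
      proof -
        have "G x e' \<le> max 1 C1" using Gmax[of x e'] e' x Gx0 by auto
        then show ?thesis using sq(1)[OF xS] by (simp add: G_def v_def divide_le_eq)
      qed
      moreover have "max 1 C1 * sqrt (K - (norm (grad u x))\<^sup>2) \<le> max 1 C1 * K"
        using sq(2)[OF xS] by (intro mult_left_mono) auto
      ultimately have "5/16 * v \<le> max 1 C1 * K" by linarith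
      then show False using v by (simp add: C2_def)
    qed
    have lap: "0 \<le> (\<Sum>i\<in>UNIV. hess u x $ i $ i)"
      using laplacian_pos[OF S u xS \<Gamma>[OF xS] \<open>1 \<le> k\<close>] by (simp add: laplacian_def)
    have "\<bar>hess u x $ i $ j\<bar> \<le> n * C2" for i j
      unfolding n_def by (rule hess_entry_bound[OF transpose_hess[OF S u xS] lap pure])
    from norm_matrix_entry_bound[OF this] show "norm (hess u x) \<le> n\<^sup>2 * (n * C2) + 1"
      by (simp add: n_def)
  qed
qed

end
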